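(* Let $\mathbb V$ be a finite-dimensional real vector space with a non-degenerate inner product $\langle\,,\,\rangle$ of signature $s$, and let $G$ be a Lie subgroup of $SO(\mathbb V)$. Assume that there exists an algebraic pseudo-Riemannian curvature tensor $R$ of $\mathbb V$ such that the curvature endomorphisms $R_{u,v}$, $u,v\in\mathbb V$, linearly span the Lie algebra $\mathfrak g$ of $G$. Furthermore, assume that $R$, regarded as a symmetric endomorphism of $\Lambda^2(\mathbb V)$, is positive semi-definite, that is, $\langle R(u),u\rangle\ge 0$ for all $u\in\Lambda^2(\mathbb V)$, and if $\langle R(u),u\rangle=0$ then $R(u)=0$. Let $N$ be a non-degenerate submanifold of $\mathbb V$ which is locally invariant under the action of $G$. Then: (i) $G$ acts weakly polarly on $N$. (ii) $T_q(G\cdot q)$ is invariant under any shape operator of $N$ at $q$, for all $q\in\Omega$, where $\Omega$ is the open and dense subset of $N$ where the dimensions of the $G$-orbits are locally constant.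
   Context: An algebraic pseudo-Riemannian curvature tensor is a trilinear map $(u,v,w)\mapsto R_{u,v}w$ satisfying all the algebraic identities of a pseudo-Riemannian curvature tensor (skew-symmetry of $R_{u,v}$ in $u,v$, $R_{u,v}\in\mathfrak{so}(\mathbb V)$, the first Bianchi identity, hence pair symmetry). $\Lambda^2(\mathbb V)$ carries the inner product $\langle x\wedge y,w\wedge z\rangle=2(\langle x,w\rangle\langle y,z\rangle-\langle x,z\rangle\langle y,w\rangle)$, and $R$ is regarded as an endomorphism of $\Lambda^2(\mathbb V)$ via $\langle R(u\wedge v),w\wedge z\rangle=\langle R_{u,v}w,z\rangle$. A submanifold is non-degenerate if the induced metric is non-degenerate. Let $G$ act (locally) by isometries on a pseudo-Riemannian manifold $N$, and let $\Omega$ be the open dense subset where the dimension of the $G$-orbits is locally constant. Let $\mathcal V$ be the distribution on $\Omega$ of tangent spaces to the $G$-orbits and $\mathcal H:=\mathcal V^\perp$ its orthogonal complement in $TN$ (possibly $\mathcal V_q\cap\mathcal H_q\ne 0$). $G$ acts weakly polarly on $N$ if $\mathcal H$ is integrable on $\Omega$. *)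

theory Defs
  imports "HOL-Analysis.Analysis"
begin

section \<open>Smooth maps\<close>

text \<open>Intended for open S and maps between finite-dimensional spaces, where class \<open>C^k\<close> amounts
  to k-fold continuous differentiability of all directional derivatives.\<close>

primrec Ck_on :: "nat \<Rightarrow> 'e::real_normed_vector set \<Rightarrow> ('e \<Rightarrow> 'f::real_normed_vector) \<Rightarrow> bool" where
  "Ck_on 0 S f \<longleftrightarrow> continuous_on S f"
| "Ck_on (Suc k) S f \<longleftrightarrow>
     (\<forall>x\<in>S. f differentiable (at x)) \<and> (\<forall>v. Ck_on k S (\<lambda>x. frechet_derivative f (at x) v))"

definition smooth_on :: "'e::real_normed_vector set \<Rightarrow> ('e \<Rightarrow> 'f::real_normed_vector) \<Rightarrow> bool" where
  "smooth_on S f \<longleftrightarrow> (\<forall>k. Ck_on k S f)"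


section \<open>Submanifolds of a finite-dimensional vector space\<close>

definition embedded_submanifold :: "nat \<Rightarrow> 'e::real_normed_vector set \<Rightarrow> bool" where
  "embedded_submanifold k S \<longleftrightarrow>
     (\<forall>p\<in>S. \<exists>U V \<phi> \<psi> (W :: 'e set). open U \<and> p \<in> U \<and> open V \<and> homeomorphism U V \<phi> \<psi> \<and>
        smooth_on U \<phi> \<and> smooth_on V \<psi> \<and>
        subspace W \<and> dim W = k \<and> \<phi> ` (S \<inter> U) = W \<inter> V)"

text \<open>An (injectively immersed, not necessarily embedded) submanifold is encoded by its intrinsic
  manifold topology T: its underlying set is the topspace of T, and T may be finer than the subspace
  topology. Locally for T it is an embedded submanifold, which also determines the smooth
  structure. The inclusion is continuous, so the Hausdorff property is automatic. Embedded
  submanifolds S are the case in which T is \<open>top_of_set S\<close>.\<close>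

definition submanifold :: "nat \<Rightarrow> 'e::real_normed_vector topology \<Rightarrow> bool" where
  "submanifold k T \<longleftrightarrow> second_countable T \<and>
     (\<forall>p\<in>topspace T. \<exists>U. openin T U \<and> p \<in> U \<and> embedded_submanifold k U \<and>
        subtopology T U = top_of_set U)"

text \<open>Velocities of curves that are smooth as curves in the submanifold, i.e. smooth in the ambient
  space and continuous for the manifold topology.\<close>

definition tangent_space :: "'e::real_normed_vector topology \<Rightarrow> 'e \<Rightarrow> 'e set" where
  "tangent_space T p = {v. \<exists>c e. e > 0 \<and> c 0 = p \<and> smooth_on {-e<..<e} c \<and>
     continuous_map (top_of_set {-e<..<e}) T c \<and> (c has_vector_derivative v) (at (0::real))}"

text \<open>Integrability of a distribution D on an open subset \<open>\<Omega>\<close> of a submanifold N: through every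
  point of \<open>\<Omega>\<close> there passes an integral manifold.\<close>

definition integrable_distribution ::
  "'e::real_normed_vector topology \<Rightarrow> 'e set \<Rightarrow> ('e \<Rightarrow> 'e set) \<Rightarrow> bool" where
  "integrable_distribution N \<Omega> D \<longleftrightarrow>
     (\<forall>q\<in>\<Omega>. \<exists>k L. submanifold k L \<and> q \<in> topspace L \<and> topspace L \<subseteq> \<Omega> \<and>
        continuous_map L N id \<and> (\<forall>x\<in>topspace L. tangent_space L x = D x))"


section \<open>Inner products of arbitrary signature\<close>

text \<open>The vector space is a type of class \<open>euclidean_space\<close>; its built-in Euclidean structure serves
  only as a source of topology and of a reference basis. The inner product of the mathematics
  is an arbitrary form g.\<close>

definition nondegenerate_on :: "('a::euclidean_space \<Rightarrow> 'a \<Rightarrow> real) \<Rightarrow> 'a set \<Rightarrow> bool" where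
  "nondegenerate_on g W \<longleftrightarrow> (\<forall>u\<in>W. (\<forall>v\<in>W. g u v = 0) \<longrightarrow> u = 0)"

definition pseudo_inner :: "('a::euclidean_space \<Rightarrow> 'a \<Rightarrow> real) \<Rightarrow> bool" where
  "pseudo_inner g \<longleftrightarrow> bilinear g \<and> (\<forall>u v. g u v = g v u) \<and> nondegenerate_on g UNIV"

text \<open>The signature is recorded by the maximal dimension of a negative definite subspace.\<close>

definition signature :: "('a::euclidean_space \<Rightarrow> 'a \<Rightarrow> real) \<Rightarrow> nat" where
  "signature g = Max {dim W |W. subspace W \<and> (\<forall>w\<in>W. w \<noteq> 0 \<longrightarrow> g w w < 0)}"

definition g_orthogonal :: "('a::euclidean_space \<Rightarrow> 'a \<Rightarrow> real) \<Rightarrow> 'a set \<Rightarrow> 'a set" where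
  "g_orthogonal g W = {v. \<forall>w\<in>W. g v w = 0}"

text \<open>The Leibniz formula in the basis \<open>Basis\<close>.\<close>

definition endo_det :: "('a::euclidean_space \<Rightarrow>\<^sub>L 'a) \<Rightarrow> real" where
  "endo_det A = (\<Sum>p | p permutes Basis. of_int (sign p) * (\<Prod>b\<in>Basis. blinfun_apply A b \<bullet> p b))"

definition SO :: "('a::euclidean_space \<Rightarrow> 'a \<Rightarrow> real) \<Rightarrow> ('a \<Rightarrow>\<^sub>L 'a) set" where
  "SO g = {A. (\<forall>u v. g (blinfun_apply A u) (blinfun_apply A v) = g u v) \<and> endo_det A = 1}"


section \<open>Lie subgroups of \<open>SO(g)\<close>\<close>

text \<open>A Lie subgroup is a subgroup carrying the structure of an immersed submanifold for which the
  group operations are smooth. They are restrictions of smooth maps of the ambient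
  space, so smoothness amounts to continuity for the manifold topology.\<close>

definition lie_subgroup_SO ::
  "('a::euclidean_space \<Rightarrow> 'a \<Rightarrow> real) \<Rightarrow> ('a \<Rightarrow>\<^sub>L 'a) topology \<Rightarrow> bool" where
  "lie_subgroup_SO g G \<longleftrightarrow>
     (\<exists>k. submanifold k G) \<and> topspace G \<subseteq> SO g \<and> id_blinfun \<in> topspace G \<and>
     (\<forall>A\<in>topspace G. \<forall>B\<in>topspace G. A o\<^sub>L B \<in> topspace G) \<and>
     (\<forall>A\<in>topspace G. Blinfun (inv (blinfun_apply A)) \<in> topspace G) \<and>
     continuous_map (prod_topology G G) G (\<lambda>(A, B). A o\<^sub>L B) \<and>
     continuous_map G G (\<lambda>A. Blinfun (inv (blinfun_apply A)))"

definition lie_algebra :: "('a::euclidean_space \<Rightarrow>\<^sub>L 'a) topology \<Rightarrow> ('a \<Rightarrow>\<^sub>L 'a) set" where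
  "lie_algebra G = tangent_space G id_blinfun"

text \<open>The tangent space at q of the orbit through q. The orbit is the immersed submanifold parametrized
  by the orbit map \<open>A \<mapsto> A q\<close>, so this is the image of the differential of
  that map at the identity.\<close>

definition orbit_tangent :: "('a::euclidean_space \<Rightarrow>\<^sub>L 'a) topology \<Rightarrow> 'a \<Rightarrow> 'a set" where
  "orbit_tangent G q =
     frechet_derivative (\<lambda>A. blinfun_apply A q) (at id_blinfun) ` tangent_space G id_blinfun"

text \<open>The linear action restricts to a local action of G on N; continuity is for the manifold
  topologies, and is automatic when N is embedded.\<close>

definition locally_invariant ::
  "('a::euclidean_space \<Rightarrow>\<^sub>L 'a) topology \<Rightarrow> 'a topology \<Rightarrow> bool" where
  "locally_invariant G N \<longleftrightarrow>
     (\<forall>q\<in>topspace N. \<exists>U W. openin G U \<and> id_blinfun \<in> U \<and> openin N W \<and> q \<in> W \<and>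
        continuous_map (prod_topology (subtopology G U) (subtopology N W)) N
          (\<lambda>(A, x). blinfun_apply A x))"

definition regular_set :: "('a::euclidean_space \<Rightarrow>\<^sub>L 'a) topology \<Rightarrow> 'a topology \<Rightarrow> 'a set" where
  "regular_set G N = {q \<in> topspace N. \<exists>W. openin N W \<and> q \<in> W \<and>
     (\<forall>x\<in>W. dim (orbit_tangent G x) = dim (orbit_tangent G q))}"

definition horizontal_space :: "('a::euclidean_space \<Rightarrow> 'a \<Rightarrow> real) \<Rightarrow>
    ('a \<Rightarrow>\<^sub>L 'a) topology \<Rightarrow> 'a topology \<Rightarrow> 'a \<Rightarrow> 'a set" where
  "horizontal_space g G N q = tangent_space N q \<inter> g_orthogonal g (orbit_tangent G q)"

definition weakly_polar :: "('a::euclidean_space \<Rightarrow> 'a \<Rightarrow> real) \<Rightarrow>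
    ('a \<Rightarrow>\<^sub>L 'a) topology \<Rightarrow> 'a topology \<Rightarrow> bool" where
  "weakly_polar g G N \<longleftrightarrow>
     integrable_distribution N (regular_set G N) (horizontal_space g G N)"


section \<open>Bivectors and algebraic curvature tensors\<close>

text \<open>The exterior square is realized inside the tensor square by \<open>x \<and> y = x \<otimes> y - y \<otimes> x\<close>, where
  \<open>x \<otimes> y\<close> is identified with the endomorphism \<open>z \<mapsto> (x \<bullet> z) y\<close> through the reference inner
  product.\<close>

definition wedge :: "'a::euclidean_space \<Rightarrow> 'a \<Rightarrow> 'a \<Rightarrow>\<^sub>L 'a" where
  "wedge x y = Blinfun (\<lambda>z. (x \<bullet> z) *\<^sub>R y - (y \<bullet> z) *\<^sub>R x)"

definition bivectors :: "('a::euclidean_space \<Rightarrow>\<^sub>L 'a) set" where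
  "bivectors = span {wedge x y |x y. True}"

text \<open>The restriction of the tensor square of g; its values on decomposable bivectors are given by
  \<open>biv_inner_wedge\<close> below.\<close>

definition biv_inner ::
  "('a::euclidean_space \<Rightarrow> 'a \<Rightarrow> real) \<Rightarrow> ('a \<Rightarrow>\<^sub>L 'a) \<Rightarrow> ('a \<Rightarrow>\<^sub>L 'a) \<Rightarrow> real" where
  "biv_inner g \<alpha> \<beta> =
     (\<Sum>b\<in>Basis. \<Sum>c\<in>Basis. g b c * g (blinfun_apply \<alpha> b) (blinfun_apply \<beta> c))"

lemma wedge_apply: "blinfun_apply (wedge x y) z = (x \<bullet> z) *\<^sub>R y - (y \<bullet> z) *\<^sub>R x"
proof -
  have "bounded_linear (\<lambda>z. (x \<bullet> z) *\<^sub>R y - (y \<bullet> z) *\<^sub>R x)"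
    by (intro bounded_linear_intros)
  then show ?thesis
    by (simp add: wedge_def bounded_linear_Blinfun_apply)
qed

lemma bilinear_expand:
  assumes "bilinear (g :: 'a::euclidean_space \<Rightarrow> 'a \<Rightarrow> real)"
  shows "(\<Sum>b\<in>Basis. \<Sum>c\<in>Basis. g b c * ((x \<bullet> b) * (y \<bullet> c))) = g x y"
proof -
  have lin: "linear (\<lambda>u. g u v)" "linear (g v)" for v
    using assms by (auto simp: bilinear_def)
  have "g x y = g (\<Sum>b\<in>Basis. (x \<bullet> b) *\<^sub>R b) y"
    by (simp add: euclidean_representation)
  also have "\<dots> = (\<Sum>b\<in>Basis. (x \<bullet> b) * g b y)"
    by (simp only: linear_sum[OF lin(1)] linear_cmul[OF lin(1)] real_scaleR_def)
  also have "\<dots> = (\<Sum>b\<in>Basis. (x \<bullet> b) * g b (\<Sum>c\<in>Basis. (y \<bullet> c) *\<^sub>R c))"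
    by (simp add: euclidean_representation)
  also have "\<dots> = (\<Sum>b\<in>Basis. (x \<bullet> b) * (\<Sum>c\<in>Basis. (y \<bullet> c) * g b c))"
    by (simp only: linear_sum[OF lin(2)] linear_cmul[OF lin(2)] real_scaleR_def)
  finally show ?thesis
    by (simp add: sum_distrib_left mult_ac)
qed

lemma biv_inner_wedge:
  assumes "bilinear g" "\<And>u v. g u v = g v u"
  shows "biv_inner g (wedge x y) (wedge w z) = 2 * (g x w * g y z - g x z * g y w)"
proof -
  have lin: "linear (\<lambda>u. g u v)" "linear (g v)" for v
    using assms(1) by (auto simp: bilinear_def)
  have "biv_inner g (wedge x y) (wedge w z) =
    (\<Sum>b\<in>Basis. \<Sum>c\<in>Basis.
       g b c * ((x \<bullet> b) * (w \<bullet> c)) * g y z - g b c * ((x \<bullet> b) * (z \<bullet> c)) * g y w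
     - g b c * ((y \<bullet> b) * (w \<bullet> c)) * g x z + g b c * ((y \<bullet> b) * (z \<bullet> c)) * g x w)"
    by (simp add: biv_inner_def wedge_apply linear_diff[OF lin(1)] linear_diff[OF lin(2)]
        linear_cmul[OF lin(1)] linear_cmul[OF lin(2)] algebra_simps)
  also have "\<dots> = g x w * g y z - g x z * g y w - g y w * g x z + g y z * g x w"
    by (simp only: sum.distrib sum_subtractf sum_distrib_right[symmetric]
        bilinear_expand[OF assms(1)])
  finally show ?thesis by (simp add: mult.commute)
qed

definition algebraic_curvature_tensor ::
  "('a::euclidean_space \<Rightarrow> 'a \<Rightarrow> real) \<Rightarrow> ('a \<Rightarrow> 'a \<Rightarrow> 'a \<Rightarrow> 'a) \<Rightarrow> bool" where
  "algebraic_curvature_tensor g R \<longleftrightarrow>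
     (\<forall>v w. linear (\<lambda>u. R u v w)) \<and> (\<forall>u w. linear (\<lambda>v. R u v w)) \<and> (\<forall>u v. linear (R u v)) \<and>
     (\<forall>u v w. R u v w = - R v u w) \<and>
     (\<forall>u v w z. g (R u v w) z = - g w (R u v z)) \<and>
     (\<forall>u v w. R u v w + R v w u + R w u v = 0)"

text \<open>F is the endomorphism of the exterior square determined by R; only its values on \<open>bivectors\<close>
  matter, and these are uniquely determined by R since \<open>biv_inner g\<close> is non-degenerate there.\<close>

definition is_curvature_operator :: "('a::euclidean_space \<Rightarrow> 'a \<Rightarrow> real) \<Rightarrow>
    ('a \<Rightarrow> 'a \<Rightarrow> 'a \<Rightarrow> 'a) \<Rightarrow> (('a \<Rightarrow>\<^sub>L 'a) \<Rightarrow> ('a \<Rightarrow>\<^sub>L 'a)) \<Rightarrow> bool" where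
  "is_curvature_operator g R F \<longleftrightarrow>
     F ` bivectors \<subseteq> bivectors \<and>
     (\<forall>\<alpha>\<in>bivectors. \<forall>\<beta>\<in>bivectors. F (\<alpha> + \<beta>) = F \<alpha> + F \<beta>) \<and>
     (\<forall>r. \<forall>\<alpha>\<in>bivectors. F (r *\<^sub>R \<alpha>) = r *\<^sub>R F \<alpha>) \<and>
     (\<forall>u v w z. biv_inner g (F (wedge u v)) (wedge w z) = g (R u v w) z)"

definition psd_curvature_operator ::
  "('a::euclidean_space \<Rightarrow> 'a \<Rightarrow> real) \<Rightarrow> (('a \<Rightarrow>\<^sub>L 'a) \<Rightarrow> ('a \<Rightarrow>\<^sub>L 'a)) \<Rightarrow> bool" where
  "psd_curvature_operator g F \<longleftrightarrow>
     (\<forall>\<alpha>\<in>bivectors. biv_inner g (F \<alpha>) \<alpha> \<ge> 0 \<and> (biv_inner g (F \<alpha>) \<alpha> = 0 \<longrightarrow> F \<alpha> = 0))"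


section \<open>Shape operators\<close>

definition nondegenerate_submanifold ::
  "('a::euclidean_space \<Rightarrow> 'a \<Rightarrow> real) \<Rightarrow> 'a topology \<Rightarrow> bool" where
  "nondegenerate_submanifold g N \<longleftrightarrow>
     (\<exists>k. submanifold k N) \<and> (\<forall>q\<in>topspace N. nondegenerate_on g (tangent_space N q))"

definition normal_vectors ::
  "('a::euclidean_space \<Rightarrow> 'a \<Rightarrow> real) \<Rightarrow> 'a topology \<Rightarrow> 'a \<Rightarrow> 'a set" where
  "normal_vectors g N q = g_orthogonal g (tangent_space N q)"

definition tangential_part ::
  "('a::euclidean_space \<Rightarrow> 'a \<Rightarrow> real) \<Rightarrow> 'a topology \<Rightarrow> 'a \<Rightarrow> 'a \<Rightarrow> 'a" where
  "tangential_part g N q v = (THE t. t \<in> tangent_space N q \<and> v - t \<in> normal_vectors g N q)"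

text \<open>A smooth normal field of N near q, given by a smooth extension to an ambient neighbourhood.\<close>

definition local_normal_field ::
  "('a::euclidean_space \<Rightarrow> 'a \<Rightarrow> real) \<Rightarrow> 'a topology \<Rightarrow> 'a \<Rightarrow> ('a \<Rightarrow> 'a) \<Rightarrow> bool" where
  "local_normal_field g N q \<eta> \<longleftrightarrow>
     (\<exists>O' W. open O' \<and> openin N W \<and> q \<in> W \<and> W \<subseteq> O' \<and> smooth_on O' \<eta> \<and>
        (\<forall>x\<in>W. \<eta> x \<in> normal_vectors g N x))"

text \<open>The Weingarten formula \<open>A\<^sub>\<xi> X = - (D\<^sub>X \<eta>)\<^sup>T\<close> for a normal field \<open>\<eta>\<close> with \<open>\<eta> q = \<xi>\<close>; for X tangent to N
  at q the value is independent of the choice of \<open>\<eta>\<close>.\<close>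

definition shape_operator :: "('a::euclidean_space \<Rightarrow> 'a \<Rightarrow> real) \<Rightarrow> 'a topology \<Rightarrow>
    'a \<Rightarrow> 'a \<Rightarrow> 'a \<Rightarrow> 'a" where
  "shape_operator g N q \<xi> X =
     (let \<eta> = (SOME \<eta>. local_normal_field g N q \<eta> \<and> \<eta> q = \<xi>)
      in - tangential_part g N q (frechet_derivative \<eta> (at q) X))"

end

theory Submission
  imports Defs
begin

text \<open>Write \<open>V\<^sub>q\<close> for the tangent space of the orbit through q, \<open>K\<^sub>q\<close> for its g-orthogonal complement in
the whole vector space, and \<open>H\<^sub>q\<close> for the intersection of \<open>K\<^sub>q\<close> with the tangent space of N. Since
the curvature endomorphisms span the Lie algebra, pair symmetry gives that y lies in \<open>K\<^sub>q\<close> exactly if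
\<open>R q y = 0\<close>. The theorem rests on one pointwise fact, valid where the orbit dimension is locally
constant: every A in the Lie algebra maps \<open>H\<^sub>q\<close> into \<open>V\<^sub>q\<close> (\<open>lie_algebra_maps_horizontal_to_orbit\<close>).

For h in \<open>H\<^sub>q\<close> and y in \<open>K\<^sub>q\<close> the Bianchi identity yields \<open>R h y q = 0\<close>, so \<open>A = R h y\<close> annihilates q. If c
is a curve in N starting at q with velocity h, then \<open>A (c t) / t\<close> is tangent to the orbit through
\<open>c t\<close> and converges to \<open>A h\<close>. The orbit tangent spaces have constant dimension near q, hence depend
continuously on the point, and so \<open>A h\<close> lies in \<open>V\<^sub>q\<close>
(\<open>isotropy_maps_tangent_to_orbit\<close>). Therefore \<open>g (R h y h) y = 0\<close>, and semi-definiteness of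
the curvature operator forces \<open>R h y = 0\<close>. By pair symmetry every \<open>R u v h\<close> is then orthogonal to
\<open>K\<^sub>q\<close>, that is, contained in \<open>V\<^sub>q\<close>.

Invariance of \<open>V\<^sub>q\<close> under shape operators follows by differentiating \<open>g (\<eta> (\<alpha> t q)) (\<alpha> t h) = 0\<close> for a
normal field \<open>\<eta>\<close> and a curve \<open>\<alpha>\<close> in G with velocity A at the identity: the derivative of \<open>\<eta>\<close> in the
direction \<open>A q\<close> pairs with h to \<open>- g (\<eta> q) (A h)\<close>, which vanishes because \<open>A h\<close> is tangent to N. So
the tangential part of that derivative is orthogonal to \<open>H\<^sub>q\<close>, hence lies in \<open>V\<^sub>q\<close>.

For integrability of H no appeal to the theorem of Frobenius is made, because the leaves can be written
down. Along a curve tangent to H the velocity of \<open>A c\<close> is \<open>A c'\<close>, which stays in the orbit tangent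
space; so the orbit tangent space is constant along a leaf, and the leaf through q must lie in the
linear subspace \<open>K\<^sub>q\<close>. Conversely, \<open>K\<^sub>q\<close> is transversal to N at q because the tangent space is
nondegenerate, and so the intersection of N with \<open>K\<^sub>q\<close> is a submanifold near q
(\<open>projection_adapted_chart\<close>, \<open>submanifold_chart_slice\<close>). Its tangent spaces are horizontal as soon as
\<open>V\<^sub>x = V\<^sub>q\<close> for all its points x. A vector tangent to the slice at x is horizontal up to an error
controlled by the deviation of \<open>V\<^sub>x\<close> from \<open>V\<^sub>q\<close>; so along curves in the slice this deviation satisfies a linear
differential inequality with initial value 0, and it vanishes by Gronwall's argument
(\<open>orbit_tangent_constant_on_slice\<close>).\<close>

section \<open>Calculus of smooth maps\<close>

lemma Ck_on_subset: "Ck_on k S f \<Longrightarrow> S' \<subseteq> S \<Longrightarrow> Ck_on k S' f"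
  by (induction k arbitrary: f) (auto intro: continuous_on_subset)

lemma Ck_on_SucD: "Ck_on (Suc k) S f \<Longrightarrow> Ck_on k S f"
proof (induction k arbitrary: f)
  case 0
  then show ?case
    by (auto intro!: continuous_at_imp_continuous_on differentiable_imp_continuous_within)
next
  case (Suc k)
  then show ?case by (metis Ck_on.simps(2))
qed

lemma Ck_on_cong:
  assumes "open S" "\<And>x. x \<in> S \<Longrightarrow> f x = h x" "Ck_on k S f"
  shows "Ck_on k S h"
  using assms(2,3)
proof (induction k arbitrary: f h)
  case 0
  then show ?case by (auto cong: continuous_on_cong)
next
  case (Suc k)
  have d: "(h has_derivative frechet_derivative f (at x)) (at x)" if "x \<in> S" for x
  proof (rule has_derivative_transform_within_open[OF _ assms(1) that])
    show "(f has_derivative frechet_derivative f (at x)) (at x)"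
      using Suc.prems(2) that by (simp add: frechet_derivative_works)
  qed (use Suc.prems(1) in auto)
  have "Ck_on k S (\<lambda>x. frechet_derivative h (at x) v)" for v
  proof (rule Suc.IH)
    show "Ck_on k S (\<lambda>x. frechet_derivative f (at x) v)" using Suc.prems(2) by simp
  qed (simp add: frechet_derivative_at[OF d, symmetric])
  then show ?case using Derivative.differentiableI[OF d] by simp
qed

lemma Ck_on_SucI:
  assumes "open S" "\<And>x. x \<in> S \<Longrightarrow> (f has_derivative D x) (at x)" "\<And>v. Ck_on k S (\<lambda>x. D x v)"
  shows "Ck_on (Suc k) S f"
proof -
  have "Ck_on k S (\<lambda>x. frechet_derivative f (at x) v)" for v
    by (rule Ck_on_cong[OF assms(1) _ assms(3)[of v]]) (simp add: frechet_derivative_at[OF assms(2), symmetric])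
  then show ?thesis using Derivative.differentiableI[OF assms(2)] by simp
qed

lemma Ck_on_has_derivative:
  "Ck_on (Suc k) S f \<Longrightarrow> x \<in> S \<Longrightarrow> (f has_derivative frechet_derivative f (at x)) (at x)"
  by (simp add: frechet_derivative_works)

lemma Ck_on_const: "Ck_on k S (\<lambda>x. c)"
  by (induction k arbitrary: c) auto

lemma Ck_on_bounded_linear:
  assumes "open S" "bounded_linear L" "Ck_on k S f"
  shows "Ck_on k S (\<lambda>x. L (f x))"
  using assms(3)
proof (induction k arbitrary: f)
  case 0
  then show ?case using bounded_linear.continuous_on[OF assms(2)] by auto
next
  case (Suc k)
  show ?case
    by (rule Ck_on_SucI[OF assms(1) bounded_linear.has_derivative[OF assms(2) Ck_on_has_derivative[OF Suc.prems]]])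
       (use Suc in auto)
qed

lemma Ck_on_add:
  assumes "open S" "Ck_on k S f" "Ck_on k S h"
  shows "Ck_on k S (\<lambda>x. f x + h x)"
  using assms(2,3)
proof (induction k arbitrary: f h)
  case 0
  then show ?case by (auto intro: continuous_on_add)
next
  case (Suc k)
  show ?case
    by (rule Ck_on_SucI[OF assms(1) has_derivative_add[OF Ck_on_has_derivative[OF Suc.prems(1)] Ck_on_has_derivative[OF Suc.prems(2)]]])
       (use Suc in auto)
qed

lemma Ck_on_minus:
  assumes "open S" "Ck_on k S f"
  shows "Ck_on k S (\<lambda>x. - f x)"
  using Ck_on_bounded_linear[OF assms(1) _ assms(2), of uminus]
  by (simp add: bounded_linear_minus bounded_linear_ident)

lemma Ck_on_diff:
  assumes "open S" "Ck_on k S f" "Ck_on k S h"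
  shows "Ck_on k S (\<lambda>x. f x - h x)"
  using Ck_on_add[OF assms(1,2) Ck_on_minus[OF assms(1,3)]] by simp

lemma Ck_on_sum:
  assumes "open S" "\<And>i. i \<in> I \<Longrightarrow> Ck_on k S (f i)"
  shows "Ck_on k S (\<lambda>x. \<Sum>i\<in>I. f i x)"
  using assms(2)
  by (induction I rule: infinite_finite_induct) (auto intro: Ck_on_const Ck_on_add[OF assms(1)])

lemma Ck_on_scaleR:
  fixes f :: "'e::real_normed_vector \<Rightarrow> real"
  assumes "open S" "Ck_on k S f" "Ck_on k S h"
  shows "Ck_on k S (\<lambda>x. f x *\<^sub>R h x)"
  using assms(2,3)
proof (induction k arbitrary: f h)
  case 0
  then show ?case by (auto intro: continuous_on_scaleR)
next
  case (Suc k)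
  have IH: "Ck_on k S f" "Ck_on k S h" using Suc.prems by (blast intro: Ck_on_SucD)+
  show ?case
  proof (rule Ck_on_SucI[OF assms(1) has_derivative_scaleR[OF Ck_on_has_derivative[OF Suc.prems(1)] Ck_on_has_derivative[OF Suc.prems(2)]]])
    show "Ck_on k S (\<lambda>x. f x *\<^sub>R frechet_derivative h (at x) v + frechet_derivative f (at x) v *\<^sub>R h x)" for v
      by (intro Ck_on_add assms(1) Suc.IH IH) (use Suc.prems in auto)
  qed
qed

lemma linear_basis_expand:
  fixes L :: "'e::euclidean_space \<Rightarrow> 'f::real_vector"
  assumes "linear L"
  shows "L v = (\<Sum>b\<in>Basis. (v \<bullet> b) *\<^sub>R L b)"
proof -
  have "L v = L (\<Sum>b\<in>Basis. (v \<bullet> b) *\<^sub>R b)" by (simp add: euclidean_representation)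
  then show ?thesis by (simp only: linear_sum[OF assms] linear_cmul[OF assms])
qed

lemma Ck_on_compose:
  fixes f :: "'f::euclidean_space \<Rightarrow> 'h::real_normed_vector"
  assumes "open S" "open T" "\<And>x. x \<in> S \<Longrightarrow> h x \<in> T" "Ck_on k S h" "Ck_on k T f"
  shows "Ck_on k S (\<lambda>x. f (h x))"
  using assms(4,5)
proof (induction k arbitrary: f)
  case 0
  then show ?case using assms(3) by (auto intro: continuous_on_compose2)
next
  case (Suc k)
  have df: "(f has_derivative frechet_derivative f (at (h x))) (at (h x))" if "x \<in> S" for x
    using Suc.prems(2) assms(3)[OF that] by (rule Ck_on_has_derivative)
  let ?D = "\<lambda>x v. frechet_derivative f (at (h x)) (frechet_derivative h (at x) v)"
  have d: "((\<lambda>x. f (h x)) has_derivative ?D x) (at x)" if "x \<in> S" for x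
    using has_derivative_compose[OF Ck_on_has_derivative[OF Suc.prems(1) that] df[OF that]] .
  have "Ck_on k S (\<lambda>x. ?D x v)" for v
  proof (rule Ck_on_cong[OF assms(1)])
    show "(\<Sum>b\<in>Basis. (frechet_derivative h (at x) v \<bullet> b) *\<^sub>R frechet_derivative f (at (h x)) b) = ?D x v"
      if "x \<in> S" for x
      by (rule linear_basis_expand[symmetric]) (use df[OF that] has_derivative_linear in blast)
    show "Ck_on k S (\<lambda>x. \<Sum>b\<in>Basis. (frechet_derivative h (at x) v \<bullet> b) *\<^sub>R frechet_derivative f (at (h x)) b)"
    proof (intro Ck_on_sum Ck_on_scaleR assms(1))
      fix b :: 'f
      show "Ck_on k S (\<lambda>x. frechet_derivative h (at x) v \<bullet> b)"
        by (rule Ck_on_bounded_linear[OF assms(1) bounded_linear_inner_left]) (use Suc.prems(1) in auto)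
      show "Ck_on k S (\<lambda>x. frechet_derivative f (at (h x)) b)"
        by (rule Suc.IH[OF Ck_on_SucD[OF Suc.prems(1)]]) (use Suc.prems(2) in auto)
    qed
  qed
  with d show ?case by (rule Ck_on_SucI[OF assms(1)])
qed

lemma norm_linear_le_sum_Basis:
  fixes L :: "'e::euclidean_space \<Rightarrow> 'f::real_normed_vector"
  assumes "linear L"
  shows "norm (L v) \<le> norm v * (\<Sum>b\<in>Basis. norm (L b))"
proof -
  have "norm (L v) \<le> (\<Sum>b\<in>Basis. norm ((v \<bullet> b) *\<^sub>R L b))"
    by (subst linear_basis_expand[OF assms]) (rule norm_sum)
  also have "\<dots> \<le> (\<Sum>b\<in>Basis. norm v * norm (L b))"
    by (intro sum_mono) (simp add: Basis_le_norm mult_right_mono)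
  finally show ?thesis by (simp add: sum_distrib_left)
qed

lemma tendsto_norm_linear_sum:
  fixes A :: "'x \<Rightarrow> 'e::euclidean_space \<Rightarrow> 'f::real_normed_vector"
  assumes "\<And>b. b \<in> Basis \<Longrightarrow> ((\<lambda>y. A y b) \<longlongrightarrow> A0 b) F"
  shows "((\<lambda>y. \<Sum>b\<in>Basis. norm (A y b - A0 b)) \<longlongrightarrow> 0) F"
proof -
  have "((\<lambda>y. \<Sum>b\<in>Basis. norm (A y b - A0 b)) \<longlongrightarrow> (\<Sum>b\<in>Basis. norm (A0 b - A0 b :: 'f))) F"
    by (intro tendsto_intros assms)
  then show ?thesis by simp
qed

text \<open>The resolvent identity \<open>B\<^sub>y - B\<^sub>x = - B\<^sub>x (A\<^sub>y - A\<^sub>x) B\<^sub>y\<close> reduces continuity of the inverse to a bound for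
\<open>B\<^sub>y\<close> near x, and the same identity provides that bound once \<open>A\<^sub>y - A\<^sub>x\<close> is small.\<close>

lemma inverse_family_tendsto:
  fixes A B :: "'x::topological_space \<Rightarrow> 'e::euclidean_space \<Rightarrow> 'e"
  assumes "open S" "x \<in> S"
    and lin: "\<And>y. y \<in> S \<Longrightarrow> linear (A y)" "linear (B x)"
    and inv: "\<And>y v. y \<in> S \<Longrightarrow> A y (B y v) = v" "\<And>v. B x (A x v) = v"
    and cont: "\<And>v. ((\<lambda>y. A y v) \<longlongrightarrow> A x v) (at x)"
  shows "((\<lambda>y. B y v) \<longlongrightarrow> B x v) (at x)"
proof -
  obtain c where c: "c > 0" "\<And>w. norm (B x w) \<le> norm w * c"
    using bounded_linear.pos_bounded[of "B x"] lin(2) linear_conv_bounded_linear by blast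
  let ?d = "\<lambda>y. \<Sum>b\<in>Basis. norm (A y b - A x b)"
  have d0: "(?d \<longlongrightarrow> 0) (at x)" by (rule tendsto_norm_linear_sum) (rule cont)
  have ev: "\<forall>\<^sub>F y in at x. y \<in> S" using assms(1,2) eventually_at_topological by blast
  have "\<forall>\<^sub>F y in at x. ?d y < 1 / (2 * c)"
    using order_tendstoD(2)[OF d0, of "1/(2*c)"] c(1) by simp
  then have "\<forall>\<^sub>F y in at x. norm (B y v - B x v) \<le> ?d y * (2 * c * c * norm v)"
    using ev
  proof eventually_elim
    case (elim y)
    define w where "w = B y v"
    have dl: "linear (\<lambda>v. A y v - A x v)"
      using lin(1)[OF elim(2)] lin(1)[OF assms(2)] by (rule linear_compose_sub)
    have e: "norm (A y w - A x w) \<le> norm w * ?d y"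
      using norm_linear_le_sum_Basis[OF dl] .
    have v: "A y w = v" using inv(1) elim w_def by simp
    have eq: "B x v - w = B x (A y w - A x w)"
      using inv(2)[of w] linear_diff[OF lin(2)] v by simp
    have n1: "norm (B x v - w) \<le> norm w * ?d y * c"
      unfolding eq using c(2)[of "A y w - A x w"] e c(1) by (meson mult_right_mono order.trans less_imp_le)
    also have "\<dots> \<le> norm w * (1/(2*c)) * c"
      using elim(1) c(1) by (intro mult_right_mono mult_left_mono) auto
    also have "\<dots> = norm w / 2" using c(1) by simp
    finally have "norm w \<le> 2 * norm (B x v)"
      using norm_triangle_ineq2[of w "B x v"] by (simp add: norm_minus_commute)
    also have "\<dots> \<le> 2 * (norm v * c)" using c(2)[of v] by simp
    finally have "norm w * ?d y * c \<le> 2 * (norm v * c) * ?d y * c"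
      using c(1) by (intro mult_right_mono) (auto intro: sum_nonneg)
    then show ?case using n1 by (simp add: w_def norm_minus_commute mult_ac)
  qed
  moreover have "((\<lambda>y. ?d y * (2 * c * c * norm v)) \<longlongrightarrow> 0) (at x)"
    using tendsto_mult_right[OF d0, of "2 * c * c * norm v"] by simp
  ultimately have "((\<lambda>y. B y v - B x v) \<longlongrightarrow> 0) (at x)"
    by (rule Lim_null_comparison)
  then show ?thesis using LIM_zero_iff by blast
qed

text \<open>A product rule that asks only for continuity of one factor, at the price that the other factor
vanishes at the point. It turns the resolvent identity into a derivative of the inverse.\<close>

lemma has_derivative_scaleR_vanishing:
  fixes f :: "'e::real_normed_vector \<Rightarrow> real"
  assumes f: "(f \<longlongrightarrow> l) (at x)" and h: "(h has_derivative h') (at x)" and "h x = 0"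
  shows "((\<lambda>y. f y *\<^sub>R h y) has_derivative (\<lambda>v. l *\<^sub>R h' v)) (at x)"
proof -
  obtain K where K: "\<And>v. norm (h' v) \<le> norm v * K" "K > 0"
    using bounded_linear.pos_bounded[OF has_derivative_bounded_linear[OF h]] by blast
  have bl: "bounded_linear (\<lambda>v. l *\<^sub>R h' v)"
    using bounded_linear_const_scaleR has_derivative_bounded_linear[OF h] by blast
  let ?r = "\<lambda>y. (h y - h x - h' (y - x)) /\<^sub>R norm (y - x)"
  have r: "(?r \<longlongrightarrow> 0) (at x)" using h unfolding has_derivative_at_within by simp
  have "((\<lambda>y. f y *\<^sub>R ?r y + (f y - l) *\<^sub>R (h' (y - x) /\<^sub>R norm (y - x))) \<longlongrightarrow> 0) (at x)"
  proof (rule tendsto_add_zero)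
    show "((\<lambda>y. f y *\<^sub>R ?r y) \<longlongrightarrow> 0) (at x)" using tendsto_scaleR[OF f r] by simp
    have "((\<lambda>y. \<bar>f y - l\<bar> * K) \<longlongrightarrow> 0) (at x)"
      using tendsto_mult_right[OF tendsto_rabs[OF LIM_zero[OF f]], of K] by simp
    then show "((\<lambda>y. (f y - l) *\<^sub>R (h' (y - x) /\<^sub>R norm (y - x))) \<longlongrightarrow> 0) (at x)"
    proof (rule Lim_null_comparison[rotated], intro always_eventually allI)
      fix y
      have "norm (h' (y - x) /\<^sub>R norm (y - x)) \<le> K"
      proof (cases "y = x")
        case False
        then show ?thesis using K(1)[of "y - x"] by (simp add: field_simps)
      qed (use K linear_0[OF has_derivative_linear[OF h]] in auto)
      then show "norm ((f y - l) *\<^sub>R (h' (y - x) /\<^sub>R norm (y - x))) \<le> \<bar>f y - l\<bar> * K"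
        by (simp only: norm_scaleR) (simp add: mult_left_mono)
    qed
  qed
  moreover have "(\<lambda>y. f y *\<^sub>R ?r y + (f y - l) *\<^sub>R (h' (y - x) /\<^sub>R norm (y - x)))
      = (\<lambda>y. (f y *\<^sub>R h y - f x *\<^sub>R h x - l *\<^sub>R h' (y - x)) /\<^sub>R norm (y - x))"
    using \<open>h x = 0\<close> by (auto simp: algebra_simps)
  ultimately show ?thesis using bl unfolding has_derivative_at_within by simp
qed

lemma inverse_family_has_derivative:
  fixes A B :: "'x::real_normed_vector \<Rightarrow> 'e::euclidean_space \<Rightarrow> 'e"
  assumes "open S" "x \<in> S"
    and lin: "\<And>y. y \<in> S \<Longrightarrow> linear (A y)" "linear (B x)"
    and inv: "\<And>y v. y \<in> S \<Longrightarrow> A y (B y v) = v" "\<And>v. B x (A x v) = v"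
    and der: "\<And>b. ((\<lambda>y. A y b) has_derivative D b) (at x)"
  shows "((\<lambda>y. B y v) has_derivative (\<lambda>w. - (\<Sum>b\<in>Basis. (B x v \<bullet> b) *\<^sub>R B x (D b w)))) (at x)"
proof -
  have cont: "((\<lambda>y. A y v) \<longlongrightarrow> A x v) (at x)" for v
    using has_derivative_continuous[OF der] by (simp add: continuous_within)
  have B: "((\<lambda>y. B y v) \<longlongrightarrow> B x v) (at x)"
    by (rule inverse_family_tendsto[of S x A B]) (use assms cont in auto)
  have bB: "bounded_linear (B x)" using lin(2) linear_conv_bounded_linear by blast
  have h: "((\<lambda>y. B x v - (\<Sum>b\<in>Basis. (B y v \<bullet> b) *\<^sub>R B x (A y b - A x b))) has_derivative
     (\<lambda>w. 0 - (\<Sum>b\<in>Basis. (B x v \<bullet> b) *\<^sub>R B x (D b w)))) (at x)"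
  proof (intro has_derivative_diff has_derivative_const has_derivative_sum has_derivative_scaleR_vanishing)
    show "((\<lambda>y. B y v \<bullet> b) \<longlongrightarrow> B x v \<bullet> b) (at x)" for b by (intro tendsto_intros B)
    show "((\<lambda>y. B x (A y b - A x b)) has_derivative (\<lambda>w. B x (D b w))) (at x)" for b
      using bounded_linear.has_derivative[OF bB has_derivative_diff[OF der has_derivative_const]] by simp
    show "B x (A x b - A x b) = 0" for b using linear_0[OF lin(2)] by simp
  qed
  have "B x v - (\<Sum>b\<in>Basis. (B y v \<bullet> b) *\<^sub>R B x (A y b - A x b)) = B y v" if y: "y \<in> S" for y
  proof -
    have L: "linear (\<lambda>b. B x (A y b - A x b))"
      using linear_compose[OF linear_compose_sub[OF lin(1)[OF y] lin(1)[OF assms(2)]] lin(2)]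
      by (simp add: o_def)
    have "B x v - (\<Sum>b\<in>Basis. (B y v \<bullet> b) *\<^sub>R B x (A y b - A x b)) = B x v - B x (A y (B y v) - A x (B y v))"
      using linear_basis_expand[OF L, of "B y v"] by simp
    also have "\<dots> = B y v" using inv y linear_diff[OF lin(2)] by simp
    finally show ?thesis .
  qed
  then show ?thesis using has_derivative_transform_within_open[OF h assms(1,2)] by simp
qed

text \<open>The derivative of the inverse is \<open>- B (D A) B\<close>, so that one more derivative of A yields one more
derivative of B.\<close>

lemma Ck_on_inverse_family:
  fixes A B :: "'x::real_normed_vector \<Rightarrow> 'e::euclidean_space \<Rightarrow> 'e"
  assumes "open S"
    and lin: "\<And>y. y \<in> S \<Longrightarrow> linear (A y)" "\<And>y. y \<in> S \<Longrightarrow> linear (B y)"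
    and inv: "\<And>y v. y \<in> S \<Longrightarrow> A y (B y v) = v" "\<And>y v. y \<in> S \<Longrightarrow> B y (A y v) = v"
    and "\<And>v. Ck_on k S (\<lambda>y. A y v)"
  shows "Ck_on k S (\<lambda>y. B y v)"
  using assms(6)
proof (induction k arbitrary: v)
  case 0
  have "((\<lambda>y. B y v) \<longlongrightarrow> B x v) (at x)" if "x \<in> S" for x
    by (rule inverse_family_tendsto[of S x A B])
       (use assms that 0 in \<open>auto simp: continuous_on_eq_continuous_at continuous_within\<close>)
  then show ?case using assms(1) by (auto simp: continuous_on_eq_continuous_at continuous_within)
next
  case (Suc k)
  let ?D = "\<lambda>x b. frechet_derivative (\<lambda>y. A y b) (at x)"
  have d: "((\<lambda>y. B y v) has_derivative (\<lambda>w. - (\<Sum>b\<in>Basis. (B x v \<bullet> b) *\<^sub>R B x (?D x b w)))) (at x)"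
    if "x \<in> S" for x
    by (rule inverse_family_has_derivative[of S x A B]) (use assms that Ck_on_has_derivative[OF Suc.prems] in auto)
  have IH: "Ck_on k S (\<lambda>y. B y v)" for v
    using Suc.IH Suc.prems Ck_on_SucD by blast
  have IH2: "Ck_on k S (\<lambda>y. B y (?D y b w))" for b w
  proof (rule Ck_on_cong[OF assms(1)])
    show "Ck_on k S (\<lambda>y. \<Sum>c\<in>Basis. (?D y b w \<bullet> c) *\<^sub>R B y c)"
      by (intro Ck_on_sum Ck_on_scaleR assms(1) IH Ck_on_bounded_linear[OF _ bounded_linear_inner_left])
         (use Suc.prems in auto)
    show "(\<Sum>c\<in>Basis. (?D y b w \<bullet> c) *\<^sub>R B y c) = B y (?D y b w)" if "y \<in> S" for y
      using linear_basis_expand[OF lin(2)[OF that], of "?D y b w"] by simp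
  qed
  show ?case
    by (rule Ck_on_SucI[OF assms(1) d], assumption,
        intro Ck_on_minus Ck_on_sum Ck_on_scaleR Ck_on_bounded_linear[OF _ bounded_linear_inner_left] assms(1) IH IH2)
qed

text \<open>Smoothness of the inverse is bootstrapped: \<open>D\<psi>\<close> at y is the inverse of \<open>D\<phi>\<close> at \<open>\<psi> y\<close>, hence of class \<open>C\<^sup>k\<close>
if \<open>\<psi>\<close> is, which makes \<open>\<psi>\<close> of class \<open>C\<^sup>k\<^sup>+\<^sup>1\<close>.\<close>

lemma smooth_on_inverse:
  fixes \<phi> \<psi> :: "'e::euclidean_space \<Rightarrow> 'e"
  assumes "open U" "open V" "smooth_on U \<phi>" "\<And>y. y \<in> V \<Longrightarrow> \<psi> y \<in> U"
    and der: "\<And>y. y \<in> V \<Longrightarrow> (\<psi> has_derivative D y) (at y)"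
    and inv: "\<And>y v. y \<in> V \<Longrightarrow> frechet_derivative \<phi> (at (\<psi> y)) (D y v) = v"
  shows "smooth_on V \<psi>"
  unfolding smooth_on_def
proof
  fix k show "Ck_on k V \<psi>"
  proof (induction k)
    case 0
    have "\<psi> differentiable at y" if "y \<in> V" for y using der[OF that] differentiable_def by blast
    then show ?case by (auto intro!: continuous_at_imp_continuous_on differentiable_imp_continuous_within)
  next
    case (Suc k)
    let ?A = "\<lambda>y. frechet_derivative \<phi> (at (\<psi> y))"
    have sm: "Ck_on j U \<phi>" for j using assms(3) smooth_on_def by blast
    have linA: "linear (?A y)" if "y \<in> V" for y
      using has_derivative_linear[OF Ck_on_has_derivative[OF sm assms(4)[OF that]]] .
    have inv2: "D y (?A y v) = v" if y: "y \<in> V" for y v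
      using linear_inverse_left[OF linA[OF y] has_derivative_linear[OF der[OF y]]] inv[OF y]
      by (metis (no_types, lifting) eq_id_iff comp_apply ext id_apply)
    show ?case
    proof (rule Ck_on_SucI[OF assms(2) der])
      show "Ck_on k V (\<lambda>y. D y v)" for v
      proof (rule Ck_on_inverse_family[OF assms(2), of ?A])
        show "Ck_on k V (\<lambda>y. ?A y v)" for v
          using Ck_on_compose[OF assms(2,1,4) Suc, of "\<lambda>x. frechet_derivative \<phi> (at x) v"] sm[of "Suc k"] by auto
      qed (use linA has_derivative_linear[OF der] inv inv2 in auto)
    qed
  qed
qed

section \<open>Tangent spaces in charts\<close>

lemma has_vector_derivative_quotient:
  assumes "(c has_vector_derivative v) (at (0::real))"
  shows "((\<lambda>t. (c t - c 0) /\<^sub>R t) \<longlongrightarrow> v) (at 0)"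
proof -
  have 1: "((\<lambda>t. (c t - c 0 - t *\<^sub>R v) /\<^sub>R norm t) \<longlongrightarrow> 0) (at 0)"
    using assms unfolding has_vector_derivative_def has_derivative_at_within by simp
  have "((\<lambda>t. (c t - c 0) /\<^sub>R t - v) \<longlongrightarrow> 0) (at 0)"
  proof (rule Lim_null_comparison[OF _ tendsto_norm_zero[OF 1]])
    have "norm ((c t - c 0) /\<^sub>R t - v) = norm ((c t - c 0 - t *\<^sub>R v) /\<^sub>R norm t)" if "t \<noteq> 0" for t
    proof -
      have "(c t - c 0) /\<^sub>R t - v = (c t - c 0 - t *\<^sub>R v) /\<^sub>R t"
        using that by (simp add: algebra_simps)
      then show ?thesis by simp
    qed
    then show "\<forall>\<^sub>F t in at 0. norm ((c t - c 0) /\<^sub>R t - v) \<le> norm ((c t - c 0 - t *\<^sub>R v) /\<^sub>R norm t)"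
      by (auto simp: eventually_at_filter)
  qed
  then show ?thesis using LIM_zero_iff by blast
qed

lemma has_vector_derivative_in_subspace:
  fixes c :: "real \<Rightarrow> 'e::euclidean_space"
  assumes "subspace W" "(c has_vector_derivative v) (at 0)" "c 0 \<in> W"
    and "\<forall>\<^sub>F t in at 0. c t \<in> W"
  shows "v \<in> W"
proof (rule Lim_in_closed_set[OF closed_subspace[OF assms(1)] _ _ has_vector_derivative_quotient[OF assms(2)]])
  show "\<forall>\<^sub>F t in at 0. (c t - c 0) /\<^sub>R t \<in> W"
    using assms(4) by eventually_elim (use assms(1,3) in \<open>simp add: subspace_diff subspace_scale\<close>)
qed auto

lemma tangent_space_curve:
  assumes "v \<in> tangent_space N x"
  obtains c where "c 0 = x" "(c has_vector_derivative v) (at 0)"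
    "\<And>O'. openin N O' \<Longrightarrow> x \<in> O' \<Longrightarrow> \<forall>\<^sub>F t in at 0. c t \<in> O'"
proof -
  obtain c e where e: "e > 0" "c 0 = x" "continuous_map (top_of_set {-e<..<e}) N c"
    "(c has_vector_derivative v) (at (0::real))"
    using assms unfolding tangent_space_def by blast
  have "\<forall>\<^sub>F t in at 0. c t \<in> O'" if O: "openin N O'" "x \<in> O'" for O'
  proof -
    have "openin (top_of_set {-e<..<e}) {t \<in> topspace (top_of_set {-e<..<e}). c t \<in> O'}"
      by (rule openin_continuous_map_preimage[OF e(3) O(1)])
    then have "open {t \<in> {-e<..<e}. c t \<in> O'}"
      by (simp add: openin_open_eq)
    moreover have "0 \<in> {t \<in> {-e<..<e}. c t \<in> O'}" using e O by auto
    ultimately have "\<forall>\<^sub>F t in at 0. t \<in> {t \<in> {-e<..<e}. c t \<in> O'}"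
      using eventually_at_topological by blast
    then show ?thesis by (rule eventually_mono) auto
  qed
  then show thesis using that e by blast
qed

lemma tangent_space_topspace:
  assumes "v \<in> tangent_space N x" shows "x \<in> topspace N"
proof -
  obtain c and e :: real where e: "e > 0" "c 0 = x" "continuous_map (top_of_set {-e<..<e}) N c"
    using assms unfolding tangent_space_def by blast
  then have "c 0 \<in> topspace N" using continuous_map_image_subset_topspace[OF e(3)] by auto
  then show ?thesis using e(2) by simp
qed

lemma continuous_map_into_slice:
  assumes "subtopology N S = top_of_set S" "continuous_on I c" "c ` I \<subseteq> S"
  shows "continuous_map (top_of_set I) N c"
proof -
  have "continuous_map (top_of_set I) (top_of_set S) c"
    using assms(2,3) by (auto simp: continuous_map_in_subtopology)
  then show ?thesis using assms(1) by (metis continuous_map_in_subtopology)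
qed

text \<open>A flattening chart that respects the topology N of the submanifold: on the piece S, which is open for N,
that topology is the ambient subspace topology. In this way arguments about immersed
submanifolds reduce to embedded pieces.\<close>

definition submanifold_chart :: "'e::real_normed_vector topology \<Rightarrow> 'e set \<Rightarrow> 'e set \<Rightarrow> 'e set \<Rightarrow>
    ('e \<Rightarrow> 'e) \<Rightarrow> ('e \<Rightarrow> 'e) \<Rightarrow> 'e set \<Rightarrow> bool" where
  "submanifold_chart N S U V \<phi> \<psi> W \<longleftrightarrow>
     openin N S \<and> subtopology N S = top_of_set S \<and> S \<subseteq> U \<and> open U \<and> open V \<and>
     homeomorphism U V \<phi> \<psi> \<and> smooth_on U \<phi> \<and> smooth_on V \<psi> \<and> subspace W \<and> \<phi> ` S = W \<inter> V"

lemma openin_slice_open: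
  assumes "openin N S" "subtopology N S = top_of_set S" "open U"
  shows "openin N (S \<inter> U)"
proof -
  have "openin (top_of_set S) (S \<inter> U)" using assms(3) by (simp add: openin_open_Int)
  then show ?thesis using assms(1,2) openin_trans_full[of N S "S \<inter> U"] by simp
qed

lemma subtopology_slice_subset:
  assumes "subtopology N S = top_of_set S" "S' \<subseteq> S"
  shows "subtopology N S' = top_of_set S'"
  using assms by (metis Int_absorb1 subtopology_subtopology)

lemma submanifold_chart_exists:
  assumes "submanifold k N" "q \<in> topspace N"
  obtains S U V \<phi> \<psi> W where "submanifold_chart N S U V \<phi> \<psi> W" "q \<in> S"
proof -
  obtain S where S: "openin N S" "q \<in> S" "embedded_submanifold k S" "subtopology N S = top_of_set S"
    using assms unfolding submanifold_def by blast
  then obtain U V \<phi> \<psi> and W :: "'a set" where U: "open U" "q \<in> U" "open V" "homeomorphism U V \<phi> \<psi>"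
      "smooth_on U \<phi>" "smooth_on V \<psi>" "subspace W" "\<phi> ` (S \<inter> U) = W \<inter> V"
    using S(2,3)[unfolded embedded_submanifold_def] by (elim ballE[where x=q] exE conjE) auto
  have "submanifold_chart N (S \<inter> U) U V \<phi> \<psi> W"
    unfolding submanifold_chart_def
    using U S openin_slice_open[OF S(1,4) U(1)] subtopology_slice_subset[OF S(4)] by auto
  then show thesis using that S U by blast
qed

lemma smooth_on_has_derivative:
  "smooth_on S f \<Longrightarrow> x \<in> S \<Longrightarrow> (f has_derivative frechet_derivative f (at x)) (at x)"
  unfolding smooth_on_def using Ck_on_has_derivative by blast

lemma smooth_on_continuous: "smooth_on S f \<Longrightarrow> continuous_on S f"
  unfolding smooth_on_def using Ck_on.simps(1) by blast

lemma smooth_on_deriv_continuous: "smooth_on S f \<Longrightarrow> continuous_on S (\<lambda>x. frechet_derivative f (at x) v)"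
  unfolding smooth_on_def using Ck_on.simps by blast

lemma smooth_homeomorphism_derivatives:
  assumes h: "homeomorphism U V \<phi> \<psi>" and "open U" "open V" "smooth_on U \<phi>" "smooth_on V \<psi>" "x \<in> U"
  shows "frechet_derivative \<psi> (at (\<phi> x)) (frechet_derivative \<phi> (at x) v) = v"
    and "frechet_derivative \<phi> (at x) (frechet_derivative \<psi> (at (\<phi> x)) v) = v"
proof -
  have y: "\<phi> x \<in> V" and xx: "\<psi> (\<phi> x) = x"
    using homeomorphism_image1[OF h] homeomorphism_apply1[OF h] assms(6) by auto
  have d1: "(\<phi> has_derivative frechet_derivative \<phi> (at x)) (at x)"
    using smooth_on_has_derivative assms by blast
  have d2: "(\<psi> has_derivative frechet_derivative \<psi> (at (\<phi> x))) (at (\<phi> x))"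
    using smooth_on_has_derivative assms y by blast
  have "((\<lambda>x. x) has_derivative (\<lambda>v. frechet_derivative \<psi> (at (\<phi> x)) (frechet_derivative \<phi> (at x) v))) (at x)"
    by (rule has_derivative_transform_within_open[OF has_derivative_compose[OF d1 d2] assms(2,6)])
       (use homeomorphism_apply1[OF h] in auto)
  then show "frechet_derivative \<psi> (at (\<phi> x)) (frechet_derivative \<phi> (at x) v) = v"
    using has_derivative_unique[OF has_derivative_ident] by metis
  have "((\<lambda>y. y) has_derivative (\<lambda>v. frechet_derivative \<phi> (at x) (frechet_derivative \<psi> (at (\<phi> x)) v))) (at (\<phi> x))"
    by (rule has_derivative_transform_within_open[OF has_derivative_compose[OF d2, of \<phi>] assms(3) y])
       (use homeomorphism_apply2[OF h] d1 xx in auto)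
  then show "frechet_derivative \<phi> (at x) (frechet_derivative \<psi> (at (\<phi> x)) v) = v"
    using has_derivative_unique[OF has_derivative_ident] by metis
qed

lemma smooth_on_subset: "smooth_on S f \<Longrightarrow> S' \<subseteq> S \<Longrightarrow> smooth_on S' f"
  unfolding smooth_on_def using Ck_on_subset by blast

lemma smooth_on_bounded_linear:
  "open S \<Longrightarrow> bounded_linear L \<Longrightarrow> smooth_on S f \<Longrightarrow> smooth_on S (\<lambda>x. L (f x))"
  unfolding smooth_on_def using Ck_on_bounded_linear by blast

lemma smooth_on_affine:
  fixes w :: "'e::real_normed_vector"
  shows "smooth_on {-e<..<e} (\<lambda>t::real. y + t *\<^sub>R w)"
  unfolding smooth_on_def
proof
  fix k
  have 1: "Ck_on k {-e<..<e} (\<lambda>t::real. t)"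
  proof (cases k)
    case (Suc j)
    have "Ck_on (Suc j) {-e<..<e} (\<lambda>t::real. t)" by (rule Ck_on_SucI[OF _ has_derivative_ident]) (auto intro: Ck_on_const)
    then show ?thesis using Suc by simp
  qed simp
  show "Ck_on k {-e<..<e} (\<lambda>t::real. y + t *\<^sub>R w)"
    by (intro Ck_on_add Ck_on_const Ck_on_bounded_linear[OF _ bounded_linear_scaleR_left] 1) auto
qed

text \<open>Curves in N stay in S for small times, so their images under \<open>\<phi>\<close> are curves in the linear space W;
conversely, straight lines in W are mapped by \<open>\<psi>\<close> to curves in N.\<close>

theorem tangent_space_chart:
  fixes N :: "'e::euclidean_space topology"
  assumes ch: "submanifold_chart N S U V \<phi> \<psi> W" and "x \<in> S"
  shows "tangent_space N x = frechet_derivative \<psi> (at (\<phi> x)) ` W"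
proof -
  have S: "openin N S" "subtopology N S = top_of_set S" "S \<subseteq> U" "open U" "open V"
    and h: "homeomorphism U V \<phi> \<psi>" and sm: "smooth_on U \<phi>" "smooth_on V \<psi>"
    and W: "subspace W" "\<phi> ` S = W \<inter> V"
    using ch unfolding submanifold_chart_def by auto
  have xU: "x \<in> U" and xW: "\<phi> x \<in> W" "\<phi> x \<in> V" and xx: "\<psi> (\<phi> x) = x"
    using S(3) W(2) assms(2) homeomorphism_apply1[OF h] by auto
  note inv = smooth_homeomorphism_derivatives[OF h S(4,5) sm xU]
  have "v \<in> frechet_derivative \<psi> (at (\<phi> x)) ` W" if v: "v \<in> tangent_space N x" for v
  proof -
    obtain c where c: "c 0 = x" "(c has_vector_derivative v) (at 0)" "\<forall>\<^sub>F t in at 0. c t \<in> S"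
      using tangent_space_curve[OF v] S(1) assms(2) by metis
    have "((\<lambda>t. \<phi> (c t)) has_vector_derivative frechet_derivative \<phi> (at x) v) (at 0)"
      using vector_derivative_diff_chain_within[OF c(2), of \<phi> "frechet_derivative \<phi> (at x)"]
        smooth_on_has_derivative[OF sm(1) xU] c(1) has_derivative_at_withinI by (auto simp: o_def)
    then have "frechet_derivative \<phi> (at x) v \<in> W"
    proof (rule has_vector_derivative_in_subspace[OF W(1)])
      show "\<forall>\<^sub>F t in at 0. \<phi> (c t) \<in> W" using c(3) by eventually_elim (use W in auto)
    qed (use c(1) xW in simp)
    then show ?thesis using inv(1) by (metis imageI)
  qed
  moreover have "frechet_derivative \<psi> (at (\<phi> x)) w \<in> tangent_space N x" if w: "w \<in> W" for w
  proof -
    have "isCont (\<lambda>t::real. \<phi> x + t *\<^sub>R w) 0" by (intro continuous_intros)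
    then have "\<forall>\<^sub>F t in nhds (0::real). \<phi> x + t *\<^sub>R w \<in> V"
      using S(5) xW(2) by (simp add: continuous_within eventually_nhds_conv_at topological_tendstoD)
    then obtain e where e: "e > 0" "\<And>t. \<bar>t\<bar> < e \<Longrightarrow> \<phi> x + t *\<^sub>R w \<in> V"
      by (auto simp: eventually_nhds_metric dist_real_def)
    let ?c = "\<lambda>t. \<psi> (\<phi> x + t *\<^sub>R w)"
    have inV: "\<phi> x + t *\<^sub>R w \<in> V" if "t \<in> {-e<..<e}" for t using e(2) that by (auto simp: abs_less_iff)
    have sc: "smooth_on {-e<..<e} ?c"
      unfolding smooth_on_def
    proof
      fix k
      have 1: "Ck_on k {-e<..<e} (\<lambda>t. \<phi> x + t *\<^sub>R w)" "Ck_on k V \<psi>"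
        using smooth_on_affine[of e "\<phi> x" w] sm(2) by (simp_all add: smooth_on_def)
      show "Ck_on k {-e<..<e} ?c"
        by (rule Ck_on_compose[OF open_greaterThanLessThan S(5) inV 1])
    qed
    have "?c t \<in> S" if t: "t \<in> {-e<..<e}" for t
    proof -
      have "\<phi> x + t *\<^sub>R w \<in> W \<inter> V" using inV[OF t] W(1) xW w by (simp add: subspace_add subspace_scale)
      then obtain y where "y \<in> S" "\<phi> y = \<phi> x + t *\<^sub>R w" unfolding W(2)[symmetric] by force
      then have "\<psi> (\<phi> x + t *\<^sub>R w) = y" using homeomorphism_apply1[OF h, of y] S(3) by auto
      then show ?thesis using \<open>y \<in> S\<close> by simp
    qed
    then have "continuous_map (top_of_set {-e<..<e}) N ?c"
      by (intro continuous_map_into_slice[OF S(2) smooth_on_continuous[OF sc]]) auto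
    moreover have "(?c has_vector_derivative frechet_derivative \<psi> (at (\<phi> x)) w) (at 0)"
    proof -
      have 1: "((\<lambda>t. \<phi> x + t *\<^sub>R w) has_derivative (\<lambda>t. t *\<^sub>R w)) (at (0::real))"
        by (auto intro!: derivative_eq_intros)
      have 2: "(\<psi> has_derivative frechet_derivative \<psi> (at (\<phi> x))) (at (\<phi> x + 0 *\<^sub>R w))"
        using smooth_on_has_derivative[OF sm(2) xW(2)] by simp
      show ?thesis
        using has_derivative_compose[OF 1 2] linear_cmul[OF has_derivative_linear[OF 2]]
        by (simp add: has_vector_derivative_def)
    qed
    moreover have "?c 0 = x" using xx by simp
    ultimately show ?thesis
      unfolding tangent_space_def mem_Collect_eq using e(1) sc by (intro exI[of _ ?c] exI[of _ e] conjI)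
  qed
  ultimately show ?thesis by blast
qed

lemma tangent_space_chart_iff:
  fixes N :: "'e::euclidean_space topology"
  assumes ch: "submanifold_chart N S U V \<phi> \<psi> W" and "x \<in> S"
  shows "v \<in> tangent_space N x \<longleftrightarrow> frechet_derivative \<phi> (at x) v \<in> W"
proof -
  have x: "x \<in> U" and h: "homeomorphism U V \<phi> \<psi>" "open U" "open V" "smooth_on U \<phi>" "smooth_on V \<psi>"
    using assms unfolding submanifold_chart_def by auto
  note inv = smooth_homeomorphism_derivatives[OF h x]
  show ?thesis
    unfolding tangent_space_chart[OF assms]
    using inv(1)[of v, symmetric] inv(2) by (auto intro: rev_image_eqI)
qed

lemma subspace_tangent_space:
  fixes N :: "'e::euclidean_space topology"
  assumes "submanifold k N" "q \<in> topspace N"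
  shows "subspace (tangent_space N q)"
proof -
  obtain S U V \<phi> \<psi> W where ch: "submanifold_chart N S U V \<phi> \<psi> W" "q \<in> S"
    using submanifold_chart_exists[OF assms] by metis
  then have "smooth_on V \<psi>" "\<phi> q \<in> V" "subspace W" unfolding submanifold_chart_def by auto
  then show ?thesis
    unfolding tangent_space_chart[OF ch]
    by (intro linear_subspace_image has_derivative_linear[OF smooth_on_has_derivative])
qed

section \<open>Linear algebra of an inner product of arbitrary signature\<close>

lemma pseudo_inner_bounded_bilinear: "pseudo_inner g \<Longrightarrow> bounded_bilinear g"
  unfolding pseudo_inner_def using bilinear_conv_bounded_bilinear by blast

lemma pseudo_inner_linear:
  assumes "pseudo_inner g"
  shows "linear (g u)" "linear (\<lambda>u. g u v)"
  using assms unfolding pseudo_inner_def bilinear_def by auto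

lemma pseudo_inner_simps:
  assumes "pseudo_inner g"
  shows "g 0 v = 0" "g v 0 = 0"
    "g (u + u') v = g u v + g u' v" "g v (u + u') = g v u + g v u'"
    "g (u - u') v = g u v - g u' v" "g v (u - u') = g v u - g v u'"
    "g (r *\<^sub>R u) v = r * g u v" "g v (r *\<^sub>R u) = r * g v u"
    "g (- u) v = - g u v" "g v (- u) = - g v u"
  using linear_0[OF pseudo_inner_linear(1)[OF assms]] linear_0[OF pseudo_inner_linear(2)[OF assms]]
    linear_add[OF pseudo_inner_linear(1)[OF assms]] linear_add[OF pseudo_inner_linear(2)[OF assms]]
    linear_diff[OF pseudo_inner_linear(1)[OF assms]] linear_diff[OF pseudo_inner_linear(2)[OF assms]]
    linear_cmul[OF pseudo_inner_linear(1)[OF assms]] linear_cmul[OF pseudo_inner_linear(2)[OF assms]]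
    linear_neg[OF pseudo_inner_linear(1)[OF assms]] linear_neg[OF pseudo_inner_linear(2)[OF assms]]
  by simp_all

lemma pseudo_inner_sym: "pseudo_inner g \<Longrightarrow> g u v = g v u"
  unfolding pseudo_inner_def by blast

lemma pseudo_inner_eq_0I:
  "pseudo_inner g \<Longrightarrow> (\<And>v. g u v = 0) \<Longrightarrow> u = 0"
  unfolding pseudo_inner_def nondegenerate_on_def by blast

lemma pseudo_inner_represents:
  fixes f :: "'a::euclidean_space \<Rightarrow> real"
  assumes g: "pseudo_inner g" and f: "linear f"
  obtains y where "\<And>v. g y v = f v"
proof -
  let ?L = "\<lambda>y. \<Sum>b\<in>Basis. g y b *\<^sub>R b"
  have expand: "h v = (\<Sum>b\<in>Basis. (v \<bullet> b) * h b)" if "linear h" for h :: "'a \<Rightarrow> real" and v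
    using linear_basis_expand[OF that, of v] by (simp only: real_scaleR_def)
  have lin: "linear ?L"
    by (rule linearI) (simp_all add: pseudo_inner_simps[OF g] scaleR_add_left sum.distrib scaleR_sum_right)
  have "inj ?L"
  proof (rule iffD2[OF linear_injective_0[OF lin]], intro allI impI)
    fix y assume 0: "?L y = 0"
    have "g y b = 0" if b: "b \<in> Basis" for b
    proof -
      have "?L y \<bullet> b = g y b" using b by (simp add: inner_sum_left inner_Basis if_distrib cong: if_cong)
      then show ?thesis using 0 by simp
    qed
    then have "g y v = 0" for v by (subst expand[OF pseudo_inner_linear(1)[OF g]]) simp
    then show "y = 0" by (rule pseudo_inner_eq_0I[OF g])
  qed
  then have "surj ?L" by (rule eucl.linear_inj_imp_surj[OF lin])
  then obtain y where y: "?L y = (\<Sum>b\<in>Basis. f b *\<^sub>R b)" by (elim surjE[where y="\<Sum>b\<in>Basis. f b *\<^sub>R b"]) simp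
  have "g y b = f b" if b: "b \<in> Basis" for b
    using arg_cong[OF y, of "\<lambda>x. x \<bullet> b"] b by (simp add: inner_sum_left inner_Basis if_distrib cong: if_cong)
  then have "g y v = f v" for v
    unfolding expand[OF pseudo_inner_linear(1)[OF g], of y v] expand[OF f, of v] by simp
  then show thesis using that by blast
qed

lemma subspace_g_orthogonal:
  assumes "pseudo_inner g" shows "subspace (g_orthogonal g W)"
  by (simp add: subspace_def g_orthogonal_def pseudo_inner_simps[OF assms])

lemma g_orthogonal_antimono: "A \<subseteq> B \<Longrightarrow> g_orthogonal g B \<subseteq> g_orthogonal g A"
  unfolding g_orthogonal_def by blast

text \<open>A vector w outside V has a nonzero component z that is Euclidean-orthogonal to V. The functional \<open>v \<mapsto> v \<bullet> z\<close> is
represented by some y with respect to g; this y is g-orthogonal to V but not to w.\<close>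

lemma g_orthogonal_orthogonal:
  assumes g: "pseudo_inner g" and V: "subspace V"
  shows "g_orthogonal g (g_orthogonal g V) = V"
proof
  show "V \<subseteq> g_orthogonal g (g_orthogonal g V)"
    unfolding g_orthogonal_def using pseudo_inner_sym[OF g] by auto
  show "g_orthogonal g (g_orthogonal g V) \<subseteq> V"
  proof
    fix w assume w: "w \<in> g_orthogonal g (g_orthogonal g V)"
    obtain p z where p: "p \<in> span V" "\<And>u. u \<in> span V \<Longrightarrow> orthogonal z u" "w = p + z"
      using orthogonal_subspace_decomp_exists[of V w] by metis
    have sp: "span V = V" using V by simp
    have "linear (\<lambda>v. v \<bullet> z)" by (rule bounded_linear.linear[OF bounded_linear_inner_left])
    then obtain y where y: "\<And>v. g y v = v \<bullet> z" using pseudo_inner_represents[OF g] by blast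
    have "y \<in> g_orthogonal g V"
      unfolding g_orthogonal_def using y p(2) sp by (auto simp: orthogonal_def inner_commute)
    then have "g w y = 0" using w unfolding g_orthogonal_def by blast
    then have "g y w = 0" using pseudo_inner_sym[OF g, of y w] by simp
    then have "(p + z) \<bullet> z = 0" using y p(3) by simp
    moreover have "p \<bullet> z = 0" using p(1,2) by (auto simp: orthogonal_def inner_commute)
    ultimately have "z = 0" by (simp add: inner_add_left)
    then show "w \<in> V" using p sp by simp
  qed
qed

text \<open>A vector orthogonal to the sum of T and its complement lies in both of them, hence is 0; so
the sum is the whole space.\<close>

lemma nondegenerate_decomposition:
  assumes g: "pseudo_inner g" and T: "subspace T" "nondegenerate_on g T"
  obtains t where "t \<in> T" "y - t \<in> g_orthogonal g T"
proof -
  let ?Z = "{t + n | t n. t \<in> T \<and> n \<in> g_orthogonal g T}"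
  have Z: "subspace ?Z" using subspace_sums[OF T(1) subspace_g_orthogonal[OF g]] .
  have "T \<subseteq> ?Z" using subspace_0[OF subspace_g_orthogonal[OF g, of T]] by force
  have "g_orthogonal g T \<subseteq> ?Z" using subspace_0[OF T(1)] by force
  have "u = 0" if u: "u \<in> g_orthogonal g ?Z" for u
  proof -
    have 1: "u \<in> g_orthogonal g T" using u g_orthogonal_antimono[OF \<open>T \<subseteq> ?Z\<close>] by blast
    have "u \<in> g_orthogonal g (g_orthogonal g T)"
      using u g_orthogonal_antimono[OF \<open>g_orthogonal g T \<subseteq> ?Z\<close>] by blast
    then have "u \<in> T" using g_orthogonal_orthogonal[OF g T(1)] by simp
    then show "u = 0" using T(2) 1 unfolding nondegenerate_on_def g_orthogonal_def by auto
  qed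
  then have "g_orthogonal g ?Z \<subseteq> {0}" by blast
  then have "g_orthogonal g {0} \<subseteq> g_orthogonal g (g_orthogonal g ?Z)" by (rule g_orthogonal_antimono)
  moreover have "y \<in> g_orthogonal g {0}"
    unfolding g_orthogonal_def using linear_0[OF pseudo_inner_linear(1)[OF g]] by simp
  ultimately have "y \<in> ?Z" using g_orthogonal_orthogonal[OF g Z] by blast
  then show thesis using that by force
qed

lemma tangential_part_eq:
  assumes g: "pseudo_inner g" and T: "subspace (tangent_space N q)" "nondegenerate_on g (tangent_space N q)"
  shows "tangential_part g N q v \<in> tangent_space N q"
    and "v - tangential_part g N q v \<in> normal_vectors g N q"
proof -
  let ?T = "tangent_space N q"
  obtain t where t: "t \<in> ?T" "v - t \<in> normal_vectors g N q"
    using nondegenerate_decomposition[OF g T] unfolding normal_vectors_def by metis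
  have "s = t" if s: "s \<in> ?T \<and> v - s \<in> normal_vectors g N q" for s
  proof -
    have "s - t \<in> ?T" using s t T(1) by (simp add: subspace_diff)
    moreover have "(v - t) - (v - s) \<in> g_orthogonal g ?T"
      using s t subspace_diff[OF subspace_g_orthogonal[OF g]] unfolding normal_vectors_def by blast
    ultimately have "s - t = 0" using T(2) unfolding nondegenerate_on_def g_orthogonal_def by auto
    then show ?thesis by simp
  qed
  then have "\<exists>!t. t \<in> ?T \<and> v - t \<in> normal_vectors g N q" using t by blast
  from theI'[OF this] show "tangential_part g N q v \<in> ?T" "v - tangential_part g N q v \<in> normal_vectors g N q"
    unfolding tangential_part_def by blast+
qed

section \<open>Infinitesimal orbits\<close>

lemma orbit_tangent_eq: "orbit_tangent G q = (\<lambda>A. blinfun_apply A q) ` lie_algebra G"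
proof -
  have "((\<lambda>A. blinfun_apply A q) has_derivative (\<lambda>A. blinfun_apply A q)) (at id_blinfun)"
    by (rule bounded_linear_imp_has_derivative[OF blinfun.bounded_linear_left])
  then show ?thesis
    unfolding orbit_tangent_def lie_algebra_def using frechet_derivative_at by metis
qed

lemma tangent_space_curve_within:
  assumes "v \<in> tangent_space N x" "openin N O'" "x \<in> O'"
  obtains c e where "e > 0" "c 0 = x" "smooth_on {-e<..<e} c"
    "continuous_map (top_of_set {-e<..<e}) (subtopology N O') c"
    "(c has_vector_derivative v) (at (0::real))"
proof -
  obtain c e where e: "e > 0" "c 0 = x" "smooth_on {-e<..<e} c"
    "continuous_map (top_of_set {-e<..<e}) N c" "(c has_vector_derivative v) (at (0::real))"
    using assms(1) unfolding tangent_space_def by blast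
  have "openin (top_of_set {-e<..<e}) {t \<in> topspace (top_of_set {-e<..<e}). c t \<in> O'}"
    by (rule openin_continuous_map_preimage[OF e(4) assms(2)])
  then have "open {t \<in> {-e<..<e}. c t \<in> O'}" by (simp add: openin_open_eq)
  moreover have "0 \<in> {t \<in> {-e<..<e}. c t \<in> O'}" using e assms by auto
  ultimately obtain d where d: "d > 0" "ball 0 d \<subseteq> {t \<in> {-e<..<e}. c t \<in> O'}"
    using open_contains_ball_eq by metis
  have eq: "ball 0 d = {-d<..<d}" by (auto simp: ball_def dist_real_def)
  have sub: "{-d<..<d} \<subseteq> {-e<..<e}" "c ` {-d<..<d} \<subseteq> O'" using d(2) unfolding eq by auto
  have "continuous_map (top_of_set {-d<..<d}) N c"
    using continuous_map_from_subtopology_mono[OF e(4) sub(1)] by simp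
  then have "continuous_map (top_of_set {-d<..<d}) (subtopology N O') c"
    using sub(2) by (auto simp: continuous_map_in_subtopology)
  then show thesis using that d(1) e(2,5) smooth_on_subset[OF e(3) sub(1)] by blast
qed

text \<open>The image under A of a curve in N with velocity h is a curve in N with velocity \<open>A h\<close>. One sufficiently short
curve serves all A in U.\<close>

lemma locally_invariant_tangent:
  assumes "locally_invariant G N" "h \<in> tangent_space N q"
  obtains U where "openin G U" "id_blinfun \<in> U"
    "\<And>A. A \<in> U \<Longrightarrow> blinfun_apply A h \<in> tangent_space N (blinfun_apply A q)"
proof -
  have qN: "q \<in> topspace N" using tangent_space_topspace[OF assms(2)] .
  obtain U W where U: "openin G U" "id_blinfun \<in> U" "openin N W" "q \<in> W"
     and c: "continuous_map (prod_topology (subtopology G U) (subtopology N W)) N (\<lambda>(A, x). blinfun_apply A x)"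
    using assms(1) qN unfolding locally_invariant_def by blast
  obtain c e where e: "e > 0" "c 0 = q" "smooth_on {-e<..<e} c"
    "continuous_map (top_of_set {-e<..<e}) (subtopology N W) c" "(c has_vector_derivative h) (at (0::real))"
    using tangent_space_curve_within[OF assms(2) U(3,4)] by metis
  have "blinfun_apply A h \<in> tangent_space N (blinfun_apply A q)" if A: "A \<in> U" for A
  proof -
    have "A \<in> topspace (subtopology G U)" using openin_subset[OF U(1)] A by auto
    then have "continuous_map (top_of_set {-e<..<e}) (subtopology G U) (\<lambda>t. A)" by simp
    from continuous_map_compose[OF continuous_map_pairedI[OF this e(4)] c]
    have "continuous_map (top_of_set {-e<..<e}) N (\<lambda>t. blinfun_apply A (c t))"
      by (simp add: o_def)
    moreover have "smooth_on {-e<..<e} (\<lambda>t. blinfun_apply A (c t))"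
      by (rule smooth_on_bounded_linear[OF open_greaterThanLessThan blinfun.bounded_linear_right e(3)])
    moreover have "((\<lambda>t. blinfun_apply A (c t)) has_vector_derivative blinfun_apply A h) (at 0)"
      by (rule bounded_linear.has_vector_derivative[OF blinfun.bounded_linear_right e(5)])
    moreover have "blinfun_apply A (c 0) = blinfun_apply A q" using e(2) by simp
    ultimately show ?thesis
      unfolding tangent_space_def mem_Collect_eq using e(1)
      by (intro exI[of _ "\<lambda>t. blinfun_apply A (c t)"] exI[of _ e] conjI)
  qed
  then show thesis using that U(1,2) by blast
qed

lemma orbit_tangent_subset_tangent_space:
  assumes "locally_invariant G N" "q \<in> topspace N"
  shows "orbit_tangent G q \<subseteq> tangent_space N q"
proof -
  obtain U W where U: "openin G U" "id_blinfun \<in> U" "openin N W" "q \<in> W"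
     and c: "continuous_map (prod_topology (subtopology G U) (subtopology N W)) N (\<lambda>(A, x). blinfun_apply A x)"
    using assms unfolding locally_invariant_def by blast
  have "blinfun_apply A q \<in> tangent_space N q" if A: "A \<in> lie_algebra G" for A
  proof -
    obtain \<alpha> e where e: "e > 0" "\<alpha> 0 = id_blinfun" "smooth_on {-e<..<e} \<alpha>"
      "continuous_map (top_of_set {-e<..<e}) (subtopology G U) \<alpha>" "(\<alpha> has_vector_derivative A) (at (0::real))"
      using tangent_space_curve_within[OF A[unfolded lie_algebra_def] U(1,2)] by metis
    have "q \<in> topspace (subtopology N W)" using openin_subset[OF U(3)] U(4) by auto
    then have "continuous_map (top_of_set {-e<..<e}) (subtopology N W) (\<lambda>t. q)" by simp
    from continuous_map_compose[OF continuous_map_pairedI[OF e(4) this] c]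
    have "continuous_map (top_of_set {-e<..<e}) N (\<lambda>t. blinfun_apply (\<alpha> t) q)"
      by (simp add: o_def)
    moreover have "smooth_on {-e<..<e} (\<lambda>t. blinfun_apply (\<alpha> t) q)"
      by (rule smooth_on_bounded_linear[OF open_greaterThanLessThan blinfun.bounded_linear_left e(3)])
    moreover have "((\<lambda>t. blinfun_apply (\<alpha> t) q) has_vector_derivative blinfun_apply A q) (at 0)"
      by (rule bounded_linear.has_vector_derivative[OF blinfun.bounded_linear_left e(5)])
    moreover have "blinfun_apply (\<alpha> 0) q = q" using e(2) by simp
    ultimately show ?thesis
      unfolding tangent_space_def mem_Collect_eq using e(1)
      by (intro exI[of _ "\<lambda>t. blinfun_apply (\<alpha> t) q"] exI[of _ e] conjI)
  qed
  then show ?thesis unfolding orbit_tangent_eq by blast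
qed

section \<open>Constancy of rank and the pointwise vanishing of curvature\<close>

text \<open>Over an orthonormal basis B (for the Euclidean structure) of the orbit tangent space at q, elements of the Lie
algebra whose values at q are the basis vectors. The vectors \<open>A b x\<close> extend the basis to a frame of the
orbit tangent spaces at the points x near q, provided that their dimension stays constant.\<close>

definition orbit_frame :: "('a::euclidean_space \<Rightarrow>\<^sub>L 'a) topology \<Rightarrow> 'a \<Rightarrow> 'a set \<Rightarrow> ('a \<Rightarrow> 'a \<Rightarrow>\<^sub>L 'a) \<Rightarrow> bool" where
  "orbit_frame G q B A \<longleftrightarrow> finite B \<and> pairwise orthogonal B \<and> (\<forall>b\<in>B. norm b = 1) \<and>
     span B = orbit_tangent G q \<and> (\<forall>b\<in>B. A b \<in> lie_algebra G \<and> blinfun_apply (A b) q = b)"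

text \<open>The Euclidean-orthogonal projection onto the complement of \<open>span B\<close>: for a frame at q it measures how far a
vector is from being tangent to the orbit through q.\<close>

definition frame_defect :: "'a::euclidean_space set \<Rightarrow> 'a \<Rightarrow> 'a" where
  "frame_defect B v = v - (\<Sum>b\<in>B. (v \<bullet> b) *\<^sub>R b)"

lemma bounded_linear_frame_defect: "bounded_linear (frame_defect B)"
  unfolding frame_defect_def by (intro bounded_linear_intros)

lemma frame_defect_eq_0_iff:
  assumes "orbit_frame G q B A"
  shows "frame_defect B v = 0 \<longleftrightarrow> v \<in> orbit_tangent G q"
proof
  assume "frame_defect B v = 0"
  then have "v = (\<Sum>b\<in>B. (v \<bullet> b) *\<^sub>R b)" unfolding frame_defect_def by simp
  also have "\<dots> \<in> span B" by (intro span_sum span_scale span_base)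
  finally show "v \<in> orbit_tangent G q" using assms unfolding orbit_frame_def by simp
next
  assume "v \<in> orbit_tangent G q"
  then show "frame_defect B v = 0"
    using assms orthonormal_basis_expand[of B v] unfolding orbit_frame_def frame_defect_def by simp
qed

lemma subspace_orbit_tangent:
  assumes "subspace (lie_algebra G)" shows "subspace (orbit_tangent G q)"
  unfolding orbit_tangent_eq
  by (rule linear_subspace_image[OF bounded_linear.linear[OF blinfun.bounded_linear_left] assms])

lemma orbit_frame_exists:
  assumes "subspace (lie_algebra G)"
  obtains B A where "orbit_frame G q B A"
proof -
  obtain B where B: "B \<subseteq> orbit_tangent G q" "pairwise orthogonal B" "\<And>x. x \<in> B \<Longrightarrow> norm x = 1"
    "independent B" "span B = orbit_tangent G q"
    using orthonormal_basis_subspace[OF subspace_orbit_tangent[OF assms, of q]] by metis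
  have "\<forall>b\<in>B. \<exists>A. A \<in> lie_algebra G \<and> blinfun_apply A q = b" using B(1) unfolding orbit_tangent_eq by blast
  then obtain A where "\<forall>b\<in>B. A b \<in> lie_algebra G \<and> blinfun_apply (A b) q = b" by metis
  then have "orbit_frame G q B A"
    unfolding orbit_frame_def using B independent_imp_finite by auto
  then show thesis using that by blast
qed

text \<open>The linear map \<open>v \<mapsto> (\<Sum>b\<in>B. (v \<bullet> b) *\<^sub>R A b x)\<close> is close to the identity on the orbit tangent space at q, hence
bounded below there, and by equality of dimensions it maps onto the orbit tangent space at x.\<close>

lemma orbit_frame_spans:
  assumes sub: "subspace (lie_algebra G)" and fr: "orbit_frame G q B A"
    and dim: "dim (orbit_tangent G x) = dim (orbit_tangent G q)"
    and close: "(\<Sum>b\<in>B. norm (blinfun_apply (A b) x - b)) \<le> 1 / 2"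
    and w: "w \<in> orbit_tangent G x"
  obtains v where "w = (\<Sum>b\<in>B. (v \<bullet> b) *\<^sub>R blinfun_apply (A b) x)" "norm v \<le> 2 * norm w"
proof -
  let ?Q = "\<lambda>v. \<Sum>b\<in>B. (v \<bullet> b) *\<^sub>R blinfun_apply (A b) x"
  have fin: "finite B" and nB: "\<And>b. b \<in> B \<Longrightarrow> norm b = 1" and sp: "span B = orbit_tangent G q"
    and A: "\<And>b. b \<in> B \<Longrightarrow> A b \<in> lie_algebra G"
    and exp: "\<And>v. v \<in> orbit_tangent G q \<Longrightarrow> (\<Sum>b\<in>B. (v \<bullet> b) *\<^sub>R b) = v"
    using fr orthonormal_basis_expand[of B] unfolding orbit_frame_def by auto
  have lin: "linear ?Q" by (rule bounded_linear.linear) (intro bounded_linear_intros)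
  have est: "norm v \<le> 2 * norm (?Q v)" if v: "v \<in> orbit_tangent G q" for v
  proof -
    have "?Q v - v = ?Q v - (\<Sum>b\<in>B. (v \<bullet> b) *\<^sub>R b)" using exp[OF v] by simp
    also have "\<dots> = (\<Sum>b\<in>B. (v \<bullet> b) *\<^sub>R (blinfun_apply (A b) x - b))"
      by (simp add: sum_subtractf scaleR_diff_right)
    finally have e: "?Q v - v = (\<Sum>b\<in>B. (v \<bullet> b) *\<^sub>R (blinfun_apply (A b) x - b))" .
    have "norm (?Q v - v) \<le> (\<Sum>b\<in>B. norm ((v \<bullet> b) *\<^sub>R (blinfun_apply (A b) x - b)))"
      unfolding e by (rule norm_sum)
    also have "\<dots> \<le> (\<Sum>b\<in>B. norm v * norm (blinfun_apply (A b) x - b))"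
    proof (rule sum_mono)
      fix b assume "b \<in> B"
      have "\<bar>v \<bullet> b\<bar> \<le> norm v" using Cauchy_Schwarz_ineq2[of v b] nB[OF \<open>b \<in> B\<close>] by simp
      then show "norm ((v \<bullet> b) *\<^sub>R (blinfun_apply (A b) x - b)) \<le> norm v * norm (blinfun_apply (A b) x - b)"
        by (simp add: mult_right_mono)
    qed
    also have "\<dots> = norm v * (\<Sum>b\<in>B. norm (blinfun_apply (A b) x - b))" by (simp add: sum_distrib_left)
    also have "\<dots> \<le> norm v * (1 / 2)" by (rule mult_left_mono[OF close]) simp
    finally show ?thesis using norm_triangle_ineq3[of "?Q v" v] by simp
  qed
  have inj: "inj_on ?Q (orbit_tangent G q)"
  proof (rule inj_onI)
    fix u v assume uv: "u \<in> orbit_tangent G q" "v \<in> orbit_tangent G q" "?Q u = ?Q v"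
    have "u - v \<in> orbit_tangent G q" using uv subspace_diff[OF subspace_orbit_tangent[OF sub]] by blast
    moreover have "?Q (u - v) = 0" using linear_diff[OF lin, of u v] uv(3) by simp
    ultimately show "u = v" using est[of "u - v"] by simp
  qed
  have sx: "subspace (orbit_tangent G x)" by (rule subspace_orbit_tangent[OF sub])
  have "?Q ` orbit_tangent G q \<subseteq> orbit_tangent G x"
  proof (intro image_subsetI subspace_sum[OF sx] subspace_scale[OF sx])
    show "blinfun_apply (A b) x \<in> orbit_tangent G x" if "b \<in> B" for b
      unfolding orbit_tangent_eq using A[OF that] by blast
  qed
  moreover have "dim (?Q ` orbit_tangent G q) = dim (orbit_tangent G q)"
    by (rule dim_image_eq[OF lin]) (simp add: inj span_eq_iff[THEN iffD2, OF subspace_orbit_tangent[OF sub]])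
  ultimately have "?Q ` orbit_tangent G q = orbit_tangent G x"
    using subspace_dim_equal[OF linear_subspace_image[OF lin subspace_orbit_tangent[OF sub]] sx] dim by simp
  then obtain v where "v \<in> orbit_tangent G q" "w = ?Q v" using w by blast
  then show thesis using that est by blast
qed

text \<open>Continuity of the orbit tangent spaces in quantitative form: the defect of any vector tangent to the orbit
through x is controlled by the defects of the frame vectors at x, which are small near q.\<close>

lemma norm_frame_defect_le:
  assumes sub: "subspace (lie_algebra G)" and fr: "orbit_frame G q B A"
    and dim: "dim (orbit_tangent G x) = dim (orbit_tangent G q)"
    and close: "(\<Sum>b\<in>B. norm (blinfun_apply (A b) x - b)) \<le> 1 / 2"
    and w: "w \<in> orbit_tangent G x"
  shows "norm (frame_defect B w) \<le> 2 * norm w * (\<Sum>b\<in>B. norm (frame_defect B (blinfun_apply (A b) x)))"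
proof -
  obtain v where v: "w = (\<Sum>b\<in>B. (v \<bullet> b) *\<^sub>R blinfun_apply (A b) x)" "norm v \<le> 2 * norm w"
    using orbit_frame_spans[OF assms] by metis
  have lin: "linear (frame_defect B)" by (rule bounded_linear.linear[OF bounded_linear_frame_defect])
  have nB: "norm b = 1" if "b \<in> B" for b using fr that unfolding orbit_frame_def by blast
  have e: "frame_defect B w = (\<Sum>b\<in>B. (v \<bullet> b) *\<^sub>R frame_defect B (blinfun_apply (A b) x))"
    unfolding v(1) by (simp only: linear_sum[OF lin] linear_cmul[OF lin])
  have "norm (frame_defect B w) \<le> (\<Sum>b\<in>B. norm ((v \<bullet> b) *\<^sub>R frame_defect B (blinfun_apply (A b) x)))"
    unfolding e by (rule norm_sum)
  also have "\<dots> \<le> (\<Sum>b\<in>B. 2 * norm w * norm (frame_defect B (blinfun_apply (A b) x)))"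
  proof (rule sum_mono)
    fix b assume "b \<in> B"
    have "\<bar>v \<bullet> b\<bar> \<le> 2 * norm w" using Cauchy_Schwarz_ineq2[of v b] nB[OF \<open>b \<in> B\<close>] v(2) by simp
    then show "norm ((v \<bullet> b) *\<^sub>R frame_defect B (blinfun_apply (A b) x))
        \<le> 2 * norm w * norm (frame_defect B (blinfun_apply (A b) x))"
      by (simp only: norm_scaleR real_norm_def) (rule mult_right_mono, auto)
  qed
  finally show ?thesis by (simp add: sum_distrib_left)
qed

lemma orbit_frame_tendsto:
  assumes "orbit_frame G q B A" "(c \<longlongrightarrow> q) F"
  shows "((\<lambda>t. \<Sum>b\<in>B. norm (blinfun_apply (A b) (c t) - b)) \<longlongrightarrow> 0) F"
    and "((\<lambda>t. \<Sum>b\<in>B. norm (frame_defect B (blinfun_apply (A b) (c t)))) \<longlongrightarrow> 0) F"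
proof -
  have A: "blinfun_apply (A b) q = b" "frame_defect B b = 0" if "b \<in> B" for b
    using assms(1) that frame_defect_eq_0_iff[OF assms(1)] span_base[OF that] unfolding orbit_frame_def by auto
  have "((\<lambda>t. \<Sum>b\<in>B. norm (blinfun_apply (A b) (c t) - b)) \<longlongrightarrow> (\<Sum>b\<in>B. norm (blinfun_apply (A b) q - b))) F"
    by (intro tendsto_intros bounded_linear.tendsto[OF blinfun.bounded_linear_right] assms(2))
  then show "((\<lambda>t. \<Sum>b\<in>B. norm (blinfun_apply (A b) (c t) - b)) \<longlongrightarrow> 0) F" using A by simp
  have "((\<lambda>t. \<Sum>b\<in>B. norm (frame_defect B (blinfun_apply (A b) (c t)))) \<longlongrightarrow>
      (\<Sum>b\<in>B. norm (frame_defect B (blinfun_apply (A b) q)))) F"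
    by (intro tendsto_intros bounded_linear.tendsto[OF bounded_linear_frame_defect]
        bounded_linear.tendsto[OF blinfun.bounded_linear_right] assms(2))
  then show "((\<lambda>t. \<Sum>b\<in>B. norm (frame_defect B (blinfun_apply (A b) (c t)))) \<longlongrightarrow> 0) F" using A by simp
qed

text \<open>An element A of the isotropy algebra of q acts trivially on tangent vectors of N modulo the orbit
directions: \<open>A h\<close> is the limit of \<open>A (c t) / t\<close>, which is tangent to the orbit through \<open>c t\<close>, and the
orbit tangent spaces vary continuously. Without constant orbit dimension this fails, for instance
for rotations at the origin of the plane.\<close>

lemma isotropy_maps_tangent_to_orbit:
  assumes sub: "subspace (lie_algebra G)" and q: "q \<in> regular_set G N"
    and A: "A \<in> lie_algebra G" "blinfun_apply A q = 0" and h: "h \<in> tangent_space N q"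
  shows "blinfun_apply A h \<in> orbit_tangent G q"
proof -
  obtain B E where fr: "orbit_frame G q B E" using orbit_frame_exists[OF sub] by metis
  obtain W where W: "openin N W" "q \<in> W" "\<And>x. x \<in> W \<Longrightarrow> dim (orbit_tangent G x) = dim (orbit_tangent G q)"
    using q unfolding regular_set_def by blast
  obtain c where c: "c 0 = q" "(c has_vector_derivative h) (at 0)" "\<forall>\<^sub>F t in at 0. c t \<in> W"
    using tangent_space_curve[OF h] W(1,2) by metis
  have cq: "(c \<longlongrightarrow> q) (at 0)"
    using has_vector_derivative_continuous[OF c(2)] c(1) by (simp add: continuous_within)
  let ?w = "\<lambda>t. blinfun_apply A (c t) /\<^sub>R t"
  let ?s = "\<lambda>t. \<Sum>b\<in>B. norm (frame_defect B (blinfun_apply (E b) (c t)))"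
  have w: "(?w \<longlongrightarrow> blinfun_apply A h) (at 0)"
    using has_vector_derivative_quotient[OF bounded_linear.has_vector_derivative[OF blinfun.bounded_linear_right c(2), of A]]
      c(1) A(2) by simp
  have small: "\<forall>\<^sub>F t in at 0. (\<Sum>b\<in>B. norm (blinfun_apply (E b) (c t) - b)) < 1 / 2"
    using order_tendstoD(2)[OF orbit_frame_tendsto(1)[OF fr cq], of "1/2"] by simp
  have "\<forall>\<^sub>F t in at 0. norm (frame_defect B (?w t)) \<le> 2 * norm (?w t) * ?s t"
    using small c(3)
  proof eventually_elim
    case (elim t)
    have "?w t \<in> orbit_tangent G (c t)"
      using A(1) subspace_scale[OF subspace_orbit_tangent[OF sub]] unfolding orbit_tangent_eq by blast
    then show ?case
      by (rule norm_frame_defect_le[OF sub fr W(3)[OF elim(2)] less_imp_le[OF elim(1)]])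
  qed
  moreover have "((\<lambda>t. 2 * norm (?w t) * ?s t) \<longlongrightarrow> 2 * norm (blinfun_apply A h) * 0) (at 0)"
    by (intro tendsto_intros w orbit_frame_tendsto(2)[OF fr cq])
  ultimately have "((\<lambda>t. frame_defect B (?w t)) \<longlongrightarrow> 0) (at 0)"
    using Lim_null_comparison by fastforce
  moreover have "((\<lambda>t. frame_defect B (?w t)) \<longlongrightarrow> frame_defect B (blinfun_apply A h)) (at 0)"
    by (rule bounded_linear.tendsto[OF bounded_linear_frame_defect w])
  ultimately have "frame_defect B (blinfun_apply A h) = 0"
    using tendsto_unique[OF trivial_limit_at] by blast
  then show ?thesis using frame_defect_eq_0_iff[OF fr] by blast
qed

text \<open>Pair symmetry follows from the four Bianchi identities in which the last argument runs through u, v, w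
and z.\<close>

lemma curvature_pair_symmetry:
  assumes g: "pseudo_inner g" and R: "algebraic_curvature_tensor g R"
  shows "g (R u v w) z = g (R w z u) v"
proof -
  have s1: "g (R u v w) z = - g (R v u w) z" for u v w z
    using R pseudo_inner_simps(9)[OF g, of "R v u w" z] unfolding algebraic_curvature_tensor_def by metis
  have s2: "g (R u v w) z = - g (R u v z) w" for u v w z
    using R pseudo_inner_sym[OF g] unfolding algebraic_curvature_tensor_def by metis
  have b: "g (R u v w) z + g (R v w u) z + g (R w u v) z = 0" for u v w z
  proof -
    have "R u v w + R v w u + R w u v = 0" using R unfolding algebraic_curvature_tensor_def by blast
    then have "g (R u v w + R v w u + R w u v) z = 0" using pseudo_inner_simps(1)[OF g] by simp
    then show ?thesis by (simp only: pseudo_inner_simps(3)[OF g])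
  qed
  show ?thesis
    using b[of u v w z] b[of v w z u] b[of w z u v] b[of z u v w]
      s1[of u v w z] s1[of v w u z] s1[of w u v z] s1[of w z u v] s1[of z u w v] s1[of v z w u]
      s1[of u w v z] s1[of u z w v] s1[of z v w u] s1[of z w u v]
      s2[of u v w z] s2[of v w u z] s2[of w u v z] s2[of w z u v] s2[of z u w v] s2[of v z w u] s2[of u z w v]
      s2[of v w z u] s2[of w z v u] s2[of z v w u] s2[of z u v w] s2[of u v z w] s2[of u w z v] s2[of w u z v]
    by linarith
qed

locale psd_curvature_action =
  fixes g :: "'a::euclidean_space \<Rightarrow> 'a \<Rightarrow> real"
    and G :: "('a \<Rightarrow>\<^sub>L 'a) topology"
    and R :: "'a \<Rightarrow> 'a \<Rightarrow> 'a \<Rightarrow> 'a"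
    and F :: "('a \<Rightarrow>\<^sub>L 'a) \<Rightarrow> ('a \<Rightarrow>\<^sub>L 'a)"
    and N :: "'a topology"
  assumes pseudo: "pseudo_inner g"
    and curvature: "algebraic_curvature_tensor g R"
    and spans: "span {Blinfun (R u v) |u v. True} = lie_algebra G"
    and operator: "is_curvature_operator g R F"
    and psd: "psd_curvature_operator g F"
    and nondegenerate: "nondegenerate_submanifold g N"
    and invariant: "locally_invariant G N"
begin

lemma subspace_lie_algebra: "subspace (lie_algebra G)"
  unfolding spans[symmetric] by (rule subspace_span)

lemmas subspace_orbit = subspace_orbit_tangent[OF subspace_lie_algebra]

lemma blinfun_curvature [simp]: "blinfun_apply (Blinfun (R u v)) = R u v"
proof -
  have "linear (R u v)" using curvature unfolding algebraic_curvature_tensor_def by blast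
  then show ?thesis using bounded_linear_Blinfun_apply linear_conv_bounded_linear by blast
qed

lemma curvature_in_lie_algebra: "Blinfun (R u v) \<in> lie_algebra G"
  unfolding spans[symmetric] by (rule span_base) blast

lemma subspace_tangent: "q \<in> topspace N \<Longrightarrow> subspace (tangent_space N q)"
  using nondegenerate subspace_tangent_space unfolding nondegenerate_submanifold_def by blast

lemma nondegenerate_tangent: "q \<in> topspace N \<Longrightarrow> nondegenerate_on g (tangent_space N q)"
  using nondegenerate unfolding nondegenerate_submanifold_def by blast

lemma regular_in_topspace: "q \<in> regular_set G N \<Longrightarrow> q \<in> topspace N"
  unfolding regular_set_def by blast

text \<open>By pair symmetry, orthogonality of y to all vectors \<open>R u v q\<close> says precisely that \<open>R q y\<close> vanishes.\<close>

lemma orbit_tangent_perp: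
  assumes "y \<in> g_orthogonal g (orbit_tangent G q)"
  shows "R q y u = 0"
proof (rule pseudo_inner_eq_0I[OF pseudo])
  fix v
  have "R u v q \<in> orbit_tangent G q"
    unfolding orbit_tangent_eq using curvature_in_lie_algebra[of u v] by (force intro: image_eqI[of _ _ "Blinfun (R u v)"])
  then have "g (R u v q) y = 0"
    using assms pseudo_inner_sym[OF pseudo, of "R u v q" y] unfolding g_orthogonal_def by simp
  then show "g (R q y u) v = 0" using curvature_pair_symmetry[OF pseudo curvature, of q y u v] by simp
qed

text \<open>For decomposable bivectors semi-definiteness is a statement about sectional curvature: the vanishing of the
quadratic form on \<open>u \<and> v\<close> already kills the endomorphism \<open>R u v\<close>.\<close>

lemma flat_plane_curvature_eq_0:
  assumes "g (R u v u) v = 0"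
  shows "R u v = (\<lambda>w. 0)"
proof
  fix w
  have op: "biv_inner g (F (wedge u v)) (wedge w z) = g (R u v w) z" for u v w z
    using operator unfolding is_curvature_operator_def by blast
  have "wedge u v \<in> bivectors" unfolding bivectors_def by (rule span_base) blast
  then have "F (wedge u v) = 0"
    using psd op[of u v u v] assms unfolding psd_curvature_operator_def by metis
  then have "g (R u v w) z = 0" for z using op[of u v w z] by (simp add: biv_inner_def pseudo_inner_simps[OF pseudo])
  then show "R u v w = 0" using pseudo_inner_eq_0I[OF pseudo] by blast
qed

text \<open>The Bianchi identity for h, y, q shows that \<open>R h y\<close> annihilates q. So it maps h to an orbit direction, which is
orthogonal to y; the sectional curvature of the plane of h and y is therefore 0.\<close>

lemma curvature_horizontal_eq_0:
  assumes q: "q \<in> regular_set G N" and h: "h \<in> horizontal_space g G N q"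
    and y: "y \<in> g_orthogonal g (orbit_tangent G q)"
  shows "R h y = (\<lambda>w. 0)"
proof (rule flat_plane_curvature_eq_0)
  have hT: "h \<in> tangent_space N q" "h \<in> g_orthogonal g (orbit_tangent G q)"
    using h unfolding horizontal_space_def by auto
  have "R h y q + R y q h + R q h y = 0" "R y q h = - R q y h"
    using curvature unfolding algebraic_curvature_tensor_def by blast+
  then have "R h y q = 0" using orbit_tangent_perp[OF hT(2)] orbit_tangent_perp[OF y] by simp
  then have "R h y h \<in> orbit_tangent G q"
    using isotropy_maps_tangent_to_orbit[OF subspace_lie_algebra q curvature_in_lie_algebra[of h y] _ hT(1)] by simp
  then show "g (R h y h) y = 0"
    using y pseudo_inner_sym[OF pseudo, of "R h y h" y] unfolding g_orthogonal_def by simp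
qed

text \<open>Pair symmetry rewrites \<open>g (R u v h) y\<close> as \<open>g (R h y u) v\<close>, which vanishes for y orthogonal to the
orbit; and the vectors orthogonal to all such y are the orbit directions.\<close>

lemma lie_algebra_maps_horizontal_to_orbit:
  assumes q: "q \<in> regular_set G N" and h: "h \<in> horizontal_space g G N q" and A: "A \<in> lie_algebra G"
  shows "blinfun_apply A h \<in> orbit_tangent G q"
proof -
  let ?S = "{A. blinfun_apply A h \<in> orbit_tangent G q}"
  have gen: "R u v h \<in> orbit_tangent G q" for u v
  proof -
    have "g (R u v h) y = 0" if y: "y \<in> g_orthogonal g (orbit_tangent G q)" for y
      using curvature_pair_symmetry[OF pseudo curvature, of u v h y] curvature_horizontal_eq_0[OF q h y]
      by (simp add: pseudo_inner_simps[OF pseudo])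
    then have "R u v h \<in> g_orthogonal g (g_orthogonal g (orbit_tangent G q))"
      unfolding g_orthogonal_def by blast
    then show ?thesis using g_orthogonal_orthogonal[OF pseudo subspace_orbit] by simp
  qed
  have "subspace ?S"
    using subspace_0[OF subspace_orbit] subspace_add[OF subspace_orbit] subspace_scale[OF subspace_orbit]
    by (auto simp: subspace_def blinfun.add_left blinfun.scaleR_left)
  then have "span {Blinfun (R u v) |u v. True} \<subseteq> ?S"
    by (intro span_minimal) (use gen in auto)
  then show ?thesis using A spans by blast
qed

end

section \<open>Shape operators\<close>

text \<open>Normal vectors are easier to extend as covectors. Transport vectors at x to q by \<open>D\<psi> \<circ> D\<phi>\<close>, which preserves
tangency to N, and pull back the covector \<open>g \<xi>\<close>; the vector dual to it under g depends on x only
through the derivative of \<open>\<phi>\<close>, hence smoothly.\<close>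

lemma local_normal_field_exists:
  fixes g :: "'a::euclidean_space \<Rightarrow> 'a \<Rightarrow> real"
  assumes g: "pseudo_inner g" and N: "submanifold k N" "q \<in> topspace N" and xi: "\<xi> \<in> normal_vectors g N q"
  obtains \<eta> where "local_normal_field g N q \<eta>" "\<eta> q = \<xi>"
proof -
  obtain S U V \<phi> \<psi> W where ch: "submanifold_chart N S U V \<phi> \<psi> W" "q \<in> S"
    using submanifold_chart_exists[OF N] by metis
  then have S: "openin N S" "S \<subseteq> U" "open U" "open V" and h: "homeomorphism U V \<phi> \<psi>"
    and sm: "smooth_on U \<phi>" "smooth_on V \<psi>"
    unfolding submanifold_chart_def by auto
  have qU: "q \<in> U" using S(2) ch(2) by blast
  let ?E = "frechet_derivative \<psi> (at (\<phi> q))"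
  let ?D = "\<lambda>x. frechet_derivative \<phi> (at x)"
  have "\<phi> q \<in> V" using homeomorphism_image1[OF h] qU by blast
  then have linE: "linear ?E" using has_derivative_linear[OF smooth_on_has_derivative[OF sm(2)]] by blast
  have linD: "linear (?D x)" if "x \<in> U" for x
    using has_derivative_linear[OF smooth_on_has_derivative[OF sm(1) that]] .
  have "\<exists>d. \<forall>v. g d v = v \<bullet> b" for b
    using pseudo_inner_represents[OF g bounded_linear.linear[OF bounded_linear_inner_left]] by metis
  then obtain d where d: "\<And>b v. g (d b) v = v \<bullet> b" by metis
  \<comment> \<open>The vectors \<open>d b\<close> form the g-dual basis, so that \<open>\<eta> x\<close> represents \<open>v \<mapsto> g \<xi> (?E (?D x v))\<close>.\<close>
  define \<eta> where "\<eta> x = (\<Sum>b\<in>Basis. g \<xi> (?E (?D x b)) *\<^sub>R d b)" for x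
  have geta: "g (\<eta> x) v = g \<xi> (?E (?D x v))" if x: "x \<in> U" for x v
  proof -
    have lin: "linear (\<lambda>v. g \<xi> (?E (?D x v)))"
      using linear_compose[OF linear_compose[OF linD[OF x] linE] pseudo_inner_linear(1)[OF g]]
      by (simp add: o_def)
    have "g (\<eta> x) v = (\<Sum>b\<in>Basis. g \<xi> (?E (?D x b)) * g (d b) v)"
      unfolding \<eta>_def by (simp only: linear_sum[OF pseudo_inner_linear(2)[OF g]] pseudo_inner_simps[OF g])
    also have "\<dots> = (\<Sum>b\<in>Basis. (v \<bullet> b) *\<^sub>R g \<xi> (?E (?D x b)))" by (simp add: d mult.commute)
    also have "\<dots> = g \<xi> (?E (?D x v))" by (rule linear_basis_expand[OF lin, symmetric])
    finally show ?thesis .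
  qed
  have "\<eta> q = \<xi>"
  proof -
    have "g (\<eta> q - \<xi>) v = 0" for v
      using geta[OF qU, of v] smooth_homeomorphism_derivatives(1)[OF h S(3,4) sm qU]
      by (simp add: pseudo_inner_simps[OF g])
    then have "\<eta> q - \<xi> = 0" by (rule pseudo_inner_eq_0I[OF g])
    then show ?thesis by simp
  qed
  moreover have "smooth_on U \<eta>"
    unfolding smooth_on_def \<eta>_def
  proof (intro allI Ck_on_sum S(3))
    fix k and b :: 'a
    have "bounded_linear (\<lambda>v. g \<xi> (?E v))"
      using linear_compose[OF linE pseudo_inner_linear(1)[OF g]] linear_conv_bounded_linear
      by (auto simp: o_def)
    then have bl: "bounded_linear (\<lambda>v. g \<xi> (?E v) *\<^sub>R d b)"
      by (rule bounded_linear_compose[OF bounded_linear_scaleR_left])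
    have "Ck_on (Suc k) U \<phi>" using sm(1) smooth_on_def by blast
    then have "Ck_on k U (\<lambda>x. ?D x b)" by simp
    then show "Ck_on k U (\<lambda>x. g \<xi> (?E (?D x b)) *\<^sub>R d b)"
      by (rule Ck_on_bounded_linear[OF S(3) bl])
  qed
  moreover have "\<eta> x \<in> normal_vectors g N x" if x: "x \<in> S" for x
  proof -
    have "g (\<eta> x) v = 0" if v: "v \<in> tangent_space N x" for v
    proof -
      have "?D x v \<in> W" using v tangent_space_chart_iff[OF ch(1) x] by blast
      then have "?E (?D x v) \<in> tangent_space N q" using tangent_space_chart[OF ch] by blast
      then show ?thesis
        using xi geta[of x v] S(2) x unfolding normal_vectors_def g_orthogonal_def by auto
    qed
    then show ?thesis unfolding normal_vectors_def g_orthogonal_def by blast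
  qed
  ultimately have "local_normal_field g N q \<eta>"
    unfolding local_normal_field_def using S ch(2) by blast
  then show thesis using that \<open>\<eta> q = \<xi>\<close> by blast
qed

context psd_curvature_action
begin

lemma orbit_subset_tangent: "q \<in> topspace N \<Longrightarrow> orbit_tangent G q \<subseteq> tangent_space N q"
  by (rule orbit_tangent_subset_tangent_space[OF invariant])

text \<open>Within the nondegenerate tangent space of N the double orthogonal complement of the orbit directions is again
the space of orbit directions, even if this space itself is degenerate.\<close>

lemma orbit_tangentI:
  assumes q: "q \<in> topspace N" and t: "t \<in> tangent_space N q"
    and perp: "\<And>h. h \<in> horizontal_space g G N q \<Longrightarrow> g t h = 0"
  shows "t \<in> orbit_tangent G q"
proof -
  have "g t y = 0" if y: "y \<in> g_orthogonal g (orbit_tangent G q)" for y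
  proof -
    obtain h where h: "h \<in> tangent_space N q" "y - h \<in> g_orthogonal g (tangent_space N q)"
      using nondegenerate_decomposition[OF pseudo subspace_tangent[OF q] nondegenerate_tangent[OF q]] by metis
    have "y - h \<in> g_orthogonal g (orbit_tangent G q)"
      using h(2) g_orthogonal_antimono[OF orbit_subset_tangent[OF q]] by blast
    then have "y - (y - h) \<in> g_orthogonal g (orbit_tangent G q)"
      by (rule subspace_diff[OF subspace_g_orthogonal[OF pseudo] y])
    then have "h \<in> horizontal_space g G N q" unfolding horizontal_space_def using h(1) by simp
    then have "g t h = 0" by (rule perp)
    moreover have "g (y - h) t = 0" using h(2) t unfolding g_orthogonal_def by blast
    ultimately show ?thesis
      using pseudo_inner_sym[OF pseudo, of "y - h" t] by (simp add: pseudo_inner_simps[OF pseudo])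
  qed
  then have "t \<in> g_orthogonal g (g_orthogonal g (orbit_tangent G q))" unfolding g_orthogonal_def by blast
  then show ?thesis using g_orthogonal_orthogonal[OF pseudo subspace_orbit] by simp
qed

text \<open>Differentiate \<open>g (\<eta> (\<alpha> t q)) (\<alpha> t h) = 0\<close> at 0 along a curve \<open>\<alpha>\<close> in G with velocity A at the identity.
The vector \<open>\<alpha> t h\<close> is tangent to N at \<open>\<alpha> t q\<close> by invariance, so no extension of h to a tangent vector
field has to be constructed.\<close>

lemma normal_field_derivative:
  assumes eta: "local_normal_field g N q \<eta>" and A: "A \<in> lie_algebra G" and h: "h \<in> tangent_space N q"
  shows "g (frechet_derivative \<eta> (at q) (blinfun_apply A q)) h = - g (\<eta> q) (blinfun_apply A h)"
proof -
  obtain O' W where O: "open O'" "openin N W" "q \<in> W" "W \<subseteq> O'" "smooth_on O' \<eta>"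
    "\<And>x. x \<in> W \<Longrightarrow> \<eta> x \<in> normal_vectors g N x"
    using eta unfolding local_normal_field_def by blast
  obtain U1 where U1: "openin G U1" "id_blinfun \<in> U1"
     "\<And>A. A \<in> U1 \<Longrightarrow> blinfun_apply A h \<in> tangent_space N (blinfun_apply A q)"
    using locally_invariant_tangent[OF invariant h] by metis
  have qN: "q \<in> topspace N" using tangent_space_topspace[OF h] .
  obtain U2 W2 where U2: "openin G U2" "id_blinfun \<in> U2" "openin N W2" "q \<in> W2"
     and c: "continuous_map (prod_topology (subtopology G U2) (subtopology N W2)) N (\<lambda>(A, x). blinfun_apply A x)"
    using invariant qN unfolding locally_invariant_def by blast
  obtain \<alpha> e where \<alpha>: "e > 0" "\<alpha> 0 = id_blinfun"
      "continuous_map (top_of_set {-e<..<e}) (subtopology G (U1 \<inter> U2)) \<alpha>" "(\<alpha> has_vector_derivative A) (at (0::real))"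
    using tangent_space_curve_within[OF A[unfolded lie_algebra_def] openin_Int[OF U1(1) U2(1)]] U1(2) U2(2) by blast
  let ?c = "\<lambda>t. blinfun_apply (\<alpha> t) q"
  have "q \<in> topspace (subtopology N W2)" using openin_subset[OF U2(3)] U2(4) by auto
  then have k: "continuous_map (top_of_set {-e<..<e}) (subtopology N W2) (\<lambda>t. q)" by simp
  have "continuous_map (top_of_set {-e<..<e}) (subtopology G U2) \<alpha>"
    using \<alpha>(3) by (auto simp: continuous_map_in_subtopology)
  from continuous_map_compose[OF continuous_map_pairedI[OF this k] c]
  have cont: "continuous_map (top_of_set {-e<..<e}) N ?c" by (simp add: o_def)
  have "openin (top_of_set {-e<..<e}) {t \<in> topspace (top_of_set {-e<..<e}). ?c t \<in> W}"
    by (rule openin_continuous_map_preimage[OF cont O(2)])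
  then have opI: "open {t \<in> {-e<..<e}. ?c t \<in> W}" by (simp add: openin_open_eq)
  let ?I = "{t \<in> {-e<..<e}. ?c t \<in> W}"
  have 0: "0 \<in> ?I" using \<alpha>(1,2) O(3) by simp
  have zero: "g (\<eta> (?c t)) (blinfun_apply (\<alpha> t) h) = 0" if t: "t \<in> ?I" for t
  proof -
    have "\<alpha> t \<in> U1" using \<alpha>(3) t by (auto simp: continuous_map_in_subtopology)
    then show ?thesis
      using U1(3) O(6)[of "?c t"] t unfolding normal_vectors_def g_orthogonal_def by auto
  qed
  have dc: "(?c has_derivative (\<lambda>t. t *\<^sub>R blinfun_apply A q)) (at 0)"
    using bounded_linear.has_vector_derivative[OF blinfun.bounded_linear_left \<alpha>(4)]
    unfolding has_vector_derivative_def .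
  have dh: "((\<lambda>t. blinfun_apply (\<alpha> t) h) has_derivative (\<lambda>t. t *\<^sub>R blinfun_apply A h)) (at 0)"
    using bounded_linear.has_vector_derivative[OF blinfun.bounded_linear_left \<alpha>(4)]
    unfolding has_vector_derivative_def .
  have deta: "(\<eta> has_derivative frechet_derivative \<eta> (at q)) (at (?c 0))"
    using smooth_on_has_derivative[OF O(5)] O(3,4) \<alpha>(2) by auto
  have "((\<lambda>t. g (\<eta> (?c t)) (blinfun_apply (\<alpha> t) h)) has_derivative
      (\<lambda>t. g (\<eta> (?c 0)) (t *\<^sub>R blinfun_apply A h) +
           g (frechet_derivative \<eta> (at q) (t *\<^sub>R blinfun_apply A q)) (blinfun_apply (\<alpha> 0) h))) (at 0)"
    by (rule bounded_bilinear.FDERIV[OF pseudo_inner_bounded_bilinear[OF pseudo] has_derivative_compose[OF dc deta] dh])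
  then have "((\<lambda>t. 0) has_derivative
      (\<lambda>t. g (\<eta> (?c 0)) (t *\<^sub>R blinfun_apply A h) +
           g (frechet_derivative \<eta> (at q) (t *\<^sub>R blinfun_apply A q)) (blinfun_apply (\<alpha> 0) h))) (at 0)"
    by (rule has_derivative_transform_within_open[OF _ opI 0]) (use zero in auto)
  then have "(\<lambda>t. g (\<eta> (?c 0)) (t *\<^sub>R blinfun_apply A h) +
           g (frechet_derivative \<eta> (at q) (t *\<^sub>R blinfun_apply A q)) (blinfun_apply (\<alpha> 0) h)) = (\<lambda>t. 0)"
    by (rule has_derivative_unique[OF _ has_derivative_const])
  from fun_cong[OF this, of 1] show ?thesis using \<alpha>(2) by simp
qed

theorem shape_operator_invariant:
  assumes q: "q \<in> regular_set G N" and xi: "\<xi> \<in> normal_vectors g N q"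
  shows "shape_operator g N q \<xi> ` orbit_tangent G q \<subseteq> orbit_tangent G q"
proof (intro image_subsetI)
  fix X assume "X \<in> orbit_tangent G q"
  then obtain A where A: "A \<in> lie_algebra G" "X = blinfun_apply A q" unfolding orbit_tangent_eq by blast
  have qN: "q \<in> topspace N" using q by (rule regular_in_topspace)
  obtain k where k: "submanifold k N" using nondegenerate unfolding nondegenerate_submanifold_def by blast
  define \<eta> where "\<eta> = (SOME \<eta>. local_normal_field g N q \<eta> \<and> \<eta> q = \<xi>)"
  have "\<exists>\<eta>. local_normal_field g N q \<eta> \<and> \<eta> q = \<xi>"
    using local_normal_field_exists[OF pseudo k qN xi] by metis
  then have eta: "local_normal_field g N q \<eta>" "\<eta> q = \<xi>"
    unfolding \<eta>_def by (rule someI2_ex, blast)+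
  let ?d = "frechet_derivative \<eta> (at q) X"
  note tp = tangential_part_eq[OF pseudo subspace_tangent[OF qN] nondegenerate_tangent[OF qN], of ?d]
  have "tangential_part g N q ?d \<in> orbit_tangent G q"
  proof (rule orbit_tangentI[OF qN tp(1)])
    fix h assume h: "h \<in> horizontal_space g G N q"
    then have hT: "h \<in> tangent_space N q" unfolding horizontal_space_def by blast
    have "blinfun_apply A h \<in> tangent_space N q"
      using lie_algebra_maps_horizontal_to_orbit[OF q h A(1)] orbit_subset_tangent[OF qN] by blast
    then have "g \<xi> (blinfun_apply A h) = 0" using xi unfolding normal_vectors_def g_orthogonal_def by blast
    then have "g ?d h = 0" using normal_field_derivative[OF eta(1) A(1) hT] eta(2) A(2) by simp
    moreover have "g (?d - tangential_part g N q ?d) h = 0"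
      using tp(2) hT unfolding normal_vectors_def g_orthogonal_def by blast
    ultimately show "g (tangential_part g N q ?d) h = 0" by (simp add: pseudo_inner_simps[OF pseudo])
  qed
  then show "shape_operator g N q \<xi> X \<in> orbit_tangent G q"
    unfolding shape_operator_def Let_def \<eta>_def[symmetric] by (rule subspace_neg[OF subspace_orbit])
qed

end

section \<open>Slices of a submanifold\<close>

lemma submanifold_chart_restrict:
  fixes N :: "'e::euclidean_space topology"
  assumes ch: "submanifold_chart N S U V \<phi> \<psi> W" and V': "open V'" "V' \<subseteq> V"
  shows "submanifold_chart N (S \<inter> (U \<inter> \<phi> -` V')) (U \<inter> \<phi> -` V') V' \<phi> \<psi> W"
proof -
  have S: "openin N S" "subtopology N S = top_of_set S" "S \<subseteq> U" "open U" "open V"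
    and h: "homeomorphism U V \<phi> \<psi>" and sm: "smooth_on U \<phi>" "smooth_on V \<psi>"
    and W: "subspace W" "\<phi> ` S = W \<inter> V"
    using ch unfolding submanifold_chart_def by auto
  have op: "open (U \<inter> \<phi> -` V')"
    by (rule continuous_open_preimage[OF smooth_on_continuous[OF sm(1)] S(4) V'(1)])
  have "\<phi> ` (U \<inter> \<phi> -` V') = V'"
  proof
    show "V' \<subseteq> \<phi> ` (U \<inter> \<phi> -` V')"
    proof
      fix y assume "y \<in> V'"
      then show "y \<in> \<phi> ` (U \<inter> \<phi> -` V')"
        using homeomorphism_apply2[OF h, of y] homeomorphism_image2[OF h] V'(2)
        by (intro image_eqI[of _ _ "\<psi> y"]) auto
    qed
  qed auto
  then have "homeomorphism (U \<inter> \<phi> -` V') V' \<phi> \<psi>"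
    using homeomorphism_of_subsets[OF h _ V'(2)] by auto
  moreover have "\<phi> ` (S \<inter> (U \<inter> \<phi> -` V')) = W \<inter> V'"
  proof
    show "\<phi> ` (S \<inter> (U \<inter> \<phi> -` V')) \<subseteq> W \<inter> V'" using W(2) by auto
    show "W \<inter> V' \<subseteq> \<phi> ` (S \<inter> (U \<inter> \<phi> -` V'))"
    proof
      fix z assume z: "z \<in> W \<inter> V'"
      then have "z \<in> \<phi> ` S" using W(2) V'(2) by auto
      then obtain x where x: "x \<in> S" "z = \<phi> x" by blast
      then show "z \<in> \<phi> ` (S \<inter> (U \<inter> \<phi> -` V'))" using z S(3) by (intro image_eqI[of _ _ x]) auto
    qed
  qed
  ultimately show ?thesis
    unfolding submanifold_chart_def
    using op V'(1) W(1) openin_slice_open[OF S(1,2) op] subtopology_slice_subset[OF S(2)]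
      smooth_on_subset[OF sm(1)] smooth_on_subset[OF sm(2) V'(2)] by auto
qed

lemma submanifold_chart_within:
  fixes N :: "'e::euclidean_space topology"
  assumes N: "submanifold k N" and O: "openin N O'" "q \<in> O'"
  obtains S U V \<phi> \<psi> W where "submanifold_chart N S U V \<phi> \<psi> W" "q \<in> S" "S \<subseteq> O'"
proof -
  have "q \<in> topspace N" using openin_subset[OF O(1)] O(2) by blast
  then obtain S U V \<phi> \<psi> W where ch: "submanifold_chart N S U V \<phi> \<psi> W" "q \<in> S"
    using submanifold_chart_exists[OF N] by metis
  then have S: "openin N S" "subtopology N S = top_of_set S" "S \<subseteq> U" "open U" "open V"
    and h: "homeomorphism U V \<phi> \<psi>" and sm: "smooth_on V \<psi>"
    unfolding submanifold_chart_def by auto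
  have "openin (subtopology N S) (S \<inter> O')" using O(1) by (rule openin_subtopology_Int2)
  then obtain X where X: "open X" "S \<inter> O' = S \<inter> X" unfolding S(2) openin_open by blast
  let ?V = "V \<inter> \<psi> -` X"
  have "open ?V" by (rule continuous_open_preimage[OF smooth_on_continuous[OF sm] S(5) X(1)])
  from submanifold_chart_restrict[OF ch(1) this]
  have "submanifold_chart N (S \<inter> (U \<inter> \<phi> -` ?V)) (U \<inter> \<phi> -` ?V) ?V \<phi> \<psi> W" by blast
  moreover have "S \<inter> (U \<inter> \<phi> -` ?V) = S \<inter> O'"
  proof -
    have "\<phi> x \<in> V" "\<psi> (\<phi> x) = x" "x \<in> U" if "x \<in> S" for x
      using that S(3) homeomorphism_apply1[OF h] homeomorphism_image1[OF h] by auto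
    then show ?thesis unfolding X(2) by auto
  qed
  ultimately show thesis using that ch(2) O(2) by (metis IntI inf_le2)
qed

text \<open>A chart \<open>\<phi>\<close> is straightened to \<open>x \<mapsto> J (\<phi> x) + \<mu> (x - J (\<phi> x))\<close>, where J inverts the derivative of \<open>\<phi>\<close> at q.
The second term moves points only within the tangent space at q, so N stays flat; it
replaces the \<open>\<mu>\<close>-component of \<open>J (\<phi> x)\<close> by that of x itself, so the new chart commutes
with \<open>\<mu>\<close>; and its derivative at q is the identity, so the inverse function theorem applies.\<close>

lemma projection_adapted_chart:
  fixes N :: "'e::euclidean_space topology"
  assumes N: "submanifold k N" and O: "openin N O'" "q \<in> O'"
    and mu: "linear \<mu>" "\<And>v. \<mu> (\<mu> v) = \<mu> v" "\<And>v. \<mu> v \<in> tangent_space N q"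
  obtains S U V \<phi> \<psi> where "submanifold_chart N S U V \<phi> \<psi> (tangent_space N q)" "q \<in> S" "S \<subseteq> O'"
    "\<And>x. x \<in> U \<Longrightarrow> \<mu> (\<phi> x) = \<mu> x" "frechet_derivative \<psi> (at (\<phi> q)) = (\<lambda>v. v)"
proof -
  obtain S U V \<phi> \<psi> W where ch: "submanifold_chart N S U V \<phi> \<psi> W" "q \<in> S" and SO: "S \<subseteq> O'"
    using submanifold_chart_within[OF N O] by metis
  then have S: "openin N S" "subtopology N S = top_of_set S" "S \<subseteq> U" "open U" "open V"
    and h: "homeomorphism U V \<phi> \<psi>" and sm: "smooth_on U \<phi>" "smooth_on V \<psi>"
    and W: "subspace W" "\<phi> ` S = W \<inter> V"
    unfolding submanifold_chart_def by auto
  have qU: "q \<in> U" using S(3) ch(2) by blast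
  let ?T = "tangent_space N q"
  define J where "J = frechet_derivative \<psi> (at (\<phi> q))"
  have qV: "\<phi> q \<in> V" using homeomorphism_image1[OF h] qU by blast
  have blJ: "bounded_linear J"
    unfolding J_def using has_derivative_bounded_linear[OF smooth_on_has_derivative[OF sm(2) qV]] .
  have blm: "bounded_linear \<mu>" using mu(1) linear_conv_bounded_linear by blast
  note inv = smooth_homeomorphism_derivatives[OF h S(4,5) sm qU, folded J_def]
  have T: "?T = J ` W" unfolding J_def by (rule tangent_space_chart[OF ch])
  have sT: "subspace ?T" unfolding T by (rule linear_subspace_image[OF bounded_linear.linear[OF blJ] W(1)])
  have JW: "w \<in> W" if "J w \<in> ?T" for w
  proof -
    have "J w \<in> J ` W" using that unfolding T .
    then obtain w' where w': "w' \<in> W" "J w = J w'" by (elim imageE)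
    have "w = w'" using inv(2)[of w] inv(2)[of w'] unfolding w'(2) by (rule trans[OF sym])
    then show ?thesis using w'(1) by simp
  qed
  define \<Theta> where "\<Theta> x = J (\<phi> x) + \<mu> (x - J (\<phi> x))" for x
  define D where "D x v = J (frechet_derivative \<phi> (at x) v) + \<mu> (v - J (frechet_derivative \<phi> (at x) v))" for x v
  have mT: "\<mu> (\<Theta> x) = \<mu> x" for x
    unfolding \<Theta>_def by (simp add: linear_add[OF mu(1)] linear_diff[OF mu(1)] mu(2))
  have smT: "smooth_on U \<Theta>"
    unfolding smooth_on_def
  proof
    fix k
    have p: "Ck_on k U \<phi>" using sm(1) smooth_on_def by blast
    have i: "Ck_on k U (\<lambda>x. x)"
    proof (cases k)
      case (Suc j)
      show ?thesis unfolding Suc by (rule Ck_on_SucI[OF S(4) has_derivative_ident]) (rule Ck_on_const)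
    qed simp
    show "Ck_on k U \<Theta>"
      unfolding \<Theta>_def by (intro Ck_on_add Ck_on_diff Ck_on_bounded_linear[OF _ blm] Ck_on_bounded_linear[OF _ blJ] S(4) p i)
  qed
  have derT: "(\<Theta> has_derivative D x) (at x)" if x: "x \<in> U" for x
    unfolding \<Theta>_def D_def
    by (intro has_derivative_add has_derivative_diff has_derivative_ident bounded_linear.has_derivative[OF blm]
        bounded_linear.has_derivative[OF blJ] smooth_on_has_derivative[OF sm(1) x])
  have Dfr: "frechet_derivative \<Theta> (at x) = D x" if "x \<in> U" for x
    using frechet_derivative_at[OF derT[OF that]] by simp
  have Dq: "D q v = v" for v unfolding D_def using inv(1) linear_0[OF mu(1)] by simp
  have blD: "blinfun_apply (Blinfun (D x)) = D x" if "x \<in> U" for x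
    using bounded_linear_Blinfun_apply[OF has_derivative_bounded_linear[OF derT[OF that]]] .
  have der': "(\<Theta> has_derivative blinfun_apply (Blinfun (D x))) (at x)" if "x \<in> U" for x
    using derT[OF that] blD[OF that] by simp
  have cont': "continuous_on U (\<lambda>x. Blinfun (D x))"
  proof (rule continuous_on_blinfun_componentwise)
    fix i :: 'e
    show "continuous_on U (\<lambda>x. blinfun_apply (Blinfun (D x)) i)"
      using smooth_on_deriv_continuous[OF smT, of i]
      by (rule continuous_on_cong[THEN iffD1, rotated 2]) (auto simp: blD Dfr)
  qed
  have id: "id_blinfun o\<^sub>L Blinfun (D q) = id_blinfun"
    by (rule blinfun_eqI) (simp add: blD[OF qU] Dq)
  obtain U' V' \<Psi> D' where U': "open U'" "U' \<subseteq> U" "q \<in> U'" "open V'" "\<Theta> q \<in> V'" "homeomorphism U' V' \<Theta> \<Psi>"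
    and dPsi: "\<And>y. y \<in> V' \<Longrightarrow> (\<Psi> has_derivative (D' y)) (at y)"
    and D': "\<And>y. y \<in> V' \<Longrightarrow> D' y = inv (blinfun_apply (Blinfun (D (\<Psi> y))))"
    and bij: "\<And>y. y \<in> V' \<Longrightarrow> bij (blinfun_apply (Blinfun (D (\<Psi> y))))"
    using inverse_function_theorem[OF S(4) der' cont' qU id] by metis
  have PsiU: "\<Psi> y \<in> U'" if "y \<in> V'" for y using homeomorphism_image2[OF U'(6)] that by blast
  have smPsi: "smooth_on V' \<Psi>"
  proof (rule smooth_on_inverse[OF U'(1,4) smooth_on_subset[OF smT U'(2)] PsiU dPsi])
    fix y v assume y: "y \<in> V'"
    have yU: "\<Psi> y \<in> U" using PsiU[OF y] U'(2) by blast
    show "frechet_derivative \<Theta> (at (\<Psi> y)) (D' y v) = v"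
      unfolding Dfr[OF yU] D'[OF y] blD[OF yU] using bij[OF y] unfolding blD[OF yU]
      by (simp add: bij_is_surj surj_f_inv_f)
  qed
  have im: "\<Theta> ` (S \<inter> U') = ?T \<inter> V'"
  proof
    show "\<Theta> ` (S \<inter> U') \<subseteq> ?T \<inter> V'"
    proof (rule image_subsetI)
      fix x assume x: "x \<in> S \<inter> U'"
      have "J (\<phi> x) \<in> ?T" unfolding T using x W(2) by blast
      then have "\<Theta> x \<in> ?T" unfolding \<Theta>_def by (rule subspace_add[OF sT _ mu(3)])
      then show "\<Theta> x \<in> ?T \<inter> V'" using homeomorphism_image1[OF U'(6)] x by blast
    qed
    show "?T \<inter> V' \<subseteq> \<Theta> ` (S \<inter> U')"
    proof
      fix z assume z: "z \<in> ?T \<inter> V'"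
      define x where "x = \<Psi> z"
      have x: "x \<in> U'" "\<Theta> x = z" unfolding x_def using PsiU homeomorphism_apply2[OF U'(6)] z by auto
      have "J (\<phi> x) = z - \<mu> (x - J (\<phi> x))" using x(2) unfolding \<Theta>_def by (simp add: algebra_simps)
      moreover have "z - \<mu> (x - J (\<phi> x)) \<in> ?T" by (rule subspace_diff[OF sT _ mu(3)]) (use z in blast)
      ultimately have "J (\<phi> x) \<in> ?T" by (simp only:)
      then have "\<phi> x \<in> W" by (rule JW)
      moreover have "\<phi> x \<in> V" using x(1) U'(2) homeomorphism_image1[OF h] by blast
      ultimately obtain x' where x': "x' \<in> S" "\<phi> x = \<phi> x'" using W(2) by blast
      have "x = x'" using homeomorphism_apply1[OF h, of x] homeomorphism_apply1[OF h, of x'] x(1) x' U'(2) S(3) by auto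
      then show "z \<in> \<Theta> ` (S \<inter> U')" using x x'(1) by blast
    qed
  qed
  have "submanifold_chart N (S \<inter> U') U' V' \<Theta> \<Psi> ?T"
    unfolding submanifold_chart_def
    using U' smPsi sT im smooth_on_subset[OF smT U'(2)] openin_slice_open[OF S(1,2) U'(1)]
      subtopology_slice_subset[OF S(2), of "S \<inter> U'"] by auto
  moreover have "frechet_derivative \<Psi> (at (\<Theta> q)) = (\<lambda>v. v)"
  proof
    fix v
    show "frechet_derivative \<Psi> (at (\<Theta> q)) v = v"
      using smooth_homeomorphism_derivatives(1)[OF U'(6,1,4) smooth_on_subset[OF smT U'(2)] smPsi U'(3), of v]
      by (simp add: Dfr[OF qU] Dq)
  qed
  ultimately show thesis using that[of "S \<inter> U'" U' V' \<Theta> \<Psi>] ch(2) U'(3) SO mT by blast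
qed

text \<open>A chart that commutes with \<open>\<mu>\<close> flattens N and the kernel of \<open>\<mu>\<close> simultaneously.\<close>

lemma submanifold_chart_slice:
  fixes N :: "'e::euclidean_space topology"
  assumes ch: "submanifold_chart N S U V \<phi> \<psi> W" and mu: "linear \<mu>"
    and pres: "\<And>x. x \<in> U \<Longrightarrow> \<mu> (\<phi> x) = \<mu> x"
  shows "submanifold_chart (top_of_set (S \<inter> {x. \<mu> x = 0})) (S \<inter> {x. \<mu> x = 0}) U V \<phi> \<psi> (W \<inter> {x. \<mu> x = 0})"
proof -
  have S: "S \<subseteq> U" and W: "subspace W" "\<phi> ` S = W \<inter> V" using ch unfolding submanifold_chart_def by auto
  have "\<phi> ` (S \<inter> {x. \<mu> x = 0}) = W \<inter> {x. \<mu> x = 0} \<inter> V"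
  proof
    show "\<phi> ` (S \<inter> {x. \<mu> x = 0}) \<subseteq> W \<inter> {x. \<mu> x = 0} \<inter> V" using W(2) pres S by auto
    show "W \<inter> {x. \<mu> x = 0} \<inter> V \<subseteq> \<phi> ` (S \<inter> {x. \<mu> x = 0})"
    proof
      fix z assume z: "z \<in> W \<inter> {x. \<mu> x = 0} \<inter> V"
      then obtain x where x: "x \<in> S" "z = \<phi> x" using W(2) by blast
      then show "z \<in> \<phi> ` (S \<inter> {x. \<mu> x = 0})" using z pres[of x] S by auto
    qed
  qed
  moreover have "subspace (W \<inter> {x. \<mu> x = 0})"
    using W(1) linear_subspace_kernel[OF mu] by (rule subspace_inter)
  ultimately show ?thesis using ch unfolding submanifold_chart_def by (auto simp: subtopology_subtopology)
qed

lemma second_countable_euclidean: "second_countable (euclidean :: 'a::second_countable_topology topology)"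
proof -
  obtain B :: "'a set set" where B: "countable B" "topological_basis B" using ex_countable_basis by blast
  show ?thesis
    unfolding second_countable_def
  proof (intro exI[of _ B] conjI ballI allI impI)
    show "openin euclidean V" if "V \<in> B" for V using topological_basis_open[OF B(2) that] by simp
    show "\<exists>V\<in>B. x \<in> V \<and> V \<subseteq> U" if "openin euclidean U \<and> x \<in> U" for U x
    proof -
      have U: "open U" "x \<in> U" using that by simp_all
      show ?thesis by (rule topological_basisE[OF B(2) U]) blast
    qed
  qed (rule B(1))
qed

lemma submanifold_of_chart:
  fixes L :: "'e::euclidean_space set"
  assumes "submanifold_chart (top_of_set L) L U V \<phi> \<psi> W"
  shows "submanifold (dim W) (top_of_set L)"
proof -
  have c: "L \<subseteq> U" "open U" "open V" "homeomorphism U V \<phi> \<psi>" "smooth_on U \<phi>" "smooth_on V \<psi>" "subspace W" "\<phi> ` L = W \<inter> V"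
    using assms unfolding submanifold_chart_def by auto
  have "\<phi> ` (L \<inter> U) = W \<inter> V" using c(1,8) by (simp add: Int_absorb2)
  then have "embedded_submanifold (dim W) L"
    unfolding embedded_submanifold_def
    by (intro ballI exI[of _ U] exI[of _ V] exI[of _ \<phi>] exI[of _ \<psi>] exI[of _ W] conjI) (use c in auto)
  then show ?thesis
    unfolding submanifold_def
    using second_countable_subtopology[OF second_countable_euclidean, of L]
    by (auto intro!: exI[of _ L] simp: subtopology_subtopology)
qed

section \<open>A Gronwall argument and a transversality argument\<close>

text \<open>Gronwall's argument for the energy \<open>\<Sum>b\<in>B. u b t \<bullet> u b t\<close>, whose derivative is at most \<open>2 * K * card B\<close> times the
energy.\<close>

lemma gronwall_family:
  fixes u :: "'i \<Rightarrow> real \<Rightarrow> 'a::real_inner"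
  assumes der: "\<And>b t. b \<in> B \<Longrightarrow> 0 \<le> t \<Longrightarrow> t \<le> 1 \<Longrightarrow> (u b has_vector_derivative u' b t) (at t)"
    and bound: "\<And>b t. b \<in> B \<Longrightarrow> 0 \<le> t \<Longrightarrow> t \<le> 1 \<Longrightarrow> norm (u' b t) \<le> K * (\<Sum>c\<in>B. norm (u c t))"
    and init: "\<And>b. b \<in> B \<Longrightarrow> u b 0 = 0" and "finite B" "K \<ge> 0" "b \<in> B"
  shows "u b 1 = 0"
proof -
  let ?S = "\<lambda>t. \<Sum>b\<in>B. u b t \<bullet> u b t"
  define L where "L = 2 * K * card B"
  have "exp (- L * 1) * ?S 1 \<le> exp (- L * 0) * ?S 0"
  proof (rule DERIV_nonpos_imp_nonincreasing[where f = "\<lambda>t. exp (- L * t) * ?S t"])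
    fix t :: real assume t: "0 \<le> t" "t \<le> 1"
    \<comment> \<open>The double sum below comes from \<open>2 x y \<le> x\<^sup>2 + y\<^sup>2\<close>; this is the origin of the factor \<open>card B\<close> in L.\<close>
    let ?S' = "\<Sum>b\<in>B. 2 * (u b t \<bullet> u' b t)"
    have dS: "(?S has_real_derivative ?S') (at t)"
    proof (rule DERIV_sum)
      fix b assume b: "b \<in> B"
      have d: "(u b has_derivative (\<lambda>h. h *\<^sub>R u' b t)) (at t)"
        using der[OF b t] unfolding has_vector_derivative_def .
      have "((\<lambda>t. u b t \<bullet> u b t) has_derivative (\<lambda>h. u b t \<bullet> (h *\<^sub>R u' b t) + (h *\<^sub>R u' b t) \<bullet> u b t)) (at t)"
        by (rule has_derivative_inner[OF d d])
      then show "((\<lambda>t. u b t \<bullet> u b t) has_real_derivative 2 * (u b t \<bullet> u' b t)) (at t)"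
        unfolding has_field_derivative_def
        by (rule has_derivative_eq_rhs) (simp add: fun_eq_iff inner_commute)
    qed
    have "?S' \<le> (\<Sum>b\<in>B. \<Sum>c\<in>B. K * (u b t \<bullet> u b t + u c t \<bullet> u c t))"
    proof (rule sum_mono)
      fix b assume b: "b \<in> B"
      have "u b t \<bullet> u' b t \<le> norm (u b t) * norm (u' b t)" by (rule norm_cauchy_schwarz)
      also have "\<dots> \<le> norm (u b t) * (K * (\<Sum>c\<in>B. norm (u c t)))"
        by (rule mult_left_mono[OF bound[OF b t]]) simp
      finally have "2 * (u b t \<bullet> u' b t) \<le> 2 * (norm (u b t) * (K * (\<Sum>c\<in>B. norm (u c t))))" by simp
      also have "\<dots> = (\<Sum>c\<in>B. K * (2 * norm (u b t) * norm (u c t)))"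
        by (simp add: sum_distrib_left mult_ac)
      also have "\<dots> \<le> (\<Sum>c\<in>B. K * (u b t \<bullet> u b t + u c t \<bullet> u c t))"
      proof (intro sum_mono mult_left_mono assms(5))
        fix c
        show "2 * norm (u b t) * norm (u c t) \<le> u b t \<bullet> u b t + u c t \<bullet> u c t"
          using sum_squares_bound[of "norm (u b t)" "norm (u c t)"] by (simp add: power2_norm_eq_inner)
      qed
      finally show "2 * (u b t \<bullet> u' b t) \<le> (\<Sum>c\<in>B. K * (u b t \<bullet> u b t + u c t \<bullet> u c t))" .
    qed
    also have "\<dots> = L * ?S t"
      unfolding L_def by (simp add: sum.distrib sum_distrib_left[symmetric] algebra_simps)
    finally have le: "?S' \<le> L * ?S t" .
    have "((\<lambda>t. exp (- L * t) * ?S t) has_real_derivative exp (- L * t) * (- L) * ?S t + ?S' * exp (- L * t)) (at t)"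
      by (rule DERIV_mult[OF _ dS]) (auto intro!: derivative_eq_intros)
    moreover have "exp (- L * t) * (- L) * ?S t + ?S' * exp (- L * t) \<le> 0"
    proof -
      have "exp (- L * t) * (- L) * ?S t + ?S' * exp (- L * t) = exp (- L * t) * (?S' - L * ?S t)"
        by (simp add: algebra_simps)
      also have "\<dots> \<le> 0" using le by (simp add: mult_nonneg_nonpos)
      finally show ?thesis .
    qed
    ultimately show "\<exists>y. ((\<lambda>t. exp (- L * t) * ?S t) has_real_derivative y) (at t) \<and> y \<le> 0" by blast
  qed simp
  then have "exp (- L) * ?S 1 \<le> 0" using init by simp
  then have "?S 1 \<le> 0" by (simp add: mult_le_0_iff)
  moreover have "?S 1 \<ge> u b 1 \<bullet> u b 1" by (rule member_le_sum) (use assms in auto)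
  ultimately have "u b 1 \<bullet> u b 1 \<le> 0" by linarith
  then show ?thesis by (metis inner_eq_zero_iff inner_ge_zero order_antisym)
qed

text \<open>The map \<open>v \<mapsto> (\<Sum>b\<in>B. g v b *\<^sub>R b)\<close> has the g-orthogonal complement of \<open>span B\<close> as its kernel. It is onto \<open>span B\<close>
already when restricted to T: a vector z of \<open>span B\<close> that is Euclidean-orthogonal to the image is
g-orthogonal to T, and T is nondegenerate and contains z. So the section \<open>\<theta>\<close> can be chosen
with values in T, which expresses the transversality of T and that complement.\<close>

lemma transversal_section:
  assumes g: "pseudo_inner g" and T: "subspace T" "nondegenerate_on g T" and BT: "span B \<subseteq> T"
    and B: "pairwise orthogonal B" "\<And>b. b \<in> B \<Longrightarrow> norm b = 1"
  obtains \<theta> where "linear \<theta>" "\<And>y. \<theta> y \<in> T" "\<And>y. y \<in> span B \<Longrightarrow> (\<Sum>b\<in>B. g (\<theta> y) b *\<^sub>R b) = y"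
proof -
  let ?n = "\<lambda>v. \<Sum>b\<in>B. g v b *\<^sub>R b"
  have fin: "finite B"
  proof -
    have "0 \<notin> B" using B(2) by force
    then show ?thesis by (intro independent_imp_finite pairwise_orthogonal_independent[OF B(1)])
  qed
  have lin: "linear ?n"
    by (rule linearI) (simp_all add: pseudo_inner_simps[OF g] scaleR_add_left sum.distrib scaleR_sum_right)
  obtain \<theta> where th: "range \<theta> \<subseteq> T" "linear \<theta>" "\<forall>v\<in>?n ` T. ?n (\<theta> v) = v"
    using linear_exists_right_inverse_on[OF lin T(1)] by (elim exE conjE)
  have "y \<in> ?n ` T" if y: "y \<in> span B" for y
  proof -
    define M where "M = ?n ` T"
    have sp: "span M = M"
      unfolding M_def using linear_subspace_image[OF lin T(1)] by simp
    obtain p z where p: "p \<in> M" "\<And>w. w \<in> M \<Longrightarrow> orthogonal z w" "y = p + z"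
      using orthogonal_subspace_decomp_exists[of M y] unfolding sp by metis
    have "M \<subseteq> span B" unfolding M_def by (intro image_subsetI span_sum span_scale span_base)
    then have "p \<in> span B" using p(1) by blast
    then have z: "z \<in> span B" using span_diff[OF y, of p] p(3) by simp
    have "g z h = 0" if h: "h \<in> T" for h
    proof -
      have "0 = z \<bullet> ?n h" using p(2)[of "?n h"] h unfolding M_def by (simp add: orthogonal_def)
      also have "\<dots> = (\<Sum>b\<in>B. (z \<bullet> b) * g h b)" by (simp add: inner_sum_right mult.commute)
      also have "\<dots> = g h (\<Sum>b\<in>B. (z \<bullet> b) *\<^sub>R b)"
        by (simp only: linear_sum[OF pseudo_inner_linear(1)[OF g]] pseudo_inner_simps[OF g])
      also have "(\<Sum>b\<in>B. (z \<bullet> b) *\<^sub>R b) = z" by (rule orthonormal_basis_expand[OF B z fin])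
      finally show ?thesis using pseudo_inner_sym[OF g, of z h] by simp
    qed
    then have "z = 0" using T(2) z BT unfolding nondegenerate_on_def by blast
    then show ?thesis using p(1,3) unfolding M_def by simp
  qed
  then show thesis using that[of \<theta>] th by blast
qed

section \<open>Integral manifolds of the horizontal distribution\<close>

context psd_curvature_action
begin

text \<open>The curvature endomorphisms are skew, so orbit directions are orthogonal to the position vector; this
is why the slice \<open>K\<^sub>q\<close> is a linear subspace through q and not merely an affine one.\<close>

lemma position_perp_orbit: "q \<in> g_orthogonal g (orbit_tangent G q)"
proof -
  have "subspace {A. g q (blinfun_apply A q) = 0}"
    by (simp add: subspace_def blinfun.add_left blinfun.scaleR_left pseudo_inner_simps[OF pseudo])
  moreover have "g q (R u v q) = 0" for u v
  proof -
    have "g (R u v q) q = - g q (R u v q)"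
      using curvature unfolding algebraic_curvature_tensor_def by blast
    then show ?thesis using pseudo_inner_sym[OF pseudo, of q "R u v q"] by simp
  qed
  ultimately have "span {Blinfun (R u v) |u v. True} \<subseteq> {A. g q (blinfun_apply A q) = 0}"
    by (intro span_minimal) auto
  then show ?thesis unfolding spans g_orthogonal_def orbit_tangent_eq by blast
qed

lemma regular_set_openin:
  assumes q: "q \<in> regular_set G N"
  obtains O' where "openin N O'" "q \<in> O'" "O' \<subseteq> regular_set G N"
    "\<And>x. x \<in> O' \<Longrightarrow> dim (orbit_tangent G x) = dim (orbit_tangent G q)"
proof -
  obtain W where W: "openin N W" "q \<in> W" "\<forall>x\<in>W. dim (orbit_tangent G x) = dim (orbit_tangent G q)"
    using q unfolding regular_set_def by blast
  have "W \<subseteq> regular_set G N"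
  proof
    fix x assume x: "x \<in> W"
    have "\<forall>y\<in>W. dim (orbit_tangent G y) = dim (orbit_tangent G x)" using W(3) x by simp
    then show "x \<in> regular_set G N"
      unfolding regular_set_def using W(1) x openin_subset[OF W(1)] by blast
  qed
  then show thesis using that W by blast
qed

text \<open>A tangent vector h of N at x becomes horizontal after subtraction of a tangent vector \<open>E v\<close> that has the same
inner products with the frame vectors \<open>A b x\<close>. Here E identifies the tangent space at q with that at x.
The system for v has the form \<open>F v = \<theta> (\<dots>)\<close> with a linear map F on the whole space that is close to
the identity, which makes it solvable together with a bound for v. Every solution automatically lies in T, and
applying the left inverse of \<open>\<theta>\<close> to the equation recovers the desired equality of inner products.\<close>

lemma horizontal_correction:
  assumes x: "x \<in> regular_set G N" and dim: "dim (orbit_tangent G x) = dim (orbit_tangent G q)"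
    and fr: "orbit_frame G q B A"
    and close: "(\<Sum>b\<in>B. norm (blinfun_apply (A b) x - b)) \<le> 1 / 2"
    and T: "subspace T"
    and th: "linear \<theta>" "\<And>y. \<theta> y \<in> T" "\<And>y. y \<in> span B \<Longrightarrow> (\<Sum>b\<in>B. g (\<theta> y) b *\<^sub>R b) = y"
    and E: "linear E" "E ` T \<subseteq> tangent_space N x"
    and near: "\<And>v. norm (v - \<theta> (\<Sum>b\<in>B. g v b *\<^sub>R b) + \<theta> (\<Sum>b\<in>B. g (E v) (blinfun_apply (A b) x) *\<^sub>R b) - v) \<le> norm v / 2"
    and h: "h \<in> tangent_space N x"
  obtains v where "h - E v \<in> horizontal_space g G N x"
    "norm v \<le> 2 * norm (\<theta> (\<Sum>b\<in>B. g h (blinfun_apply (A b) x) *\<^sub>R b))"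
proof -
  let ?n = "\<lambda>v. \<Sum>b\<in>B. g v b *\<^sub>R b"
  let ?nx = "\<lambda>v. \<Sum>b\<in>B. g v (blinfun_apply (A b) x) *\<^sub>R b"
  let ?F = "\<lambda>v. v - \<theta> (?n v) + \<theta> (?nx (E v))"
  have ln: "linear ?n" "linear ?nx"
    by (rule linearI, simp_all add: pseudo_inner_simps[OF pseudo] scaleR_add_left sum.distrib scaleR_sum_right)+
  have lF: "linear ?F"
    using linear_compose_add[OF linear_compose_sub[OF linear_id linear_compose[OF ln(1) th(1)]]
        linear_compose[OF linear_compose[OF E(1) ln(2)] th(1)]] by (simp add: o_def id_def)
  have lower: "norm v \<le> 2 * norm (?F v)" for v
    using near[of v] norm_triangle_ineq3[of "?F v" v] by simp
  have "inj ?F"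
  proof (rule iffD2[OF linear_injective_0[OF lF]], intro allI impI)
    fix v assume 0: "?F v = 0"
    show "v = 0" using lower[of v] unfolding 0 by simp
  qed
  then have "surj ?F" by (rule eucl.linear_inj_imp_surj[OF lF])
  then obtain v where v: "\<theta> (?nx h) = ?F v" by (rule surjE)
  \<comment> \<open>The equation solved by v says \<open>v = \<theta> y\<close>; so v has values in T and \<open>?n v = y\<close>.\<close>
  define y where "y = ?n v + ?nx h - ?nx (E v)"
  have spanB: "?n w \<in> span B" "?nx w \<in> span B" for w by (intro span_sum span_scale span_base; assumption)+
  have yB: "y \<in> span B" unfolding y_def by (intro span_add span_diff spanB)
  have vy: "v = \<theta> y" unfolding y_def using v by (simp add: linear_add[OF th(1)] linear_diff[OF th(1)] algebra_simps)
  have "?n v = y" unfolding vy by (rule th(3)[OF yB])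
  then have nxv: "?nx h = ?nx (E v)" unfolding y_def by simp
  have xN: "x \<in> topspace N" using x by (rule regular_in_topspace)
  have "v \<in> T" using th(2) vy by simp
  then have "h - E v \<in> tangent_space N x" using h E(2) subspace_diff[OF subspace_tangent[OF xN]] by blast
  moreover have "h - E v \<in> g_orthogonal g (orbit_tangent G x)"
  proof -
    have fin: "finite B" and ortho: "pairwise orthogonal B" and nB: "\<And>b. b \<in> B \<Longrightarrow> norm b = 1"
      using fr unfolding orbit_frame_def by auto
    have ind: "independent B"
      using pairwise_orthogonal_independent[OF ortho] nB by force
    have "?nx (h - E v) = 0" using linear_diff[OF ln(2), of h "E v"] nxv by simp
    then have z: "g (h - E v) (blinfun_apply (A b) x) = 0" if "b \<in> B" for b
      using ind fin that independentD[OF ind fin order_refl, of "\<lambda>b. g (h - E v) (blinfun_apply (A b) x)" b] by blast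
    have "g (h - E v) w = 0" if w: "w \<in> orbit_tangent G x" for w
    proof -
      obtain c where c: "w = (\<Sum>b\<in>B. (c \<bullet> b) *\<^sub>R blinfun_apply (A b) x)"
        using orbit_frame_spans[OF subspace_lie_algebra fr dim close w] by metis
      show ?thesis
        unfolding c by (simp add: linear_sum[OF pseudo_inner_linear(1)[OF pseudo]] pseudo_inner_simps(8)[OF pseudo] z)
    qed
    then show ?thesis unfolding g_orthogonal_def by blast
  qed
  ultimately have "h - E v \<in> horizontal_space g G N x" unfolding horizontal_space_def by blast
  moreover have "norm v \<le> 2 * norm (\<theta> (?nx h))" using lower[of v] unfolding v .
  ultimately show thesis using that by blast
qed

text \<open>The linear estimate that enters Gronwall's argument. Let h be orthogonal to the orbit through q
and let \<open>\<delta>\<close> be the total defect of the frame at x. Then \<open>g h (A b x)\<close> only sees the defect of \<open>A b x\<close>, so the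
correction e is of order \<open>\<delta>\<close>; and \<open>A b\<close> maps the horizontal vector \<open>h - e\<close> to a vector tangent to the orbit
through x, whose defect is again of order \<open>\<delta>\<close>. The constant C does not depend on x.\<close>

lemma frame_defect_derivative_bound:
  assumes fr: "orbit_frame G q B A" and th: "linear \<theta>"
  obtains C where "C \<ge> 0"
    "\<And>x h e CE. x \<in> regular_set G N \<Longrightarrow> dim (orbit_tangent G x) = dim (orbit_tangent G q) \<Longrightarrow>
      (\<Sum>b\<in>B. norm (blinfun_apply (A b) x - b)) \<le> 1 / 2 \<Longrightarrow>
      (\<Sum>b\<in>B. norm (frame_defect B (blinfun_apply (A b) x))) \<le> 1 \<Longrightarrow> CE \<ge> 0 \<Longrightarrow>
      h \<in> g_orthogonal g (orbit_tangent G q) \<Longrightarrow> h - e \<in> horizontal_space g G N x \<Longrightarrow>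
      norm e \<le> CE * norm (\<theta> (\<Sum>b\<in>B. g h (blinfun_apply (A b) x) *\<^sub>R b)) \<Longrightarrow>
      (\<forall>b\<in>B. norm (frame_defect B (blinfun_apply (A b) h))
         \<le> C * (1 + CE) * norm h * (\<Sum>b\<in>B. norm (frame_defect B (blinfun_apply (A b) x))))"
proof -
  obtain Cg where Cg: "Cg > 0" "\<And>u v. norm (g u v) \<le> norm u * norm v * Cg"
    using bounded_bilinear.pos_bounded[OF pseudo_inner_bounded_bilinear[OF pseudo]] by blast
  have "bounded_linear \<theta>" using th linear_conv_bounded_linear by blast
  then obtain Ct where Ct: "Ct > 0" "\<And>v. norm (\<theta> v) \<le> norm v * Ct"
    using bounded_linear.pos_bounded by blast
  obtain Cp where Cp: "Cp > 0" "\<And>v. norm (frame_defect B v) \<le> norm v * Cp"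
    using bounded_linear.pos_bounded[OF bounded_linear_frame_defect[of B]] by blast
  define CA where "CA = (\<Sum>b\<in>B. norm (A b))"
  have fin: "finite B" and nB: "\<And>b. b \<in> B \<Longrightarrow> norm b = 1" and AB: "\<And>b. b \<in> B \<Longrightarrow> A b \<in> lie_algebra G"
    and spB: "span B = orbit_tangent G q"
    using fr unfolding orbit_frame_def by auto
  have CA0: "CA \<ge> 0" unfolding CA_def by (rule sum_nonneg) simp
  have CA: "norm (blinfun_apply (A b) v) \<le> CA * norm v" if "b \<in> B" for b v
  proof -
    have "norm (A b) \<le> CA" unfolding CA_def by (rule member_le_sum[OF that _ fin]) simp
    then show ?thesis using norm_blinfun[of "A b" v] by (meson mult_right_mono norm_ge_zero order.trans)
  qed
  define M where "M = Ct * Cg"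
  have M0: "M \<ge> 0" unfolding M_def using Ct(1) Cg(1) by simp
  define C where "C = 2 * CA * (1 + M) + Cp * CA * M"
  have C0: "C \<ge> 0" unfolding C_def using CA0 M0 Cp(1) by simp
  show thesis
  proof (rule that[OF C0], intro ballI)
    fix x h e CE b
    assume x: "x \<in> regular_set G N" and dim: "dim (orbit_tangent G x) = dim (orbit_tangent G q)"
      and close: "(\<Sum>b\<in>B. norm (blinfun_apply (A b) x - b)) \<le> 1 / 2"
      and d1: "(\<Sum>b\<in>B. norm (frame_defect B (blinfun_apply (A b) x))) \<le> 1" and CE: "CE \<ge> 0"
      and h: "h \<in> g_orthogonal g (orbit_tangent G q)" and h0: "h - e \<in> horizontal_space g G N x"
      and e: "norm e \<le> CE * norm (\<theta> (\<Sum>b\<in>B. g h (blinfun_apply (A b) x) *\<^sub>R b))" and b: "b \<in> B"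
    define \<delta> where "\<delta> = (\<Sum>b\<in>B. norm (frame_defect B (blinfun_apply (A b) x)))"
    have \<delta>0: "\<delta> \<ge> 0" unfolding \<delta>_def by (rule sum_nonneg) simp
    have "norm (\<Sum>b\<in>B. g h (blinfun_apply (A b) x) *\<^sub>R b) \<le> (\<Sum>b\<in>B. norm (g h (blinfun_apply (A b) x) *\<^sub>R b))"
      by (rule norm_sum)
    also have "\<dots> \<le> (\<Sum>b\<in>B. norm h * Cg * norm (frame_defect B (blinfun_apply (A b) x)))"
    proof (rule sum_mono)
      fix c assume c: "c \<in> B"
      let ?a = "blinfun_apply (A c) x"
      have "?a - frame_defect B ?a \<in> span B"
        unfolding frame_defect_def by (simp add: span_sum span_scale span_base)
      then have "g h (?a - frame_defect B ?a) = 0" using h spB unfolding g_orthogonal_def by blast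
      then have "g h ?a = g h (frame_defect B ?a)" by (simp add: pseudo_inner_simps[OF pseudo])
      then show "norm (g h ?a *\<^sub>R c) \<le> norm h * Cg * norm (frame_defect B ?a)"
        using Cg(2)[of h "frame_defect B ?a"] nB[OF c] by (simp add: mult_ac)
    qed
    also have "\<dots> = norm h * Cg * \<delta>" unfolding \<delta>_def by (simp add: sum_distrib_left)
    finally have "norm (\<theta> (\<Sum>b\<in>B. g h (blinfun_apply (A b) x) *\<^sub>R b)) \<le> norm h * Cg * \<delta> * Ct"
      using Ct by (meson mult_right_mono order.trans less_imp_le)
    then have "norm e \<le> CE * (norm h * Cg * \<delta> * Ct)"
      using e CE by (meson mult_left_mono order.trans)
    then have e1: "norm e \<le> CE * M * norm h * \<delta>" unfolding M_def by (simp add: mult_ac)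
    also have "\<dots> \<le> CE * M * norm h * 1"
      by (rule mult_left_mono) (use d1 CE M0 \<delta>_def in auto)
    finally have e2: "norm e \<le> CE * M * norm h" by simp
    have "norm (h - e) \<le> norm h + norm e" by (rule norm_triangle_ineq4)
    also have "\<dots> \<le> (1 + CE * M) * norm h" using e2 by (simp add: algebra_simps)
    finally have nh0: "norm (h - e) \<le> (1 + CE * M) * norm h" .
    have "blinfun_apply (A b) (h - e) \<in> orbit_tangent G x"
      by (rule lie_algebra_maps_horizontal_to_orbit[OF x h0 AB[OF b]])
    then have "norm (frame_defect B (blinfun_apply (A b) (h - e))) \<le> 2 * norm (blinfun_apply (A b) (h - e)) * \<delta>"
      unfolding \<delta>_def by (rule norm_frame_defect_le[OF subspace_lie_algebra fr dim close])
    also have "\<dots> \<le> 2 * (CA * ((1 + CE * M) * norm h)) * \<delta>"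
      using CA[OF b, of "h - e"] mult_left_mono[OF nh0 CA0] \<delta>0 by (intro mult_right_mono) auto
    finally have p1: "norm (frame_defect B (blinfun_apply (A b) (h - e))) \<le> 2 * (CA * ((1 + CE * M) * norm h)) * \<delta>" .
    have "norm (frame_defect B (blinfun_apply (A b) e)) \<le> norm (blinfun_apply (A b) e) * Cp" by (rule Cp(2))
    also have "\<dots> \<le> CA * (CE * M * norm h * \<delta>) * Cp"
      using CA[OF b, of e] mult_left_mono[OF e1 CA0] Cp(1) by (intro mult_right_mono) auto
    finally have p2: "norm (frame_defect B (blinfun_apply (A b) e)) \<le> CA * (CE * M * norm h * \<delta>) * Cp" .
    have "frame_defect B (blinfun_apply (A b) h)
        = frame_defect B (blinfun_apply (A b) (h - e)) + frame_defect B (blinfun_apply (A b) e)"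
      using linear_add[OF bounded_linear.linear[OF bounded_linear_frame_defect], of B "blinfun_apply (A b) (h - e)" "blinfun_apply (A b) e"]
      by (simp add: blinfun.diff_right)
    then have "norm (frame_defect B (blinfun_apply (A b) h))
       \<le> 2 * (CA * ((1 + CE * M) * norm h)) * \<delta> + CA * (CE * M * norm h * \<delta>) * Cp"
      using norm_triangle_ineq p1 p2 by (smt (verit))
    also have "\<dots> = (2 * CA * (1 + CE * M) + Cp * CA * (CE * M)) * (norm h * \<delta>)" by (simp add: algebra_simps)
    also have "\<dots> \<le> C * (1 + CE) * (norm h * \<delta>)"
    proof (rule mult_right_mono)
      have "C * (1 + CE) = 2 * CA * (1 + CE * M) + Cp * CA * (CE * M) + (2 * CA * (CE + M) + Cp * CA * M)"
        unfolding C_def by (simp add: algebra_simps)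
      moreover have "2 * CA * (CE + M) + Cp * CA * M \<ge> 0" using CA0 CE M0 Cp(1) by simp
      ultimately show "2 * CA * (1 + CE * M) + Cp * CA * (CE * M) \<le> C * (1 + CE)" by linarith
    qed (use \<delta>0 in simp)
    finally show "norm (frame_defect B (blinfun_apply (A b) h))
         \<le> C * (1 + CE) * norm h * (\<Sum>b\<in>B. norm (frame_defect B (blinfun_apply (A b) x)))"
      unfolding \<delta>_def by (simp add: mult_ac)
  qed
qed

text \<open>The composite of \<open>\<theta>\<close> with \<open>v \<mapsto> (\<Sum>b\<in>B. g v b *\<^sub>R b)\<close> is a projection along the complement \<open>K\<^sub>q\<close>; the slice
through q is cut out as its zero set.\<close>

lemma frame_projection_eq_0_iff:
  assumes fr: "orbit_frame G q B A"
    and th: "linear \<theta>" "\<And>y. y \<in> span B \<Longrightarrow> (\<Sum>b\<in>B. g (\<theta> y) b *\<^sub>R b) = y"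
  shows "\<theta> (\<Sum>b\<in>B. g v b *\<^sub>R b) = 0 \<longleftrightarrow> v \<in> g_orthogonal g (orbit_tangent G q)"
proof
  have fin: "finite B" and ortho: "pairwise orthogonal B" and nB: "\<And>b. b \<in> B \<Longrightarrow> norm b = 1"
    and sp: "span B = orbit_tangent G q"
    using fr unfolding orbit_frame_def by auto
  have ind: "independent B"
    using pairwise_orthogonal_independent[OF ortho] nB by force
  have bV: "b \<in> orbit_tangent G q" if "b \<in> B" for b using span_base[OF that] sp by simp
  {
    assume 0: "\<theta> (\<Sum>b\<in>B. g v b *\<^sub>R b) = 0"
    have "(\<Sum>b\<in>B. g v b *\<^sub>R b) \<in> span B" by (intro span_sum span_scale span_base)
    from th(2)[OF this] have "(\<Sum>b\<in>B. g v b *\<^sub>R b) = 0" unfolding 0 by (simp add: pseudo_inner_simps[OF pseudo])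
    then have z: "g v b = 0" if "b \<in> B" for b
      using independentD[OF ind fin order_refl, of "\<lambda>b. g v b" b] that by blast
    have "span B \<subseteq> {w. g v w = 0}"
      by (rule span_minimal) (use z in \<open>auto simp: subspace_def pseudo_inner_simps[OF pseudo]\<close>)
    then show "v \<in> g_orthogonal g (orbit_tangent G q)" unfolding g_orthogonal_def using sp by blast
  }
  assume v: "v \<in> g_orthogonal g (orbit_tangent G q)"
  have "g v b = 0" if "b \<in> B" for b using v bV[OF that] unfolding g_orthogonal_def by blast
  then have "(\<Sum>b\<in>B. g v b *\<^sub>R b) = 0" by simp
  then show "\<theta> (\<Sum>b\<in>B. g v b *\<^sub>R b) = 0" using linear_0[OF th(1)] by simp
qed

text \<open>Move from q to the given point of the slice along the image of a straight segment in the chart. The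
velocity is tangent to N and orthogonal to the orbit through q, so the defects of the frame vectors
satisfy a linear differential inequality along this curve, and they vanish at q.\<close>

lemma orbit_tangent_constant_on_slice:
  assumes q: "q \<in> regular_set G N"
    and ch: "submanifold_chart N S U V \<phi> \<psi> (tangent_space N q)" "q \<in> S"
    and Sreg: "S \<subseteq> regular_set G N" "\<And>x. x \<in> S \<Longrightarrow> dim (orbit_tangent G x) = dim (orbit_tangent G q)"
    and fr: "orbit_frame G q B A"
    and th: "linear \<theta>" "\<And>y. \<theta> y \<in> tangent_space N q" "\<And>y. y \<in> span B \<Longrightarrow> (\<Sum>b\<in>B. g (\<theta> y) b *\<^sub>R b) = y"
    and mu: "\<And>v. \<mu> v = \<theta> (\<Sum>b\<in>B. g v b *\<^sub>R b)"
    and pres: "\<And>x v. x \<in> U \<Longrightarrow> \<mu> (frechet_derivative \<phi> (at x) v) = \<mu> v" and mq: "\<mu> (\<phi> q) = 0"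
    and id: "frechet_derivative \<psi> (at (\<phi> q)) = (\<lambda>v. v)"
  obtains r where "r > 0" "ball (\<phi> q) r \<subseteq> V"
    "\<And>z. z \<in> ball (\<phi> q) r \<Longrightarrow> z \<in> tangent_space N q \<Longrightarrow> \<mu> z = 0 \<Longrightarrow> orbit_tangent G (\<psi> z) = orbit_tangent G q"
proof -
  let ?T = "tangent_space N q"
  let ?z0 = "\<phi> q"
  have S: "S \<subseteq> U" "open U" "open V" and h: "homeomorphism U V \<phi> \<psi>" and sm: "smooth_on U \<phi>" "smooth_on V \<psi>"
    and T: "subspace ?T" "\<phi> ` S = ?T \<inter> V"
    using ch(1) unfolding submanifold_chart_def by auto
  have fin: "finite B" and AB: "\<And>b. b \<in> B \<Longrightarrow> blinfun_apply (A b) q = b"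
    using fr unfolding orbit_frame_def by auto
  have z0: "?z0 \<in> V" "?z0 \<in> ?T" "\<psi> ?z0 = q" using T(2) ch(2) S(1) homeomorphism_apply1[OF h, of q] by auto
  have blt: "bounded_linear \<theta>" using th(1) linear_conv_bounded_linear by blast
  have linmu: "linear \<mu>"
  proof -
    have "linear (\<lambda>v. \<Sum>b\<in>B. g v b *\<^sub>R b)"
      by (rule linearI) (simp_all add: pseudo_inner_simps[OF pseudo] scaleR_add_left sum.distrib scaleR_sum_right)
    moreover have "\<mu> = \<theta> \<circ> (\<lambda>v. \<Sum>b\<in>B. g v b *\<^sub>R b)" by (rule ext) (simp add: mu)
    ultimately show ?thesis using linear_compose[OF _ th(1)] by simp
  qed
  define E where "E z = frechet_derivative \<psi> (at z)" for z
  define Fz where "Fz z v = v - \<theta> (\<Sum>b\<in>B. g v b *\<^sub>R b) + \<theta> (\<Sum>b\<in>B. g (E z v) (blinfun_apply (A b) (\<psi> z)) *\<^sub>R b)" for z v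
  have dE: "(\<psi> has_derivative E z) (at z)" if "z \<in> V" for z
    unfolding E_def by (rule smooth_on_has_derivative[OF sm(2) that])
  have linE: "linear (E z)" if "z \<in> V" for z using has_derivative_linear[OF dE[OF that]] .
  have tpsi: "(\<psi> \<longlongrightarrow> q) (nhds ?z0)"
  proof -
    have "\<psi> \<midarrow>?z0\<rightarrow> \<psi> ?z0"
      using smooth_on_continuous[OF sm(2)] z0(1) S(3) by (simp add: continuous_on_eq_continuous_at continuous_within)
    then have "(\<psi> \<longlongrightarrow> \<psi> ?z0) (nhds ?z0)" unfolding tendsto_at_iff_tendsto_nhds .
    then show ?thesis unfolding z0(3) .
  qed
  have tE: "((\<lambda>z. E z v) \<longlongrightarrow> v) (nhds ?z0)" for v
  proof -
    have "(\<lambda>z. E z v) \<midarrow>?z0\<rightarrow> E ?z0 v"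
      using smooth_on_deriv_continuous[OF sm(2), of v] z0(1) S(3)
      unfolding E_def by (simp add: continuous_on_eq_continuous_at continuous_within)
    then have "((\<lambda>z. E z v) \<longlongrightarrow> E ?z0 v) (nhds ?z0)"
      by (rule iffD1[OF tendsto_at_iff_tendsto_nhds[of "\<lambda>z. E z v" ?z0]])
    then show ?thesis unfolding E_def id .
  qed
  \<comment> \<open>At \<open>?z0\<close> the frame vectors are the b themselves and \<open>E\<close> is the identity, so the two \<open>\<theta>\<close>-terms cancel.\<close>
  have tF: "((\<lambda>z. Fz z v) \<longlongrightarrow> v) (nhds ?z0)" for v
  proof -
    have "((\<lambda>z. Fz z v) \<longlongrightarrow> v - \<theta> (\<Sum>b\<in>B. g v b *\<^sub>R b) + \<theta> (\<Sum>b\<in>B. g v (blinfun_apply (A b) q) *\<^sub>R b)) (nhds ?z0)"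
      unfolding Fz_def
      by (intro tendsto_intros bounded_linear.tendsto[OF blt] bounded_bilinear.tendsto[OF pseudo_inner_bounded_bilinear[OF pseudo]]
          bounded_linear.tendsto[OF blinfun.bounded_linear_right] tE tpsi)
    then show ?thesis using AB by simp
  qed
  \<comment> \<open>Near \<open>?z0\<close> the operator \<open>E z\<close> is close to the identity, for which the sum over the basis is \<open>DIM('a)\<close>.\<close>
  define CE where "CE = real DIM('a) + 1"
  have ev1: "\<forall>\<^sub>F z in nhds ?z0. (\<Sum>c\<in>Basis. norm (Fz z c - c)) < 1 / 2"
    by (rule order_tendstoD(2)[OF tendsto_norm_linear_sum]) (use tF in auto)
  have "((\<lambda>z. \<Sum>c\<in>Basis. norm (E z c)) \<longlongrightarrow> (\<Sum>c\<in>(Basis::'a set). norm c)) (nhds ?z0)"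
    by (intro tendsto_intros tE)
  then have ev2: "\<forall>\<^sub>F z in nhds ?z0. (\<Sum>c\<in>Basis. norm (E z c)) < CE"
    by (rule order_tendstoD(2)) (simp add: CE_def)
  have ev3: "\<forall>\<^sub>F z in nhds ?z0. (\<Sum>b\<in>B. norm (blinfun_apply (A b) (\<psi> z) - b)) < 1 / 2"
    by (rule order_tendstoD(2)[OF orbit_frame_tendsto(1)[OF fr tpsi]]) simp
  have ev4: "\<forall>\<^sub>F z in nhds ?z0. (\<Sum>b\<in>B. norm (frame_defect B (blinfun_apply (A b) (\<psi> z)))) < 1"
    by (rule order_tendstoD(2)[OF orbit_frame_tendsto(2)[OF fr tpsi]]) simp
  have ev5: "\<forall>\<^sub>F z in nhds ?z0. z \<in> V" using eventually_nhds_in_open[OF S(3) z0(1)] .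
  obtain r where r: "r > 0" "\<And>z. dist z ?z0 < r \<Longrightarrow> (\<Sum>c\<in>Basis. norm (Fz z c - c)) < 1 / 2 \<and>
      (\<Sum>c\<in>Basis. norm (E z c)) < CE \<and> (\<Sum>b\<in>B. norm (blinfun_apply (A b) (\<psi> z) - b)) < 1 / 2 \<and>
      (\<Sum>b\<in>B. norm (frame_defect B (blinfun_apply (A b) (\<psi> z)))) < 1 \<and> z \<in> V"
    using eventually_conj[OF ev1 eventually_conj[OF ev2 eventually_conj[OF ev3 eventually_conj[OF ev4 ev5]]]]
    unfolding eventually_nhds_metric by blast
  obtain C where C: "C \<ge> 0"
    "\<And>x h e CE. x \<in> regular_set G N \<Longrightarrow> dim (orbit_tangent G x) = dim (orbit_tangent G q) \<Longrightarrow>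
      (\<Sum>b\<in>B. norm (blinfun_apply (A b) x - b)) \<le> 1 / 2 \<Longrightarrow>
      (\<Sum>b\<in>B. norm (frame_defect B (blinfun_apply (A b) x))) \<le> 1 \<Longrightarrow> CE \<ge> 0 \<Longrightarrow>
      h \<in> g_orthogonal g (orbit_tangent G q) \<Longrightarrow> h - e \<in> horizontal_space g G N x \<Longrightarrow>
      norm e \<le> CE * norm (\<theta> (\<Sum>b\<in>B. g h (blinfun_apply (A b) x) *\<^sub>R b)) \<Longrightarrow>
      (\<forall>b\<in>B. norm (frame_defect B (blinfun_apply (A b) h))
         \<le> C * (1 + CE) * norm h * (\<Sum>b\<in>B. norm (frame_defect B (blinfun_apply (A b) x))))"
    using frame_defect_derivative_bound[OF fr th(1)] by blast
  have CE0: "CE \<ge> 0" unfolding CE_def by simp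
  have Eb: "norm (E z v) \<le> CE * norm v" if z: "dist z ?z0 < r" for z v
  proof -
    have "z \<in> V" using r(2)[OF z] by blast
    then have "norm (E z v) \<le> norm v * (\<Sum>c\<in>Basis. norm (E z c))" by (rule norm_linear_le_sum_Basis[OF linE])
    also have "\<dots> \<le> norm v * CE" by (rule mult_left_mono) (use r(2)[OF z] in auto)
    finally show ?thesis by (simp add: mult.commute)
  qed
  have main: "norm (frame_defect B (blinfun_apply (A b) (E z w)))
      \<le> (C * (1 + 2 * CE) * (CE * norm w)) * (\<Sum>b\<in>B. norm (frame_defect B (blinfun_apply (A b) (\<psi> z))))"
    if z: "dist z ?z0 < r" "z \<in> ?T" and w: "w \<in> ?T" "\<mu> w = 0" and b: "b \<in> B" for z w b
  proof -
    have zV: "z \<in> V" using r(2)[OF z(1)] by blast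
    define x where "x = \<psi> z"
    have "z \<in> \<phi> ` S" using T(2) z(2) zV by blast
    then obtain x' where x': "x' \<in> S" "z = \<phi> x'" by blast
    then have "x = x'" unfolding x_def using homeomorphism_apply1[OF h, of x'] S(1) by auto
    then have x: "x \<in> S" "\<phi> x = z" using x' by auto
    have xU: "x \<in> U" using x(1) S(1) by blast
    have Tx: "tangent_space N x = E z ` ?T" unfolding E_def x(2)[symmetric] by (rule tangent_space_chart[OF ch(1) x(1)])
    have hT: "E z w \<in> tangent_space N x" unfolding Tx using w(1) by blast
    have "\<mu> (E z w) = \<mu> w"
      using pres[OF xU, of "E z w"] smooth_homeomorphism_derivatives(2)[OF h S(2,3) sm xU, of w]
      unfolding E_def x(2) by simp
    then have hK: "E z w \<in> g_orthogonal g (orbit_tangent G q)"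
      using w(2) frame_projection_eq_0_iff[OF fr th(1,3), of "E z w"] unfolding mu by simp
    have near: "norm (v - \<theta> (\<Sum>b\<in>B. g v b *\<^sub>R b) + \<theta> (\<Sum>b\<in>B. g (E z v) (blinfun_apply (A b) x) *\<^sub>R b) - v) \<le> norm v / 2" for v
    proof -
      have n1: "linear (\<lambda>v. \<Sum>b\<in>B. g v b *\<^sub>R b)" "linear (\<lambda>v. \<Sum>b\<in>B. g v (blinfun_apply (A b) x) *\<^sub>R b)"
        by (rule linearI, simp_all add: pseudo_inner_simps[OF pseudo] scaleR_add_left sum.distrib scaleR_sum_right)+
      have "linear (\<lambda>v. Fz z v - v)"
        using linear_compose_sub[OF linear_compose_add[OF linear_compose_sub[OF linear_id linear_compose[OF n1(1) th(1)]]
          linear_compose[OF linear_compose[OF linE[OF zV] n1(2)] th(1)]] linear_id]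
        unfolding Fz_def x_def by (simp add: o_def id_def)
      then have "norm (Fz z v - v) \<le> norm v * (\<Sum>c\<in>Basis. norm (Fz z c - c))" by (rule norm_linear_le_sum_Basis)
      also have "\<dots> \<le> norm v * (1 / 2)" by (rule mult_left_mono) (use r(2)[OF z(1)] in auto)
      finally show ?thesis unfolding Fz_def x_def by simp
    qed
    have reg: "x \<in> regular_set G N" "dim (orbit_tangent G x) = dim (orbit_tangent G q)" using Sreg x(1) by auto
    have cl: "(\<Sum>b\<in>B. norm (blinfun_apply (A b) x - b)) \<le> 1 / 2"
      "(\<Sum>b\<in>B. norm (frame_defect B (blinfun_apply (A b) x))) \<le> 1"
      using r(2)[OF z(1)] unfolding x_def by auto
    obtain v where v: "E z w - E z v \<in> horizontal_space g G N x"
      "norm v \<le> 2 * norm (\<theta> (\<Sum>b\<in>B. g (E z w) (blinfun_apply (A b) x) *\<^sub>R b))"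
      by (rule horizontal_correction[OF reg fr cl(1) T(1) th linE[OF zV] _ near hT]) (use Tx in auto)
    have "norm (E z v) \<le> CE * norm v" by (rule Eb[OF z(1)])
    also have "\<dots> \<le> CE * (2 * norm (\<theta> (\<Sum>b\<in>B. g (E z w) (blinfun_apply (A b) x) *\<^sub>R b)))"
      by (rule mult_left_mono[OF v(2) CE0])
    finally have e: "norm (E z v) \<le> (2 * CE) * norm (\<theta> (\<Sum>b\<in>B. g (E z w) (blinfun_apply (A b) x) *\<^sub>R b))" by simp
    have "norm (frame_defect B (blinfun_apply (A b) (E z w)))
         \<le> C * (1 + 2 * CE) * norm (E z w) * (\<Sum>b\<in>B. norm (frame_defect B (blinfun_apply (A b) x)))"
      using C(2)[OF reg cl _ hK v(1) e] CE0 b by simp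
    also have "\<dots> \<le> (C * (1 + 2 * CE) * (CE * norm w)) * (\<Sum>b\<in>B. norm (frame_defect B (blinfun_apply (A b) x)))"
      using C(1) CE0 by (intro mult_right_mono mult_left_mono Eb[OF z(1)] sum_nonneg) auto
    finally show ?thesis unfolding x_def .
  qed
  have "orbit_tangent G (\<psi> z) = orbit_tangent G q"
    if z: "z \<in> ball ?z0 r" "z \<in> ?T" "\<mu> z = 0" for z
  proof -
    define w where "w = z - ?z0"
    have w: "w \<in> ?T" "\<mu> w = 0" "norm w < r"
      unfolding w_def using z z0(2) mq subspace_diff[OF T(1)] linear_diff[OF linmu] by (auto simp: dist_norm norm_minus_commute)
    define u where "u b t = frame_defect B (blinfun_apply (A b) (\<psi> (?z0 + t *\<^sub>R w)))" for b t
    define u' where "u' b t = frame_defect B (blinfun_apply (A b) (E (?z0 + t *\<^sub>R w) w))" for b t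
    have seg: "dist (?z0 + t *\<^sub>R w) ?z0 < r" "?z0 + t *\<^sub>R w \<in> ?T" if t: "0 \<le> t" "t \<le> 1" for t
    proof -
      have "\<bar>t\<bar> * norm w \<le> 1 * norm w" using t by (intro mult_right_mono) auto
      then show "dist (?z0 + t *\<^sub>R w) ?z0 < r" using w(3) by (simp add: dist_norm)
      show "?z0 + t *\<^sub>R w \<in> ?T" by (intro subspace_add[OF T(1)] subspace_scale[OF T(1)] z0(2) w(1))
    qed
    have der: "(u b has_vector_derivative u' b t) (at t)" if t: "0 \<le> t" "t \<le> 1" for b t
    proof -
      have "?z0 + t *\<^sub>R w \<in> V" using r(2)[OF seg(1)[OF t]] by blast
      then have d: "(\<psi> has_derivative E (?z0 + t *\<^sub>R w)) (at (?z0 + t *\<^sub>R w))" by (rule dE)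
      have 1: "((\<lambda>t. ?z0 + t *\<^sub>R w) has_derivative (\<lambda>s. s *\<^sub>R w)) (at t)"
        by (auto intro!: derivative_eq_intros)
      have "((\<lambda>t. \<psi> (?z0 + t *\<^sub>R w)) has_vector_derivative E (?z0 + t *\<^sub>R w) w) (at t)"
        using has_derivative_compose[OF 1 d] linear_cmul[OF has_derivative_linear[OF d]]
        by (simp add: has_vector_derivative_def)
      from bounded_linear.has_vector_derivative[OF bounded_linear_frame_defect
          bounded_linear.has_vector_derivative[OF blinfun.bounded_linear_right this]]
      show ?thesis unfolding u_def u'_def .
    qed
    have "u b 1 = 0" if b: "b \<in> B" for b
    proof (rule gronwall_family[where u = u and u' = u' and B = B and K = "C * (1 + 2 * CE) * (CE * norm w)"])
      show "norm (u' b t) \<le> C * (1 + 2 * CE) * (CE * norm w) * (\<Sum>c\<in>B. norm (u c t))"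
        if "b \<in> B" "0 \<le> t" "t \<le> 1" for b t
        unfolding u_def u'_def by (rule main[OF seg[OF that(2,3)] w(1,2) that(1)])
      show "u b 0 = 0" if "b \<in> B" for b
        unfolding u_def using z0(3) AB[OF that] frame_defect_eq_0_iff[OF fr, of b] span_base[OF that] fr
        unfolding orbit_frame_def by simp
    qed (use der fin b C(1) CE0 in auto)
    then have inV: "blinfun_apply (A b) (\<psi> z) \<in> orbit_tangent G q" if "b \<in> B" for b
      using that frame_defect_eq_0_iff[OF fr] unfolding u_def w_def by simp
    have zr: "dist z ?z0 < r" using z(1) by (simp add: dist_commute)
    have "z \<in> \<phi> ` S" using T(2) z(2) r(2)[OF zr] by blast
    then have xS: "\<psi> z \<in> S" using homeomorphism_apply1[OF h] S(1) by auto
    have "orbit_tangent G (\<psi> z) \<subseteq> orbit_tangent G q"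
    proof
      fix y assume y: "y \<in> orbit_tangent G (\<psi> z)"
      have "(\<Sum>b\<in>B. norm (blinfun_apply (A b) (\<psi> z) - b)) \<le> 1 / 2" using r(2)[OF zr] by simp
      then obtain c where "y = (\<Sum>b\<in>B. (c \<bullet> b) *\<^sub>R blinfun_apply (A b) (\<psi> z))"
        using orbit_frame_spans[OF subspace_lie_algebra fr Sreg(2)[OF xS] _ y] by metis
      then show "y \<in> orbit_tangent G q"
        using inV by (auto intro!: subspace_sum[OF subspace_orbit] subspace_scale[OF subspace_orbit])
    qed
    then show ?thesis
      by (rule subspace_dim_equal[OF subspace_orbit subspace_orbit]) (simp add: Sreg(2)[OF xS])
  qed
  moreover have "ball ?z0 r \<subseteq> V" using r(2) by (auto simp: dist_commute)
  ultimately show thesis using that[of r] r(1) by blast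
qed

text \<open>The leaf through q is a small piece of the intersection of N with the linear subspace \<open>K\<^sub>q\<close>. Its
tangent spaces are the intersections of those of N with \<open>K\<^sub>q\<close>, which are the horizontal spaces because
\<open>K\<^sub>x = K\<^sub>q\<close> along it.\<close>

theorem horizontal_distribution_integrable: "weakly_polar g G N"
  unfolding weakly_polar_def integrable_distribution_def
proof
  fix q assume q: "q \<in> regular_set G N"
  have qN: "q \<in> topspace N" using q by (rule regular_in_topspace)
  let ?T = "tangent_space N q"
  let ?K = "g_orthogonal g (orbit_tangent G q)"
  obtain k where k: "submanifold k N" using nondegenerate unfolding nondegenerate_submanifold_def by blast
  obtain O' where O': "openin N O'" "q \<in> O'" "O' \<subseteq> regular_set G N"
    "\<And>x. x \<in> O' \<Longrightarrow> dim (orbit_tangent G x) = dim (orbit_tangent G q)"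
    using regular_set_openin[OF q] by metis
  obtain B A where fr: "orbit_frame G q B A" using orbit_frame_exists[OF subspace_lie_algebra] by metis
  have B: "pairwise orthogonal B" "\<And>b. b \<in> B \<Longrightarrow> norm b = 1" "span B = orbit_tangent G q"
    using fr unfolding orbit_frame_def by auto
  have BT: "span B \<subseteq> ?T" unfolding B(3) by (rule orbit_subset_tangent[OF qN])
  obtain \<theta> where th: "linear \<theta>" "\<And>y. \<theta> y \<in> ?T" "\<And>y. y \<in> span B \<Longrightarrow> (\<Sum>b\<in>B. g (\<theta> y) b *\<^sub>R b) = y"
    using transversal_section[OF pseudo subspace_tangent[OF qN] nondegenerate_tangent[OF qN] BT B(1,2)] by blast
  define \<mu> where "\<mu> v = \<theta> (\<Sum>b\<in>B. g v b *\<^sub>R b)" for v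
  have mu0: "\<mu> v = 0 \<longleftrightarrow> v \<in> ?K" for v
    unfolding \<mu>_def by (rule frame_projection_eq_0_iff[OF fr th(1,3)])
  have linmu: "linear \<mu>"
  proof -
    have "linear (\<lambda>v. \<Sum>b\<in>B. g v b *\<^sub>R b)"
      by (rule linearI) (simp_all add: pseudo_inner_simps[OF pseudo] scaleR_add_left sum.distrib scaleR_sum_right)
    from linear_compose[OF this th(1)] show ?thesis unfolding \<mu>_def by (simp add: o_def)
  qed
  have mumu: "\<mu> (\<mu> v) = \<mu> v" for v
  proof -
    have "(\<Sum>b\<in>B. g v b *\<^sub>R b) \<in> span B" by (intro span_sum span_scale span_base)
    from th(3)[OF this] show ?thesis unfolding \<mu>_def by simp
  qed
  have muT: "\<mu> v \<in> ?T" for v unfolding \<mu>_def by (rule th(2))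
  obtain S U V \<phi> \<psi> where ch: "submanifold_chart N S U V \<phi> \<psi> ?T" "q \<in> S" and SO: "S \<subseteq> O'"
    and pres: "\<And>x. x \<in> U \<Longrightarrow> \<mu> (\<phi> x) = \<mu> x" and id: "frechet_derivative \<psi> (at (\<phi> q)) = (\<lambda>v. v)"
    using projection_adapted_chart[OF k O'(1,2) linmu mumu muT] by blast
  have S: "subtopology N S = top_of_set S" "S \<subseteq> U" "open U" "open V"
    and h: "homeomorphism U V \<phi> \<psi>" and sm: "smooth_on U \<phi>" "smooth_on V \<psi>"
    and T: "\<phi> ` S = ?T \<inter> V"
    using ch(1) unfolding submanifold_chart_def by auto
  have dpres: "\<mu> (frechet_derivative \<phi> (at x) v) = \<mu> v" if x: "x \<in> U" for x v
  proof -
    have bl: "bounded_linear \<mu>" using linmu linear_conv_bounded_linear by blast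
    have "((\<lambda>x. \<mu> (\<phi> x)) has_derivative (\<lambda>v. \<mu> (frechet_derivative \<phi> (at x) v))) (at x)"
      by (rule bounded_linear.has_derivative[OF bl smooth_on_has_derivative[OF sm(1) x]])
    then have "(\<mu> has_derivative (\<lambda>v. \<mu> (frechet_derivative \<phi> (at x) v))) (at x)"
      by (rule has_derivative_transform_within_open[OF _ S(3) x]) (rule pres)
    from fun_cong[OF has_derivative_unique[OF this bounded_linear_imp_has_derivative[OF bl]]]
    show ?thesis .
  qed
  have qU: "q \<in> U" using ch(2) S(2) by blast
  have mq: "\<mu> (\<phi> q) = 0" using pres[OF qU] mu0 position_perp_orbit by simp
  obtain r where r: "r > 0" "ball (\<phi> q) r \<subseteq> V"
    "\<And>z. z \<in> ball (\<phi> q) r \<Longrightarrow> z \<in> ?T \<Longrightarrow> \<mu> z = 0 \<Longrightarrow> orbit_tangent G (\<psi> z) = orbit_tangent G q"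
    using orbit_tangent_constant_on_slice[OF q ch _ _ fr th \<mu>_def dpres mq id] SO O'(3,4) by blast
  let ?U = "U \<inter> \<phi> -` ball (\<phi> q) r"
  let ?S = "S \<inter> ?U"
  let ?L = "?S \<inter> {x. \<mu> x = 0}"
  have chS: "submanifold_chart N ?S ?U (ball (\<phi> q) r) \<phi> \<psi> ?T"
    by (rule submanifold_chart_restrict[OF ch(1) open_ball r(2)])
  have chL: "submanifold_chart (top_of_set ?L) ?L ?U (ball (\<phi> q) r) \<phi> \<psi> (?T \<inter> {x. \<mu> x = 0})"
    by (rule submanifold_chart_slice[OF chS linmu]) (use pres in auto)
  have "tangent_space (top_of_set ?L) x = horizontal_space g G N x" if x: "x \<in> ?L" for x
  proof -
    let ?E = "frechet_derivative \<psi> (at (\<phi> x))"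
    have xU: "x \<in> U" and xS: "x \<in> ?S" using x by auto
    \<comment> \<open>The chart commutes with \<open>\<mu>\<close>, hence so does its derivative: kernel directions stay in the kernel.\<close>
    have muE: "\<mu> (?E w) = \<mu> w" for w
      using dpres[OF xU, of "?E w"] smooth_homeomorphism_derivatives(2)[OF h S(3,4) sm xU, of w] by simp
    have "\<phi> x \<in> ?T" "\<mu> (\<phi> x) = 0" using T x pres[OF xU] by auto
    then have "orbit_tangent G (\<psi> (\<phi> x)) = orbit_tangent G q" using r(3) x by blast
    then have Vx: "orbit_tangent G x = orbit_tangent G q" using homeomorphism_apply1[OF h xU] by simp
    have "tangent_space (top_of_set ?L) x = ?E ` (?T \<inter> {x. \<mu> x = 0})"
      by (rule tangent_space_chart[OF chL x])
    also have "\<dots> = ?E ` ?T \<inter> {x. \<mu> x = 0}" using muE by auto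
    also have "\<dots> = tangent_space N x \<inter> ?K"
      unfolding tangent_space_chart[OF chS xS] using mu0 by auto
    finally show ?thesis unfolding horizontal_space_def Vx .
  qed
  moreover have "submanifold (dim (?T \<inter> {x. \<mu> x = 0})) (top_of_set ?L)"
    by (rule submanifold_of_chart[OF chL])
  moreover have "q \<in> ?L" using ch(2) qU r(1) mu0 position_perp_orbit by auto
  moreover have "?L \<subseteq> regular_set G N" using SO O'(3) by blast
  moreover have "continuous_map (top_of_set ?L) N id"
    by (rule continuous_map_into_slice[OF S(1)]) auto
  ultimately show "\<exists>k L. submanifold k L \<and> q \<in> topspace L \<and> topspace L \<subseteq> regular_set G N \<and>
        continuous_map L N id \<and> (\<forall>x\<in>topspace L. tangent_space L x = horizontal_space g G N x)"
    by (intro exI[of _ "dim (?T \<inter> {x. \<mu> x = 0})"] exI[of _ "top_of_set ?L"] conjI ballI) simp_all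
qed

end

theorem proposition2p13:
  fixes g :: "'a::euclidean_space \<Rightarrow> 'a \<Rightarrow> real"
    and s :: nat
    and G :: "('a \<Rightarrow>\<^sub>L 'a) topology"
    and R :: "'a \<Rightarrow> 'a \<Rightarrow> 'a \<Rightarrow> 'a"
    and R\<^sub>\<Lambda> :: "('a \<Rightarrow>\<^sub>L 'a) \<Rightarrow> ('a \<Rightarrow>\<^sub>L 'a)"
    and N :: "'a topology"
  assumes "pseudo_inner g" and "signature g = s"
    and "lie_subgroup_SO g G"
    and "algebraic_curvature_tensor g R"
    and "span {Blinfun (R u v) |u v. True} = lie_algebra G"
    and "is_curvature_operator g R R\<^sub>\<Lambda>" and "psd_curvature_operator g R\<^sub>\<Lambda>"
    and "nondegenerate_submanifold g N"
    and "locally_invariant G N"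
  shows "weakly_polar g G N \<and>
    (\<forall>q\<in>regular_set G N. \<forall>\<xi>\<in>normal_vectors g N q.
       shape_operator g N q \<xi> ` orbit_tangent G q \<subseteq> orbit_tangent G q)"
proof -
  interpret psd_curvature_action g G R R\<^sub>\<Lambda> N
    by unfold_locales (use assms in auto)
  show ?thesis using horizontal_distribution_integrable shape_operator_invariant by blast
qed

end
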